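(* Let $\varphi:\mathbb R\to\mathbb R$ be a non-constant real-analytic $1$-periodic function, let $0<\mu<1$, and let $\lambda\ge2$ be an integer. (1) There exists $\beta=\beta(\lambda,\mu,\varphi)>0$ such that $$\sup_{n\in\mathbb Z}\left|\int_0^1 e^{2\pi i n\theta}e^{itW_{\mu,\lambda}(\theta)}\,d\theta\right|\lesssim|t|^{-\beta},\qquad |t|\to\infty.$$ (2) There exist $c(\varphi)>0$ (depending only on $\varphi$) and $\lambda_*(\mu,\varphi)\ge2$ (depending only on $\mu$ and $\varphi$) such that, for every integer $\lambda\ge\lambda_*(\mu,\varphi)$, $$\sup_{n\in\mathbb Z}\left|\int_0^1 e^{2\pi i n\theta}e^{itW_{\mu,\lambda}(\theta)}\,d\theta\right|\lesssim|t|^{-c(\varphi)\frac{\log\lambda}{|\log\mu|}},\qquad |t|\to\infty.$$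
   Context: For $\varphi,\mu,\lambda$ as in the claim, the Weierstrass function is $W_{\mu,\lambda}(\theta)=W_{\mu,\lambda}^{(\varphi)}(\theta)=\sum_{j=0}^\infty\mu^j\varphi(\lambda^j\theta)$. The notation $\lesssim$ as $|t|\to\infty$ means: bounded by a constant times the right-hand side for all sufficiently large $|t|$; the constant and the threshold may depend on $\varphi,\mu,\lambda$ but not on $n$ or $t$. *)

theory Defs
  imports "HOL-Analysis.Analysis" "HOL-Library.Landau_Symbols"
begin

(* The library's analytic_on is complex analyticity; this is the usual notion on the real line:
   near every point the function is the sum of a convergent power series. *)
definition real_analytic :: "(real \<Rightarrow> real) \<Rightarrow> bool" where
  "real_analytic f \<longleftrightarrow>
     (\<forall>x0. \<exists>a :: nat \<Rightarrow> real. \<exists>r > 0. \<forall>x. \<bar>x - x0\<bar> < r \<longrightarrow> (\<lambda>k. a k * (x - x0) ^ k) sums f x)"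

(* For bounded \<phi> and 0 < \<mu> < 1 the series converges absolutely. *)
definition weierstrass :: "(real \<Rightarrow> real) \<Rightarrow> real \<Rightarrow> nat \<Rightarrow> real \<Rightarrow> real" where
  "weierstrass \<phi> \<mu> l \<theta> = (\<Sum>j. \<mu> ^ j * \<phi> (real l ^ j * \<theta>))"

definition osc_integral :: "(real \<Rightarrow> real) \<Rightarrow> real \<Rightarrow> nat \<Rightarrow> int \<Rightarrow> real \<Rightarrow> complex" where
  "osc_integral \<phi> \<mu> l n t =
     integral {0..1} (\<lambda>\<theta>. exp (2 * of_real pi * \<i> * of_int n * of_real \<theta>) *
                          exp (\<i> * of_real t * of_real (weierstrass \<phi> \<mu> l \<theta>)))"

(* The integrand of osc_integral has modulus 1, so the family below is bounded by 1 and the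
   supremum, taken in the conditionally complete type real, is the true one. *)
definition sup_osc :: "(real \<Rightarrow> real) \<Rightarrow> real \<Rightarrow> nat \<Rightarrow> real \<Rightarrow> real" where
  "sup_osc \<phi> \<mu> l t = (SUP n. cmod (osc_integral \<phi> \<mu> l n t))"

end

theory Submission
  imports Defs
begin

text \<open>Write \<open>W\<close> for the Weierstrass function and \<open>e(x) = cis (2 * pi * n * x)\<close>. Since
  \<open>W(x) = \<phi>(x) + \<mu> * W(l * x)\<close>, averaging over the \<open>l\<close> inverse branches of \<open>x \<mapsto> l * x\<close> turns
  \<open>\<integral> f cis(s W)\<close> into \<open>\<integral> (T f) cis(s \<mu> W)\<close>, where \<open>T f\<close> (\<open>transfer\<close>) averages \<open>cis(s \<phi>) f\<close> over
  the preimages. So the oscillatory integral is at most the \<open>L\<^sup>2\<close> norm of any number of transfer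
  operators, with parameters \<open>t, t \<mu>, t \<mu>\<^sup>2, \<dots>\<close>, applied to \<open>e\<close>, and cancellation has to be
  found in these averages.

  By periodicity the square of \<open>\<parallel>T f\<parallel>\<close> is the mean over \<open>k < l\<close> of the integrals of
  \<open>cis(s (\<phi>(y) - \<phi>(y + k/l))) f(y) cnj(f(y + k/l))\<close>. Integration by parts makes such an integral small
  except where \<open>\<phi>'(y)\<close> nearly equals \<open>\<phi>'(y + k/l)\<close> (\<open>oscillatory_integral_circle\<close>,
  \<open>transfer_L2_bound\<close>). Apart from its modulus, the amplitude enters only through \<open>f' - \<i> \<nu> f\<close>
  with an arbitrary \<open>\<nu>\<close>, because the two factors turn in opposite directions; this expression vanishes
  for \<open>f = e\<close> and a suitable \<open>\<nu>\<close>, which is why all bounds are uniform in \<open>n\<close>. It remains to show that near-coincidences of \<open>\<phi>'\<close> along the branches are rare. They are measured smoothly by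
  \<open>bump \<delta>\<close> of the difference, so that no sublevel set needs to be described.

  For large \<open>l\<close> the operators are iterated. A nonconstant analytic periodic function satisfies
  \<open>\<integral> bump \<eta> (f - b) \<le> C \<eta>\<^sup>\<kappa>\<close> uniformly in \<open>b\<close> (\<open>analytic_sublevel_estimate\<close>); applied to \<open>\<phi>'\<close> with
  \<open>\<delta> = l powr (-1/8)\<close> it yields a gain of \<open>l powr (-2 c)\<close> in the squared norm at each step, and there
  are about \<open>ln \<bar>t\<bar> / \<bar>ln \<mu>\<bar>\<close> steps before the parameter drops below \<open>l\<close>
  (\<open>iterated_transfer_decay\<close>, \<open>large_base_decay\<close>).

  For small \<open>l\<close> the constants in these steps are not compensated by powers of \<open>l\<close>. Instead one step
  is taken with base \<open>l\<^sup>m\<close> and the partial sum \<open>\<phi>\<^sub>m\<close> of \<open>m\<close> terms of \<open>W\<close>, where \<open>m\<close> is a small multiple of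
  \<open>ln \<bar>t\<bar>\<close>. What is needed is that near-coincidences of \<open>\<phi>\<^sub>m'\<close> along the \<open>l\<^sup>m\<close> branches are
  exponentially rare in \<open>m\<close>, at some exponentially small scale. For derivatives of \<open>\<phi>\<^sub>m\<close> of a high order \<open>p\<close>,
  with \<open>\<mu> l\<^sup>p > 1\<close>, the sum is dominated by its last terms and its rescaled limit along the inverse
  branches is a series \<open>Z\<close>. Either \<open>Z\<close> is 1-periodic, and then the derivative at the end of a branch
  is, up to a quantity common to all branches, the value there of a fixed analytic function, to which the
  sublevel estimate applies; or \<open>Z\<close> distinguishes two branches above every point, and then, as the digits
  of the branch are fixed block by block, the proportion of branches on which the sum can be near a given
  value shrinks by a fixed factor per block (\<open>inverse_sum_nonconcentration\<close>). Finally the order of the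
  derivative is lowered one at a time: a function can be small only where its derivative is small, or on a short set
  (\<open>integral_bump_descent\<close>).\<close>

section \<open>Integration over the circle\<close>

lemma antiderivative_on_line:
  fixes h :: "real \<Rightarrow> 'a::banach"
  assumes "continuous_on UNIV h"
  obtains H where "\<And>x. (H has_vector_derivative h x) (at x)"
    and "\<And>a b. a \<le> b \<Longrightarrow> integral {a..b} h = H b - H a"
proof -
  define H where "H x = integral {0..x} h - integral {x..0} h" for x
  have cont: "continuous_on {a..b} h" for a b
    using assms continuous_on_subset by blast
  have inte: "h integrable_on {a..b}" for a b
    by (rule integrable_continuous_real[OF cont])
  have H_eq: "H x = integral {-a..x} h - integral {-a..0} h" if "- a \<le> x" "0 \<le> a" for a x
  proof (cases "0 \<le> x")
    case True
    have "integral {-a..0} h + integral {0..x} h = integral {-a..x} h"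
      using that True by (intro Henstock_Kurzweil_Integration.integral_combine inte) auto
    moreover have "integral {x..0} h = 0"
      using True by (cases "x = 0") auto
    ultimately show ?thesis by (simp add: H_def algebra_simps)
  next
    case False
    have "integral {-a..x} h + integral {x..0} h = integral {-a..0} h"
      using that False by (intro Henstock_Kurzweil_Integration.integral_combine inte) auto
    moreover have "integral {0..x} h = 0"
      using False by auto
    ultimately show ?thesis by (simp add: H_def algebra_simps)
  qed
  have der: "(H has_vector_derivative h x) (at x)" for x
  proof -
    define a where "a = \<bar>x\<bar> + 1"
    have x: "x \<in> {-a<..<a}" and a: "0 \<le> a" by (auto simp: a_def)
    have "((\<lambda>u. integral {-a..u} h) has_vector_derivative h x) (at x within {-a..a})"
      using x by (intro integral_has_vector_derivative cont) auto
    hence "((\<lambda>u. integral {-a..u} h) has_vector_derivative h x) (at x within {-a<..<a})"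
      by (rule has_vector_derivative_within_subset) auto
    hence "((\<lambda>u. integral {-a..u} h) has_vector_derivative h x) (at x)"
      using x by (simp add: at_within_open[of x "{-a<..<a}"])
    hence "((\<lambda>u. integral {-a..u} h - integral {-a..0} h) has_vector_derivative h x) (at x)"
      by (auto intro!: derivative_eq_intros)
    thus ?thesis
      by (rule has_vector_derivative_transform_within_open[of _ _ _ "{-a<..<a}"])
        (use x a H_eq[of a] in auto)
  qed
  have "integral {a..b} h = H b - H a" if "a \<le> b" for a b
    using that der
    by (intro integral_unique fundamental_theorem_of_calculus)
      (auto intro: has_vector_derivative_at_within)
  with der show ?thesis by (rule that)
qed

abbreviation mean :: "(real \<Rightarrow> 'a::banach) \<Rightarrow> 'a" where
  "mean \<equiv> integral {0..1}"

lemma integral_circle_derivative: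
  fixes H :: "real \<Rightarrow> 'a::banach"
  assumes "\<And>x. (H has_vector_derivative h x) (at x)" and "\<And>x. H (x + 1) = H x"
  shows "mean h = 0"
proof -
  have "(h has_integral (H 1 - H 0)) {0..1}"
    using assms(1) by (intro fundamental_theorem_of_calculus) (auto intro: has_vector_derivative_at_within)
  thus ?thesis using assms(2)[of 0] by (simp add: integral_unique)
qed

lemma antiderivative_increment_const:
  fixes H :: "real \<Rightarrow> 'a::banach"
  assumes "\<And>x. (H has_vector_derivative h x) (at x)" and "\<And>x. h (x + 1) = h x"
  shows "H (x + 1) - H x = H 1 - H 0"
proof -
  have shift: "((\<lambda>y. H (y + 1)) has_vector_derivative h y) (at y)" for y
  proof -
    have "((\<lambda>y. y + 1) has_vector_derivative 1) (at y)"
      by (auto intro!: derivative_eq_intros)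
    from vector_diff_chain_at[OF this assms(1)] show ?thesis
      by (simp add: o_def assms(2))
  qed
  have "((\<lambda>y. H (y + 1) - H y) has_vector_derivative 0) (at y within UNIV)" for y
    using has_vector_derivative_diff[OF shift assms(1), of y] by simp
  then obtain c where "\<And>y. y \<in> UNIV \<Longrightarrow> H (y + 1) - H y = c"
    using has_vector_derivative_zero_constant[of UNIV "\<lambda>y. H (y + 1) - H y"] by auto
  from this[of x] this[of 0] show ?thesis by simp
qed

lemma integral_circle_shift:
  fixes h :: "real \<Rightarrow> 'a::banach"
  assumes "continuous_on UNIV h" and "\<And>x. h (x + 1) = h x"
  shows "mean (\<lambda>y. h (y + d)) = mean h"
proof -
  obtain H where H: "\<And>x. (H has_vector_derivative h x) (at x)"
    "\<And>a b. a \<le> b \<Longrightarrow> integral {a..b} h = H b - H a"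
    using antiderivative_on_line[OF assms(1)] by metis
  have "((\<lambda>y. H (y + d)) has_vector_derivative h (y + d)) (at y)" for y
  proof -
    have "((\<lambda>y. y + d) has_vector_derivative 1) (at y)"
      by (auto intro!: derivative_eq_intros)
    from vector_diff_chain_at[OF this H(1)] show ?thesis by (simp add: o_def)
  qed
  hence "((\<lambda>y. h (y + d)) has_integral (H (1 + d) - H (0 + d))) {0..1}"
    by (intro fundamental_theorem_of_calculus) (auto intro: has_vector_derivative_at_within)
  moreover have "H (1 + d) - H (0 + d) = H 1 - H 0"
    using antiderivative_increment_const[OF H(1) assms(2), of d] by (simp add: add.commute)
  ultimately show ?thesis using H(2)[of 0 1] by (simp add: integral_unique)
qed

text \<open>The substitution behind the transfer operator: the \<open>l\<close> inverse branches of multiplication by \<open>l\<close>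
  cut the circle into \<open>l\<close> arcs, and in terms of an antiderivative the sum telescopes.\<close>

lemma integral_circle_branches:
  fixes h :: "real \<Rightarrow> 'a::banach"
  assumes "continuous_on UNIV h" and "0 < l"
  shows "mean (\<lambda>x. \<Sum>k<l. h ((x + real k) / real l)) = real l *\<^sub>R mean h"
proof -
  obtain H where H: "\<And>x. (H has_vector_derivative h x) (at x)"
    "\<And>a b. a \<le> b \<Longrightarrow> integral {a..b} h = H b - H a"
    using antiderivative_on_line[OF assms(1)] by metis
  have "((\<lambda>x. real l *\<^sub>R H ((x + real k) / real l)) has_vector_derivative h ((x + real k) / real l)) (at x)"
    for x and k :: nat
  proof -
    have "((\<lambda>x. (x + real k) / real l) has_vector_derivative 1 / real l) (at x)"
      using assms(2) by (auto intro!: derivative_eq_intros simp: has_real_derivative_iff_has_vector_derivative[symmetric])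
    from vector_diff_chain_at[OF this H(1)]
    have "((\<lambda>x. H ((x + real k) / real l)) has_vector_derivative (1 / real l) *\<^sub>R h ((x + real k) / real l)) (at x)"
      by (simp add: o_def)
    from has_vector_derivative_scaleR[OF DERIV_const[of "real l"] this] show ?thesis
      using assms(2) by simp
  qed
  hence "((\<lambda>x. \<Sum>k<l. real l *\<^sub>R H ((x + real k) / real l)) has_vector_derivative
      (\<Sum>k<l. h ((x + real k) / real l))) (at x)" for x
    by (intro has_vector_derivative_sum) auto
  hence "((\<lambda>x. \<Sum>k<l. h ((x + real k) / real l)) has_integral
     ((\<Sum>k<l. real l *\<^sub>R H ((1 + real k) / real l)) - (\<Sum>k<l. real l *\<^sub>R H ((0 + real k) / real l)))) {0..1}"
    by (intro fundamental_theorem_of_calculus) (auto intro: has_vector_derivative_at_within)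
  moreover have "(\<Sum>k<l. real l *\<^sub>R H ((1 + real k) / real l)) - (\<Sum>k<l. real l *\<^sub>R H ((0 + real k) / real l))
     = real l *\<^sub>R (\<Sum>k<l. H (real (Suc k) / real l) - H (real k / real l))"
    by (simp add: sum_subtractf scaleR_sum_right scaleR_right_diff_distrib add.commute)
  moreover have "(\<Sum>k<l. H (real (Suc k) / real l) - H (real k / real l)) = H 1 - H 0"
    using assms(2) by (subst sum_lessThan_telescope) auto
  ultimately show ?thesis using H(2)[of 0 1] by (simp add: integral_unique)
qed

lemma sum_cyclic_shift:
  fixes h :: "nat \<Rightarrow> 'a::ab_group_add"
  assumes "\<And>k. h (k + l) = h k"
  shows "(\<Sum>e<l. h (k + e)) = (\<Sum>e<l. h e)"
proof (induction k)
  case (Suc k)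
  have "(\<Sum>e<l. h (Suc k + e)) + h k = (\<Sum>e<Suc l. h (k + e))"
    by (simp add: sum.lessThan_Suc_shift del: sum.lessThan_Suc)
  also have "\<dots> = (\<Sum>e<l. h (k + e)) + h k" by (simp add: assms)
  finally show ?case using Suc by simp
qed simp

lemma periodic_add_nat:
  fixes h :: "real \<Rightarrow> 'a"
  assumes "\<And>x. h (x + 1) = h x"
  shows "h (x + real n) = h x"
proof (induction n)
  case (Suc n)
  have "h (x + real (Suc n)) = h ((x + real n) + 1)" by (simp add: add_ac)
  thus ?case using assms Suc by simp
qed simp

lemma periodic_add_int:
  fixes h :: "real \<Rightarrow> 'a"
  assumes "\<And>x. h (x + 1) = h x"
  shows "h (x + of_int n) = h x"
proof (cases "0 \<le> n")
  case True
  thus ?thesis using periodic_add_nat[of h x "nat n"] assms by simp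
next
  case False
  have "h ((x + of_int n) + real (nat (- n))) = h (x + of_int n)"
    by (rule periodic_add_nat) (rule assms)
  thus ?thesis using False by simp
qed

text \<open>  For a periodic function the sum over all preimages of \<open>x\<close> may be started at any one of them. This
  turns the double sum over pairs of branches into a sum over their difference.\<close>

lemma sum_branches_shift:
  fixes h :: "real \<Rightarrow> 'a::ab_group_add"
  assumes "\<And>x. h (x + 1) = h x" and "0 < l"
  shows "(\<Sum>k<l. h ((x + real k) / real l)) = (\<Sum>e<l. h ((x + real j) / real l + real e / real l))"
proof -
  define g where "g k = h ((x + real k) / real l)" for k
  have "g (k + l) = g k" for k
  proof -
    have "(x + real (k + l)) / real l = (x + real k) / real l + 1"
      using assms(2) by (simp add: field_simps)
    thus ?thesis unfolding g_def by (simp add: assms(1))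
  qed
  from sum_cyclic_shift[of g, OF this, of j] show ?thesis
    by (simp add: g_def add_divide_distrib add_ac)
qed

lemma periodic_continuous_bounded:
  fixes h :: "real \<Rightarrow> 'a::real_normed_vector"
  assumes "continuous_on UNIV h" and "\<And>x. h (x + 1) = h x"
  obtains C where "0 < C" and "\<And>x. norm (h x) \<le> C"
proof -
  have "compact (h ` {0..1})"
    using assms(1) by (intro compact_continuous_image) (auto intro: continuous_on_subset)
  then obtain C where C: "0 < C" "\<And>y. y \<in> h ` {0..1} \<Longrightarrow> norm y \<le> C"
    using compact_imp_bounded bounded_pos by metis
  have "norm (h x) \<le> C" for x
  proof -
    have "h x = h (frac x)"
      using periodic_add_int[of h "frac x" "\<lfloor>x\<rfloor>", OF assms(2)] by (simp add: frac_def)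
    moreover have "frac x \<in> {0..1}" using frac_lt_1[of x] by (auto simp: less_imp_le)
    ultimately show ?thesis using C(2) by auto
  qed
  with C(1) show ?thesis by (rule that)
qed

section \<open>Oscillatory integrals over the circle\<close>

text \<open>A smooth substitute for the indicator of \<open>{x. \<bar>x\<bar> < \<delta>}\<close>. The algebraic form is the complement of
  \<open>x^2 / (x^2 + \<delta>^2)\<close>, which contains the factors that integrations by parts need.\<close>

definition bump :: "real \<Rightarrow> real \<Rightarrow> real" where
  "bump \<delta> x = \<delta>^2 / (x^2 + \<delta>^2)"

lemma bump_nonneg: "0 \<le> bump \<delta> x"
  by (simp add: bump_def)

lemma bump_le_1: "bump \<delta> x \<le> 1"
proof -
  have "0 \<le> x^2 + \<delta>^2" "\<delta>^2 \<le> x^2 + \<delta>^2" by simp_all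
  thus ?thesis unfolding bump_def using divide_right_mono[of "\<delta>^2" "x^2 + \<delta>^2" "x^2 + \<delta>^2"]
    by (auto split: if_splits)
qed

lemma bump_commute: "bump \<delta> (x - y) = bump \<delta> (y - x)"
  by (simp add: bump_def power2_commute)

lemma continuous_on_bump [continuous_intros]:
  assumes "continuous_on A f" and "0 < \<delta>"
  shows "continuous_on A (\<lambda>x. bump \<delta> (f x))"
proof -
  have "(f x)^2 + \<delta>^2 > 0" for x
    using assms(2) by (simp add: add_nonneg_pos)
  hence "(f x)^2 + \<delta>^2 \<noteq> 0" for x by (metis less_irrefl)
  thus ?thesis unfolding bump_def using assms(1) by (intro continuous_intros) auto
qed

lemma continuous_on_line_vector_derivative:
  assumes "\<And>x. (F has_vector_derivative F' x) (at x)"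
  shows "continuous_on A F"
  using assms by (intro continuous_at_imp_continuous_on ballI has_vector_derivative_continuous)

lemma continuous_on_line_real_derivative:
  assumes "\<And>x. (F has_real_derivative F' x) (at x)"
  shows "continuous_on A F"
  using assms by (intro continuous_at_imp_continuous_on ballI DERIV_isCont)

lemma continuous_on_subset_UNIV: "continuous_on UNIV f \<Longrightarrow> continuous_on A f"
  using continuous_on_subset by blast

text \<open>The complement \<open>1 - bump \<delta> G'\<close> factors as \<open>G' * \<rho>\<close> with \<open>\<rho> = G' / (G'^2 + \<delta>^2)\<close>, and \<open>G' cis(s G)\<close> is
  an exact derivative divided by \<open>\<i> s\<close>. Moving the derivative to \<open>\<rho> F\<close> costs only \<open>\<bar>\<rho>\<bar> \<le> 1/(2 \<delta>)\<close> and
  \<open>\<bar>\<rho>'\<bar> \<le> M/\<delta>^2\<close>, so stationary points need no separate treatment, and there are no boundary terms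
  on the circle.\<close>

lemma oscillatory_integral_circle:
  fixes G G' G'' :: "real \<Rightarrow> real" and F F' :: "real \<Rightarrow> complex"
  assumes G: "\<And>x. (G has_real_derivative G' x) (at x)"
    and G': "\<And>x. (G' has_real_derivative G'' x) (at x)"
    and G'': "continuous_on UNIV G''" "\<And>x. \<bar>G'' x\<bar> \<le> M"
    and F: "\<And>x. (F has_vector_derivative F' x) (at x)" "continuous_on UNIV F'"
    and per: "\<And>x. G (x + 1) = G x" "\<And>x. G' (x + 1) = G' x" "\<And>x. F (x + 1) = F x"
    and s: "s \<noteq> 0" and \<delta>: "0 < \<delta>"
  shows "cmod (mean (\<lambda>x. cis (s * G x) * F x))
    \<le> mean (\<lambda>x. bump \<delta> (G' x) * cmod (F x))
      + (1 / \<bar>s\<bar>) * (mean (\<lambda>x. cmod (F' x)) / (2 * \<delta>)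
                    + M / \<delta>^2 * mean (\<lambda>x. cmod (F x)))"
proof -
  have contG: "continuous_on A G" "continuous_on A G'" "continuous_on A G''"
    and contF: "continuous_on A F" "continuous_on A F'" for A
    using continuous_on_line_real_derivative[OF G] continuous_on_line_real_derivative[OF G']
      continuous_on_line_vector_derivative[OF F(1)] G''(1) F(2)
      continuous_on_subset_UNIV by blast+
  have pos: "(G' x)^2 + \<delta>^2 > 0" for x
    using \<delta> by (simp add: add_nonneg_pos)
  hence nz: "(G' x)^2 + \<delta>^2 \<noteq> 0" for x by (metis less_irrefl)
  define \<rho> where "\<rho> x = G' x / ((G' x)^2 + \<delta>^2)" for x
  define \<rho>' where "\<rho>' x = G'' x * (\<delta>^2 - (G' x)^2) / ((G' x)^2 + \<delta>^2)^2" for x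
  have \<rho>: "(\<rho> has_real_derivative \<rho>' x) (at x)" for x
    unfolding \<rho>_def \<rho>'_def
    by (rule derivative_eq_intros G' refl nz)+ (simp add: power2_eq_square algebra_simps)
  have cont\<rho>: "continuous_on A \<rho>" "continuous_on A \<rho>'" for A
    unfolding \<rho>_def \<rho>'_def using nz by (auto intro!: continuous_intros contG)
  have \<rho>_bound: "\<bar>\<rho> x\<bar> \<le> 1 / (2 * \<delta>)" for x
  proof -
    have "2 * \<delta> * \<bar>G' x\<bar> \<le> (G' x)^2 + \<delta>^2"
      using sum_squares_bound[of \<delta> "\<bar>G' x\<bar>"] by (simp add: add.commute)
    thus ?thesis using pos[of x] \<delta> by (simp add: \<rho>_def abs_divide field_simps)
  qed
  have \<rho>'_bound: "\<bar>\<rho>' x\<bar> \<le> M / \<delta>^2" for x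
  proof -
    let ?q = "(G' x)^2 + \<delta>^2"
    have "\<bar>\<delta>^2 - (G' x)^2\<bar> \<le> ?q" by (smt (verit) zero_le_power2)
    hence "\<bar>\<rho>' x\<bar> \<le> \<bar>G'' x\<bar> * ?q / ?q^2"
      unfolding \<rho>'_def abs_divide abs_mult by (intro divide_mono mult_mono) (use pos[of x] in auto)
    also have "\<dots> = \<bar>G'' x\<bar> / ?q" using pos[of x] by (simp add: power2_eq_square)
    also have "\<dots> \<le> M / \<delta>^2" using G''(2)[of x] \<delta> by (intro divide_mono) auto
    finally show ?thesis .
  qed
  define c where "c x = cis (s * G x)" for x
  have contc: "continuous_on A c" for A
    unfolding c_def by (intro continuous_intros contG)
  have c: "(c has_vector_derivative (\<i> * of_real (s * G' x) * c x)) (at x)" for x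
    unfolding c_def has_vector_derivative_def
    by (rule derivative_eq_intros G[THEN has_field_derivative_imp_has_derivative] refl)+
      (auto simp: fun_eq_iff scaleR_conv_of_real algebra_simps)
  define R where "R x = \<rho>' x *\<^sub>R F x + \<rho> x *\<^sub>R F' x" for x
  have contB: "continuous_on A (\<lambda>x. bump \<delta> (G' x))" for A
    using \<delta> by (intro continuous_on_bump contG)
  have rF: "((\<lambda>x. \<rho> x *\<^sub>R F x) has_vector_derivative R x) (at x)" for x
    using has_vector_derivative_scaleR[OF \<rho> F(1)] by (simp add: R_def add.commute)
  define A where "A x = of_real (G' x * \<rho> x) * (c x * F x)" for x
  have E: "((\<lambda>x. c x * (\<rho> x *\<^sub>R F x)) has_vector_derivative (\<i> * of_real s * A x + c x * R x)) (at x)" for x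
    using has_vector_derivative_mult[OF c rF]
    by (simp add: A_def scaleR_conv_of_real algebra_simps)
  have contA: "continuous_on B A" and contR: "continuous_on B R" for B
    unfolding A_def R_def by (intro continuous_intros contG cont\<rho> contF contc)+
  have "mean (\<lambda>x. \<i> * of_real s * A x + c x * R x) = 0"
    by (rule integral_circle_derivative[OF E]) (simp add: c_def \<rho>_def per)
  hence "\<i> * of_real s * mean A + mean (\<lambda>x. c x * R x) = 0"
    by (subst (asm) Henstock_Kurzweil_Integration.integral_add)
      (auto intro!: integrable_continuous_real continuous_intros contA contc contR)
  hence "cmod (\<i> * of_real s * mean A) = cmod (mean (\<lambda>x. c x * R x))"
    by (metis add_eq_0_iff norm_minus_cancel)
  hence "\<bar>s\<bar> * cmod (mean A) = cmod (mean (\<lambda>x. c x * R x))"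
    by (simp add: norm_mult)
  also have "\<dots> \<le> mean (\<lambda>x. M / \<delta>^2 * cmod (F x) + 1 / (2 * \<delta>) * cmod (F' x))"
  proof (intro integral_norm_bound_integral integrable_continuous_real continuous_intros contc contR contF)
    fix x
    have "cmod (c x * R x) \<le> cmod (\<rho>' x *\<^sub>R F x) + cmod (\<rho> x *\<^sub>R F' x)"
      using norm_triangle_ineq[of "\<rho>' x *\<^sub>R F x" "\<rho> x *\<^sub>R F' x"]
      by (simp add: norm_mult c_def R_def)
    also have "\<dots> \<le> M / \<delta>^2 * cmod (F x) + 1 / (2 * \<delta>) * cmod (F' x)"
      unfolding norm_scaleR by (intro add_mono mult_right_mono \<rho>_bound \<rho>'_bound) auto
    finally show "cmod (c x * R x) \<le> \<dots>" .
  qed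
  also have "\<dots> = M / \<delta>^2 * mean (\<lambda>x. cmod (F x)) + 1 / (2 * \<delta>) * mean (\<lambda>x. cmod (F' x))"
  proof -
    have "(\<lambda>x. cmod (F x)) integrable_on {0..1}" "(\<lambda>x. cmod (F' x)) integrable_on {0..1}"
      by (intro integrable_continuous_real continuous_on_norm contF)+
    from this[THEN integrable_on_mult_right] show ?thesis
      by (subst Henstock_Kurzweil_Integration.integral_add) (simp_all only: integral_mult_right)
  qed
  finally have A_bound: "cmod (mean A) \<le> (1 / \<bar>s\<bar>) * (mean (\<lambda>x. cmod (F' x)) / (2 * \<delta>)
                    + M / \<delta>^2 * mean (\<lambda>x. cmod (F x)))"
    using s by (simp add: field_simps)
  have split: "c x * F x = A x + of_real (bump \<delta> (G' x)) * (c x * F x)" for x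
  proof -
    have "G' x * \<rho> x + bump \<delta> (G' x) = 1"
      using nz[of x] by (simp add: \<rho>_def bump_def power2_eq_square add_divide_distrib[symmetric])
    hence "of_real (G' x * \<rho> x) + of_real (bump \<delta> (G' x)) = (1::complex)"
      by (metis of_real_1 of_real_add)
    thus ?thesis unfolding A_def by (metis distrib_right mult_1)
  qed
  have "mean (\<lambda>x. c x * F x) = mean A
      + mean (\<lambda>x. of_real (bump \<delta> (G' x)) * (c x * F x))"
    by (subst split, subst Henstock_Kurzweil_Integration.integral_add)
      (auto intro!: integrable_continuous_real continuous_intros contA contc contF contB continuous_on_of_real)
  moreover have "cmod (mean (\<lambda>x. of_real (bump \<delta> (G' x)) * (c x * F x)))
      \<le> mean (\<lambda>x. bump \<delta> (G' x) * cmod (F x))"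
    by (intro integral_norm_bound_integral integrable_continuous_real continuous_intros contc contF contB)
      (auto simp: norm_mult c_def bump_nonneg)
  ultimately have "cmod (mean (\<lambda>x. c x * F x)) \<le>
     cmod (mean A) + mean (\<lambda>x. bump \<delta> (G' x) * cmod (F x))"
    by (smt (verit) norm_triangle_ineq)
  with A_bound show ?thesis by (simp add: c_def)
qed

section \<open>The transfer operator\<close>

definition transfer :: "nat \<Rightarrow> (real \<Rightarrow> real) \<Rightarrow> real \<Rightarrow> (real \<Rightarrow> complex) \<Rightarrow> real \<Rightarrow> complex" where
  "transfer l \<phi> s f x =
     of_real (1 / real l) * (\<Sum>k<l. cis (s * \<phi> ((x + real k) / real l)) * f ((x + real k) / real l))"

lemma periodic_branches:
  fixes h :: "real \<Rightarrow> 'a::ab_group_add"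
  assumes "\<And>x. h (x + 1) = h x" and "0 < l"
  shows "(\<Sum>k<l. h ((x + 1 + real k) / real l)) = (\<Sum>k<l. h ((x + real k) / real l))"
  using sum_branches_shift[of h l x 1] assms by (simp add: add_divide_distrib add_ac)

lemma transfer_periodic:
  assumes "\<And>x. \<phi> (x + 1) = \<phi> x" and "\<And>x. f (x + 1) = f x" and "0 < l"
  shows "transfer l \<phi> s f (x + 1) = transfer l \<phi> s f x"
  unfolding transfer_def
  using periodic_branches[of "\<lambda>y. cis (s * \<phi> y) * f y" l x] assms by simp

lemma continuous_on_transfer:
  assumes "continuous_on UNIV \<phi>" and "continuous_on UNIV f" and "0 < l"
  shows "continuous_on A (transfer l \<phi> s f)"
proof -
  have "continuous_on UNIV (transfer l \<phi> s f)"
    unfolding transfer_def using assms(3)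
    by (intro continuous_intros continuous_on_compose2[OF assms(1)] continuous_on_compose2[OF assms(2)]) auto
  thus ?thesis by (rule continuous_on_subset_UNIV)
qed

lemma integral_eq_integral_transfer:
  assumes "continuous_on UNIV \<phi>" "continuous_on UNIV f" "continuous_on UNIV g"
    and "\<And>x. g (x + 1) = g x" and "0 < l"
  shows "mean (\<lambda>\<theta>. cis (s * \<phi> \<theta>) * f \<theta> * g (real l * \<theta>))
       = mean (\<lambda>x. transfer l \<phi> s f x * g x)"
proof -
  let ?h = "\<lambda>\<theta>. cis (s * \<phi> \<theta>) * f \<theta> * g (real l * \<theta>)"
  have "continuous_on UNIV ?h"
    using assms by (intro continuous_intros continuous_on_compose2[OF assms(3)]) auto
  from integral_circle_branches[OF this assms(5)]
  have "mean ?h = (1 / real l) *\<^sub>R mean (\<lambda>x. \<Sum>k<l. ?h ((x + real k) / real l))"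
    using assms(5) by simp
  also have "\<dots> = mean (\<lambda>x. (1 / real l) *\<^sub>R (\<Sum>k<l. ?h ((x + real k) / real l)))"
    by simp
  also have "(\<lambda>x. (1 / real l) *\<^sub>R (\<Sum>k<l. ?h ((x + real k) / real l))) = (\<lambda>x. transfer l \<phi> s f x * g x)"
  proof
    fix x
    have "g (real l * ((x + real k) / real l)) = g x" for k
      using assms(5) periodic_add_nat[of g x k] assms(4) by simp
    hence "(\<Sum>k<l. ?h ((x + real k) / real l))
       = (\<Sum>k<l. cis (s * \<phi> ((x + real k) / real l)) * f ((x + real k) / real l) * g x)"
      by (intro sum.cong refl) (simp only:)
    thus "(1 / real l) *\<^sub>R (\<Sum>k<l. ?h ((x + real k) / real l)) = transfer l \<phi> s f x * g x"
      by (simp only: transfer_def scaleR_conv_of_real sum_distrib_right mult.assoc)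
  qed
  finally show ?thesis .
qed

text \<open>In the double sum over branches \<open>j, k\<close> the second one is written as \<open>j + e\<close>; then the sum over \<open>j\<close>
  undoes the substitution and leaves an integral over the circle for every \<open>e\<close>.\<close>

lemma integral_norm_transfer_squared:
  fixes f :: "real \<Rightarrow> complex"
  assumes \<phi>: "continuous_on UNIV \<phi>" and f: "continuous_on UNIV f"
    and per: "\<And>x. \<phi> (x + 1) = \<phi> x" "\<And>x. f (x + 1) = f x" and l: "0 < l"
  shows "of_real (mean (\<lambda>x. (cmod (transfer l \<phi> s f x))^2))
    = of_real (1 / real l) * (\<Sum>e<l. mean (\<lambda>y.
        cis (s * (\<phi> y - \<phi> (y + real e / real l))) * (f y * cnj (f (y + real e / real l)))))"
proof -
  define u where "u y = cis (s * \<phi> y) * f y" for y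
  have u: "continuous_on UNIV u" and uper: "\<And>x. u (x + 1) = u x"
    unfolding u_def using per by (auto intro!: continuous_intros \<phi> f)
  have u': "continuous_on UNIV (\<lambda>y. u (y + d))" for d
    by (rule continuous_on_compose2[OF u]) (auto intro!: continuous_intros)
  have uu: "continuous_on UNIV (\<lambda>y. u y * cnj (u (y + d)))" for d
    by (intro continuous_on_mult continuous_on_cnj u u')
  define v where "v y = (\<Sum>e<l. u y * cnj (u (y + real e / real l)))" for y
  have v: "continuous_on UNIV v"
    unfolding v_def by (intro continuous_on_sum uu)
  have "(of_real ((cmod (transfer l \<phi> s f x))^2) :: complex)
     = of_real (1 / (real l)^2) * (\<Sum>k<l. v ((x + real k) / real l))" for x
  proof -
    define S where "S = (\<Sum>k<l. u ((x + real k) / real l))"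
    have "transfer l \<phi> s f x = of_real (1 / real l) * S"
      by (simp add: transfer_def S_def u_def)
    hence "(of_real ((cmod (transfer l \<phi> s f x))^2) :: complex) = of_real (1 / (real l)^2) * (S * cnj S)"
      by (simp only: complex_norm_square) (simp add: power2_eq_square)
    also have "S * cnj S = (\<Sum>k<l. u ((x + real k) / real l) * cnj S)"
      by (simp add: S_def sum_distrib_right)
    also have "\<dots> = (\<Sum>k<l. v ((x + real k) / real l))"
    proof (rule sum.cong)
      fix k
      have "S = (\<Sum>e<l. u ((x + real k) / real l + real e / real l))"
        unfolding S_def using uper l by (rule sum_branches_shift)
      thus "u ((x + real k) / real l) * cnj S = v ((x + real k) / real l)"
        by (simp add: v_def sum_distrib_left)
    qed simp
    finally show ?thesis .
  qed
  hence "mean (\<lambda>x. of_real ((cmod (transfer l \<phi> s f x))^2) :: complex)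
      = of_real (1 / (real l)^2) * mean (\<lambda>x. \<Sum>k<l. v ((x + real k) / real l))"
    by simp
  also have "\<dots> = of_real (1 / real l) * mean v"
    using integral_circle_branches[OF v l] l by (simp add: scaleR_conv_of_real power2_eq_square)
  also have "mean v = (\<Sum>e<l. mean (\<lambda>y. u y * cnj (u (y + real e / real l))))"
  proof -
    have "continuous_on {0..1} (\<lambda>y. u y * cnj (u (y + real e / real l)))" for e
      by (rule continuous_on_subset_UNIV[OF uu])
    thus ?thesis unfolding v_def
      by (intro integral_sum finite_lessThan integrable_continuous_real)
  qed
  also have "\<dots> = (\<Sum>e<l. mean (\<lambda>y.
      cis (s * (\<phi> y - \<phi> (y + real e / real l))) * (f y * cnj (f (y + real e / real l)))))"
  proof -
    have "u y * cnj (u z) = cis (s * (\<phi> y - \<phi> z)) * (f y * cnj (f z))" for y z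
    proof -
      have "cis (s * \<phi> y) * cnj (cis (s * \<phi> z)) = cis (s * (\<phi> y - \<phi> z))"
        by (simp add: cis_cnj cis_mult algebra_simps)
      thus ?thesis by (simp add: u_def mult_ac)
    qed
    thus ?thesis by simp
  qed
  finally have "mean (\<lambda>x. of_real ((cmod (transfer l \<phi> s f x))^2) :: complex)
    = of_real (1 / real l) * (\<Sum>e<l. mean (\<lambda>y.
        cis (s * (\<phi> y - \<phi> (y + real e / real l))) * (f y * cnj (f (y + real e / real l)))))" .
  moreover have "((\<lambda>x. of_real ((cmod (transfer l \<phi> s f x))^2) :: complex) has_integral
      of_real (mean (\<lambda>x. (cmod (transfer l \<phi> s f x))^2))) {0..1}"
  proof (rule has_integral_of_real)
    show "((\<lambda>x. (cmod (transfer l \<phi> s f x))^2) has_integral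
      mean (\<lambda>x. (cmod (transfer l \<phi> s f x))^2)) {0..1}"
      by (intro integrable_integral integrable_continuous_real continuous_on_power continuous_on_norm
            continuous_on_transfer \<phi> f l)
  qed
  ultimately show ?thesis by (simp add: integral_unique)
qed

lemma mult_le_weighted_squares:
  fixes a b \<gamma> :: real
  assumes "0 < \<gamma>"
  shows "a * b \<le> (\<gamma> * a^2 + b^2 / \<gamma>) / 2"
proof -
  have "0 \<le> (\<gamma> * a - b)^2 / \<gamma>" using assms by simp
  also have "\<dots> = \<gamma> * a^2 + b^2 / \<gamma> - 2 * (a * b)"
    using assms by (simp add: field_simps power2_eq_square)
  finally show ?thesis by simp
qed

text \<open>The reflection \<open>e \<mapsto> l - e\<close> permutes the shifts modulo the period. It makes the two halves of the
  symmetrised coincidence sum in \<open>transfer_L2_bound\<close> equal.\<close>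

lemma sum_bump_reflect:
  fixes g :: "real \<Rightarrow> real"
  assumes "\<And>x. g (x + 1) = g x" and "0 < l"
  shows "(\<Sum>e<l. bump \<delta> (g (y - real e / real l) - g y)) = (\<Sum>e<l. bump \<delta> (g (y + real e / real l) - g y))"
proof -
  define h where "h k = bump \<delta> (g (y + real k / real l) - g y)" for k :: nat
  have h: "h (k + l) = h k" for k
  proof -
    have "y + real (k + l) / real l = (y + real k / real l) + 1"
      using assms(2) by (simp add: field_simps)
    thus ?thesis unfolding h_def by (simp only: assms(1))
  qed
  have "(\<Sum>e<l. bump \<delta> (g (y - real e / real l) - g y)) = (\<Sum>e<l. h (1 + (l - Suc e)))"
  proof (rule sum.cong)
    fix e assume "e \<in> {..<l}"
    hence "real (1 + (l - Suc e)) = real l - real e" by auto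
    hence "y + real (1 + (l - Suc e)) / real l = (y - real e / real l) + 1"
      using assms(2) by (simp add: field_simps)
    thus "bump \<delta> (g (y - real e / real l) - g y) = h (1 + (l - Suc e))"
      unfolding h_def by (simp only: assms(1))
  qed simp
  also have "\<dots> = (\<Sum>e<l. h (1 + e))"
    by (rule sum.nat_diff_reindex)
  also have "\<dots> = (\<Sum>e<l. h e)" by (rule sum_cyclic_shift) (rule h)
  finally show ?thesis by (simp add: h_def)
qed

lemma continuous_on_shift:
  "continuous_on UNIV h \<Longrightarrow> continuous_on A (\<lambda>y::real. h (y + d))"
  by (rule continuous_on_compose2[of UNIV h]) (auto intro!: continuous_intros)

text \<open>The number \<open>\<nu>\<close> is free because \<open>f(y) cnj(f(y + d))\<close> is unchanged when \<open>f\<close> is multiplied by a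
  character of frequency \<open>\<nu>\<close>, up to a constant factor; its derivative is therefore expressed by
  \<open>f' - \<i> \<nu> f\<close>. In the term where the phase is stationary, \<open>\<bar>f(y) f(y + d)\<bar>\<close> is split into squares,
  so that only the total weight of the coincidences of a point \<open>y\<close> with its translates remains.
  The parameter \<open>\<gamma>\<close> balances the two norms.\<close>

lemma transfer_L2_bound:
  fixes \<phi> \<phi>1 \<phi>2 :: "real \<Rightarrow> real" and f f' :: "real \<Rightarrow> complex" and \<nu> :: real
  assumes \<phi>: "\<And>x. (\<phi> has_real_derivative \<phi>1 x) (at x)" "\<And>x. (\<phi>1 has_real_derivative \<phi>2 x) (at x)"
      "continuous_on UNIV \<phi>2" "\<And>x. \<bar>\<phi>2 x\<bar> \<le> M"
    and f: "\<And>x. (f has_vector_derivative f' x) (at x)" "continuous_on UNIV f'"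
    and per: "\<And>x. \<phi> (x + 1) = \<phi> x" "\<And>x. \<phi>1 (x + 1) = \<phi>1 x" "\<And>x. f (x + 1) = f x" "\<And>x. f' (x + 1) = f' x"
    and pos: "s \<noteq> 0" "0 < \<delta>" "0 < \<gamma>" "0 < l"
  defines "A \<equiv> mean (\<lambda>y. (cmod (f y))^2)"
    and "B \<equiv> mean (\<lambda>y. (cmod (f' y - \<i> * of_real \<nu> * f y))^2)"
  shows "mean (\<lambda>x. (cmod (transfer l \<phi> s f x))^2)
    \<le> (1 / real l) * mean (\<lambda>y. (\<Sum>e<l. bump \<delta> (\<phi>1 (y + real e / real l) - \<phi>1 y)) * (cmod (f y))^2)
      + (1 / \<bar>s\<bar>) * ((\<gamma> * A + B / \<gamma>) / (2 * \<delta>) + 2 * M / \<delta>^2 * A)"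
proof -
  note cont\<phi> = continuous_on_line_real_derivative[OF \<phi>(1)] continuous_on_line_real_derivative[OF \<phi>(2)]
  note contf = continuous_on_line_vector_derivative[OF f(1)]
  define D where "D y = f' y - \<i> * of_real \<nu> * f y" for y
  have contD: "continuous_on UNIV D"
    unfolding D_def by (intro continuous_intros f(2) contf)
  have perD: "D (x + 1) = D x" for x by (simp add: D_def per)
  define I where "I e = mean (\<lambda>y.
        cis (s * (\<phi> y - \<phi> (y + real e / real l))) * (f y * cnj (f (y + real e / real l))))" for e :: nat
  define J where "J e = mean (\<lambda>y. bump \<delta> (\<phi>1 (y + real e / real l) - \<phi>1 y) * (cmod (f y))^2)" for e :: nat
  define J' where "J' e = mean (\<lambda>y. bump \<delta> (\<phi>1 (y - real e / real l) - \<phi>1 y) * (cmod (f y))^2)" for e :: nat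
  define E where "E = (1 / \<bar>s\<bar>) * ((\<gamma> * A + B / \<gamma>) / (2 * \<delta>) + 2 * M / \<delta>^2 * A)"
  have M: "0 \<le> M" using \<phi>(4)[of 0] by linarith
  have contbump: "continuous_on C (\<lambda>y. bump \<delta> (\<phi>1 (y + a) - \<phi>1 (y + b)))" for C a b
    by (intro continuous_on_bump continuous_on_diff continuous_on_shift cont\<phi> pos)
  have cont_sq: "continuous_on C (\<lambda>y. (cmod (g (y + a)))^2)" if "continuous_on UNIV g" for g :: "real \<Rightarrow> complex" and C a
    using that by (intro continuous_on_power continuous_on_norm continuous_on_shift)
  have shift_sq: "mean (\<lambda>y. (cmod (g (y + a)))^2) = mean (\<lambda>y. (cmod (g y))^2)"
    if "continuous_on UNIV g" "\<And>x. g (x + 1) = g x" for g :: "real \<Rightarrow> complex" and a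
    using that cont_sq[OF that(1), of UNIV 0] by (intro integral_circle_shift) auto
  have intsq: "(\<lambda>y. (cmod (g (y + a)))^2) integrable_on {0..1}"
    if "continuous_on UNIV g" for g :: "real \<Rightarrow> complex" and a
    using cont_sq[OF that] by (rule integrable_continuous_real)
  have I_bound: "cmod (I e) \<le> (J e + J' e) / 2 + E" for e
  proof -
    define d where "d = real e / real l"
    define F where "F y = f y * cnj (f (y + d))" for y
    define F' where "F' y = D y * cnj (f (y + d)) + f y * cnj (D (y + d))" for y
    have shiftf: "((\<lambda>y. f (y + d)) has_vector_derivative f' (y + d)) (at y)" for y
    proof -
      have "((\<lambda>y. y + d) has_vector_derivative 1) (at y)"
        by (auto intro!: derivative_eq_intros)
      from vector_diff_chain_at[OF this f(1)] show ?thesis by (simp add: o_def)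
    qed
    have F: "(F has_vector_derivative F' y) (at y)" for y
    proof -
      have "((\<lambda>y. cnj (f (y + d))) has_vector_derivative cnj (f' (y + d))) (at y)"
        using has_vector_derivative_cnj[OF shiftf] .
      from has_vector_derivative_mult[OF f(1) this]
      have "(F has_vector_derivative (f y * cnj (f' (y + d)) + f' y * cnj (f (y + d)))) (at y)"
        unfolding F_def[abs_def] .
      moreover have "f y * cnj (f' (y + d)) + f' y * cnj (f (y + d)) = F' y"
        by (simp add: F'_def D_def algebra_simps)
      ultimately show ?thesis by simp
    qed
    have contF': "continuous_on UNIV F'" and contF: "continuous_on UNIV F"
      unfolding F'_def F_def
      by (intro continuous_on_add continuous_on_mult continuous_on_cnj continuous_on_shift contD contf)+
    have G: "((\<lambda>y. \<phi> y - \<phi> (y + d)) has_real_derivative \<phi>1 y - \<phi>1 (y + d)) (at y)"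
      and G': "((\<lambda>y. \<phi>1 y - \<phi>1 (y + d)) has_real_derivative \<phi>2 y - \<phi>2 (y + d)) (at y)" for y
      using \<phi>(1,2) by (auto intro!: DERIV_diff simp: DERIV_shift[symmetric])
    have sh: "y + 1 + d = (y + d) + 1" for y :: real by simp
    have persh: "\<phi> (y + 1 + d) = \<phi> (y + d)" "\<phi>1 (y + 1 + d) = \<phi>1 (y + d)" "f (y + 1 + d) = f (y + d)" for y
      by (simp_all only: sh per)
    have "cmod (mean (\<lambda>y. cis (s * (\<phi> y - \<phi> (y + d))) * F y))
      \<le> mean (\<lambda>y. bump \<delta> (\<phi>1 y - \<phi>1 (y + d)) * cmod (F y))
      + (1 / \<bar>s\<bar>) * (mean (\<lambda>x. cmod (F' x)) / (2 * \<delta>)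
                    + (2 * M) / \<delta>^2 * mean (\<lambda>x. cmod (F x)))"
    proof (rule oscillatory_integral_circle[OF G G' _ _ F contF'])
      show "continuous_on UNIV (\<lambda>y. \<phi>2 y - \<phi>2 (y + d))"
        by (intro continuous_on_diff continuous_on_shift \<phi>(3))
      show "\<bar>\<phi>2 x - \<phi>2 (x + d)\<bar> \<le> 2 * M" for x
        using \<phi>(4)[of x] \<phi>(4)[of "x + d"] by linarith
    qed (use per persh pos in \<open>simp_all add: F_def\<close>)
    moreover have "mean (\<lambda>x. cmod (F x)) \<le> A"
    proof -
      have "mean (\<lambda>x. cmod (F x)) \<le> mean (\<lambda>y. (cmod (f y))^2 / 2 + (cmod (f (y + d)))^2 / 2)"
      proof (rule integral_le)
        show "cmod (F y) \<le> (cmod (f y))^2 / 2 + (cmod (f (y + d)))^2 / 2" for y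
          using mult_le_weighted_squares[of 1 "cmod (f y)" "cmod (f (y + d))"] by (simp add: F_def norm_mult)
      qed (intro integrable_continuous_real continuous_on_norm continuous_on_subset_UNIV[OF contF]
          integrable_add integrable_on_divide intsq[of f 0, simplified] intsq contf)+
      also have "\<dots> = A"
        using intsq[OF contf, of 0] intsq[OF contf, of d] shift_sq[OF contf per(3), of d]
        by (subst Henstock_Kurzweil_Integration.integral_add)
          (auto simp: A_def intro!: integrable_on_divide)
      finally show ?thesis .
    qed
    moreover have "mean (\<lambda>x. cmod (F' x)) \<le> \<gamma> * A + B / \<gamma>"
    proof -
      have "mean (\<lambda>x. cmod (F' x)) \<le> mean (\<lambda>y.
         (\<gamma> * (cmod (f (y + d)))^2 + (cmod (D y))^2 / \<gamma>) / 2 + (\<gamma> * (cmod (f y))^2 + (cmod (D (y + d)))^2 / \<gamma>) / 2)"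
      proof (rule integral_le)
        show "cmod (F' y) \<le> (\<gamma> * (cmod (f (y + d)))^2 + (cmod (D y))^2 / \<gamma>) / 2
            + (\<gamma> * (cmod (f y))^2 + (cmod (D (y + d)))^2 / \<gamma>) / 2" for y
          using mult_le_weighted_squares[OF pos(3), of "cmod (f (y + d))" "cmod (D y)"]
            mult_le_weighted_squares[OF pos(3), of "cmod (f y)" "cmod (D (y + d))"]
            norm_triangle_ineq[of "D y * cnj (f (y + d))" "f y * cnj (D (y + d))"]
          unfolding F'_def norm_mult complex_mod_cnj mult.commute[of "cmod (D y)"] by linarith
      qed (intro integrable_continuous_real continuous_on_norm continuous_on_subset_UNIV[OF contF']
          integrable_add integrable_on_divide integrable_on_mult_right intsq[of f 0, simplified] intsq
          intsq[of D 0, simplified] contf contD)+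
      also have "\<dots> = \<gamma> * A + B / \<gamma>"
        using intsq[OF contf, of 0] intsq[OF contf, of d] shift_sq[OF contf per(3), of d]
          intsq[OF contD, of 0] intsq[OF contD, of d] shift_sq[OF contD perD, of d]
        by (simp add: Henstock_Kurzweil_Integration.integral_add integrable_add integrable_on_divide
            integrable_on_mult_right A_def B_def D_def add_divide_distrib)
      finally show ?thesis .
    qed
    moreover have "mean (\<lambda>y. bump \<delta> (\<phi>1 y - \<phi>1 (y + d)) * cmod (F y)) \<le> (J e + J' e) / 2"
    proof -
      have cb: "continuous_on UNIV (\<lambda>y. bump \<delta> (\<phi>1 (y + d) - \<phi>1 y) * (cmod (f y))^2)"
        "continuous_on UNIV (\<lambda>y. bump \<delta> (\<phi>1 y - \<phi>1 (y + d)) * (cmod (f (y + d)))^2)"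
        using contbump[of UNIV d 0] contbump[of UNIV 0 d] cont_sq[OF contf, of UNIV 0] cont_sq[OF contf, of UNIV d]
        by (auto intro!: continuous_on_mult)
      have ib: "(\<lambda>y. bump \<delta> (\<phi>1 (y + d) - \<phi>1 y) * (cmod (f y))^2 / 2) integrable_on {0..1}"
        "(\<lambda>y. bump \<delta> (\<phi>1 y - \<phi>1 (y + d)) * (cmod (f (y + d)))^2 / 2) integrable_on {0..1}"
        by (intro integrable_on_divide integrable_continuous_real continuous_on_subset_UNIV[OF cb(1)]
            continuous_on_subset_UNIV[OF cb(2)])+
      have "mean (\<lambda>y. bump \<delta> (\<phi>1 y - \<phi>1 (y + d)) * cmod (F y))
        \<le> mean (\<lambda>y. bump \<delta> (\<phi>1 (y + d) - \<phi>1 y) * (cmod (f y))^2 / 2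
            + bump \<delta> (\<phi>1 y - \<phi>1 (y + d)) * (cmod (f (y + d)))^2 / 2)"
      proof (rule integral_le)
        show "(\<lambda>y. bump \<delta> (\<phi>1 y - \<phi>1 (y + d)) * cmod (F y)) integrable_on {0..1}"
          using contbump[of "{0..1}" 0 d]
          by (auto intro!: integrable_continuous_real continuous_on_mult continuous_on_norm continuous_on_subset_UNIV[OF contF])
        show "bump \<delta> (\<phi>1 y - \<phi>1 (y + d)) * cmod (F y)
          \<le> bump \<delta> (\<phi>1 (y + d) - \<phi>1 y) * (cmod (f y))^2 / 2
            + bump \<delta> (\<phi>1 y - \<phi>1 (y + d)) * (cmod (f (y + d)))^2 / 2" for y
        proof -
          have "cmod (F y) \<le> ((cmod (f y))^2 + (cmod (f (y + d)))^2) / 2"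
            using mult_le_weighted_squares[of 1 "cmod (f y)" "cmod (f (y + d))"] by (simp add: F_def norm_mult)
          from mult_left_mono[OF this bump_nonneg[of \<delta> "\<phi>1 y - \<phi>1 (y + d)"]] show ?thesis
            unfolding bump_commute[of \<delta> "\<phi>1 (y + d)"] by (simp add: distrib_left add_divide_distrib)
        qed
      qed (intro integrable_add ib)
      also have "\<dots> = J e / 2 + mean (\<lambda>y. bump \<delta> (\<phi>1 y - \<phi>1 (y + d)) * (cmod (f (y + d)))^2) / 2"
        by (subst Henstock_Kurzweil_Integration.integral_add[OF ib]) (simp add: J_def d_def)
      also have "mean (\<lambda>y. bump \<delta> (\<phi>1 y - \<phi>1 (y + d)) * (cmod (f (y + d)))^2)
          = mean (\<lambda>y. bump \<delta> (\<phi>1 (y + - d) - \<phi>1 ((y + - d) + d)) * (cmod (f ((y + - d) + d)))^2)"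
        by (rule integral_circle_shift[symmetric, OF cb(2)]) (simp only: sh per)
      also have "\<dots> = J' e"
        by (simp add: J'_def d_def)
      finally show ?thesis by simp
    qed
    ultimately have "cmod (I e) \<le> (J e + J' e) / 2 + (1 / \<bar>s\<bar>) * ((\<gamma> * A + B / \<gamma>) / (2 * \<delta>) + 2 * M / \<delta>^2 * A)"
      unfolding I_def d_def[symmetric] F_def[symmetric]
      using pos M by (elim order_trans) (intro add_mono mult_left_mono divide_right_mono, auto)
    thus ?thesis by (simp add: E_def)
  qed
  have contJ: "continuous_on {0..1} (\<lambda>y. bump \<delta> (\<phi>1 (y + a) - \<phi>1 y) * (cmod (f y))^2)" for a
    using contbump[of "{0..1}" a 0] cont_sq[OF contf, of "{0..1}" 0] by (auto intro!: continuous_on_mult)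
  have sumJ: "(\<Sum>e<l. J e) = mean (\<lambda>y. (\<Sum>e<l. bump \<delta> (\<phi>1 (y + real e / real l) - \<phi>1 y)) * (cmod (f y))^2)"
    unfolding J_def sum_distrib_right
    by (intro integral_sum[symmetric] finite_lessThan integrable_continuous_real contJ)
  have "(\<Sum>e<l. J' e) = mean (\<lambda>y. (\<Sum>e<l. bump \<delta> (\<phi>1 (y - real e / real l) - \<phi>1 y)) * (cmod (f y))^2)"
    unfolding J'_def sum_distrib_right
    by (intro integral_sum[symmetric] finite_lessThan integrable_continuous_real
        contJ[of "- (real e / real l)" for e, simplified])
  hence sumJ': "(\<Sum>e<l. J' e) = (\<Sum>e<l. J e)"
    unfolding sumJ using sum_bump_reflect[of \<phi>1 l, OF per(2) pos(4)] by simp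
  have "mean (\<lambda>x. (cmod (transfer l \<phi> s f x))^2)
      \<le> cmod (of_real (mean (\<lambda>x. (cmod (transfer l \<phi> s f x))^2)))"
    by simp
  also have "\<dots> = (1 / real l) * cmod (\<Sum>e<l. I e)"
    unfolding I_def integral_norm_transfer_squared[OF cont\<phi>(1) contf per(1,3) pos(4)]
    by (simp add: norm_mult norm_divide)
  also have "\<dots> \<le> (1 / real l) * (\<Sum>e<l. (J e + J' e) / 2 + E)"
    by (intro mult_left_mono order_trans[OF norm_sum] sum_mono I_bound) auto
  also have "\<dots> = (1 / real l) * (\<Sum>e<l. J e) + E"
    using sumJ' pos(4)
    by (simp add: sum.distrib sum_divide_distrib[symmetric] distrib_left)
  finally show ?thesis unfolding sumJ E_def .
qed

lemma transfer_contraction: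
  assumes "continuous_on UNIV \<phi>" "continuous_on UNIV g" and l: "0 < l"
  shows "mean (\<lambda>x. (cmod (transfer l \<phi> s g x))^2) \<le> mean (\<lambda>x. (cmod (g x))^2)"
proof -
  have sq: "continuous_on UNIV (\<lambda>x. (cmod (g x))^2)"
    by (intro continuous_intros assms)
  have "mean (\<lambda>x. (cmod (transfer l \<phi> s g x))^2)
    \<le> mean (\<lambda>x. 1 / real l * (\<Sum>k<l. (cmod (g ((x + real k) / real l)))^2))"
  proof (rule integral_le)
    show "(\<lambda>x. (cmod (transfer l \<phi> s g x))^2) integrable_on {0..1}"
      by (intro integrable_continuous_real continuous_on_power continuous_on_norm continuous_on_transfer assms)
    show "(\<lambda>x. 1 / real l * (\<Sum>k<l. (cmod (g ((x + real k) / real l)))^2)) integrable_on {0..1}"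
      using l by (intro integrable_continuous_real continuous_intros continuous_on_compose2[OF assms(2)]) auto
    show "(cmod (transfer l \<phi> s g x))^2 \<le> 1 / real l * (\<Sum>k<l. (cmod (g ((x + real k) / real l)))^2)" for x
    proof -
      have "cmod (transfer l \<phi> s g x) \<le> 1 / real l * (\<Sum>k<l. cmod (g ((x + real k) / real l)))"
        unfolding transfer_def norm_mult
        by (intro mult_mono order_trans[OF norm_sum] sum_mono) (auto simp: norm_mult norm_divide)
      hence "(cmod (transfer l \<phi> s g x))^2 \<le> (1 / real l * (\<Sum>k<l. cmod (g ((x + real k) / real l))))^2"
        by (intro power_mono) auto
      also have "\<dots> = 1 / (real l)^2 * (\<Sum>k<l. 1 * cmod (g ((x + real k) / real l)))^2"
        by (simp add: power_mult_distrib power_divide)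
      also have "\<dots> \<le> 1 / (real l)^2 * ((\<Sum>k<l. 1^2) * (\<Sum>k<l. (cmod (g ((x + real k) / real l)))^2))"
        by (intro mult_left_mono Cauchy_Schwarz_ineq_sum) auto
      also have "\<dots> = 1 / real l * (\<Sum>k<l. (cmod (g ((x + real k) / real l)))^2)"
        using l by (simp add: power2_eq_square)
      finally show ?thesis .
    qed
  qed
  also have "\<dots> = mean (\<lambda>x. (cmod (g x))^2)"
    using integral_circle_branches[OF sq l] l by simp
  finally show ?thesis .
qed

text \<open>Differentiating along a branch produces the factor \<open>1/l\<close>, which keeps the frequencies created by
  the phase small compared with the parameter of the next step.\<close>

lemma transfer_derivative:
  fixes \<phi> \<phi>1 :: "real \<Rightarrow> real" and f f' :: "real \<Rightarrow> complex"
  assumes \<phi>: "\<And>x. (\<phi> has_real_derivative \<phi>1 x) (at x)"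
    and f: "\<And>x. (f has_vector_derivative f' x) (at x)" and l: "0 < l"
  shows "(transfer l \<phi> s f has_vector_derivative
     of_real (1 / real l) * transfer l \<phi> s (\<lambda>y. f' y + \<i> * of_real (s * \<phi>1 y) * f y) x) (at x)"
proof -
  define u where "u y = cis (s * \<phi> y) * f y" for y
  define u' where "u' y = cis (s * \<phi> y) * (f' y + \<i> * of_real (s * \<phi>1 y) * f y)" for y
  have c: "((\<lambda>y. cis (s * \<phi> y)) has_vector_derivative (\<i> * of_real (s * \<phi>1 y) * cis (s * \<phi> y))) (at y)" for y
    unfolding has_vector_derivative_def
    by (rule derivative_eq_intros \<phi>[THEN has_field_derivative_imp_has_derivative] refl)+
      (auto simp: fun_eq_iff scaleR_conv_of_real algebra_simps)
  have u: "(u has_vector_derivative u' y) (at y)" for y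
    using has_vector_derivative_mult[OF c f, of y] unfolding u_def[abs_def] u'_def
    by (simp add: algebra_simps)
  have "((\<lambda>x. u ((x + real k) / real l)) has_vector_derivative of_real (1 / real l) * u' ((x + real k) / real l)) (at x)" for k
  proof -
    have "((\<lambda>x. (x + real k) / real l) has_vector_derivative 1 / real l) (at x)"
      using l by (auto intro!: derivative_eq_intros simp: has_real_derivative_iff_has_vector_derivative[symmetric])
    from vector_diff_chain_at[OF this u] show ?thesis
      by (simp add: o_def scaleR_conv_of_real)
  qed
  hence "((\<lambda>x. \<Sum>k<l. u ((x + real k) / real l)) has_vector_derivative
      (\<Sum>k<l. of_real (1 / real l) * u' ((x + real k) / real l))) (at x)"
    by (intro has_vector_derivative_sum) auto
  from has_vector_derivative_mult_right[OF this, of "of_real (1 / real l)"] show ?thesis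
    unfolding transfer_def[abs_def] u_def u'_def sum_distrib_left .
qed

text \<open>The frequency \<open>\<nu>\<close> is divided by \<open>l\<close> together with the derivative, so that \<open>f' - \<i> \<nu> f\<close> is mapped to
  the corresponding expression for \<open>transfer l \<phi> s f\<close> and the phase contributes the only new term.\<close>

lemma transfer_covariant_derivative_bound:
  fixes \<phi> \<phi>1 :: "real \<Rightarrow> real" and f f' :: "real \<Rightarrow> complex"
  assumes \<phi>: "\<And>x. (\<phi> has_real_derivative \<phi>1 x) (at x)" "continuous_on UNIV \<phi>1" "\<And>x. \<bar>\<phi>1 x\<bar> \<le> M"
    and f: "\<And>x. (f has_vector_derivative f' x) (at x)" "continuous_on UNIV f'" and l: "0 < l"
  shows "mean (\<lambda>x. (cmod (of_real (1 / real l) * transfer l \<phi> s (\<lambda>y. f' y + \<i> * of_real (s * \<phi>1 y) * f y) x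
             - \<i> * of_real (\<nu> / real l) * transfer l \<phi> s f x))^2)
    \<le> 2 / (real l)^2 * (mean (\<lambda>x. (cmod (f' x - \<i> * of_real \<nu> * f x))^2)
        + (s * M)^2 * mean (\<lambda>x. (cmod (f x))^2))"
proof -
  note cont\<phi> = continuous_on_line_real_derivative[OF \<phi>(1)]
  note contf = continuous_on_line_vector_derivative[OF f(1)]
  define g where "g y = (f' y - \<i> * of_real \<nu> * f y) + \<i> * of_real (s * \<phi>1 y) * f y" for y
  have contg: "continuous_on A g" for A
    unfolding g_def
    by (intro continuous_intros continuous_on_subset_UNIV[OF f(2)] contf continuous_on_subset_UNIV[OF \<phi>(2)])
  have "of_real (1 / real l) * transfer l \<phi> s (\<lambda>y. f' y + \<i> * of_real (s * \<phi>1 y) * f y) x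
             - \<i> * of_real (\<nu> / real l) * transfer l \<phi> s f x = of_real (1 / real l) * transfer l \<phi> s g x" for x
    by (simp add: transfer_def g_def sum_distrib_left sum_subtractf[symmetric] algebra_simps)
  hence "mean (\<lambda>x. (cmod (of_real (1 / real l) * transfer l \<phi> s (\<lambda>y. f' y + \<i> * of_real (s * \<phi>1 y) * f y) x
             - \<i> * of_real (\<nu> / real l) * transfer l \<phi> s f x))^2)
     = mean (\<lambda>x. 1 / (real l)^2 * (cmod (transfer l \<phi> s g x))^2)"
    by (simp add: norm_mult norm_divide power_divide)
  also have "\<dots> = 1 / (real l)^2 * mean (\<lambda>x. (cmod (transfer l \<phi> s g x))^2)"
    by (rule integral_mult_right)
  also have "\<dots> \<le> 1 / (real l)^2 * mean (\<lambda>x. (cmod (g x))^2)"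
    by (intro mult_left_mono transfer_contraction cont\<phi> contg l) auto
  also have "mean (\<lambda>x. (cmod (g x))^2)
     \<le> mean (\<lambda>x. 2 * (cmod (f' x - \<i> * of_real \<nu> * f x))^2 + 2 * (s * M)^2 * (cmod (f x))^2)"
  proof (rule integral_le)
    show "(cmod (g y))^2 \<le> 2 * (cmod (f' y - \<i> * of_real \<nu> * f y))^2 + 2 * (s * M)^2 * (cmod (f y))^2" for y
    proof -
      define a b where "a = cmod (f' y - \<i> * of_real \<nu> * f y)" and "b = cmod (\<i> * of_real (s * \<phi>1 y) * f y)"
      have "cmod (g y) \<le> a + b" unfolding g_def a_def b_def by (rule norm_triangle_ineq)
      hence "(cmod (g y))^2 \<le> (a + b)^2" by (intro power_mono) auto
      also have "\<dots> \<le> 2 * a^2 + 2 * b^2"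
        using sum_squares_bound[of a b] by (simp add: power2_sum)
      also have "b^2 \<le> (s * M)^2 * (cmod (f y))^2"
      proof -
        have "b^2 = s^2 * \<bar>\<phi>1 y\<bar>^2 * (cmod (f y))^2"
          by (simp add: b_def norm_mult power_mult_distrib)
        also have "\<dots> \<le> s^2 * M^2 * (cmod (f y))^2"
          by (intro mult_right_mono mult_left_mono power_mono \<phi>(3)) auto
        finally show ?thesis by (simp add: power_mult_distrib)
      qed
      finally show ?thesis by (simp add: a_def)
    qed
  qed (intro integrable_continuous_real continuous_intros contg contf
      continuous_on_subset_UNIV[OF f(2)])+
  also have "\<dots> = 2 * mean (\<lambda>x. (cmod (f' x - \<i> * of_real \<nu> * f x))^2)
     + 2 * (s * M)^2 * mean (\<lambda>x. (cmod (f x))^2)"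
  proof -
    have "(\<lambda>x. (cmod (f' x - \<i> * of_real \<nu> * f x))^2) integrable_on {0..1}"
      "(\<lambda>x. (cmod (f x))^2) integrable_on {0..1}"
      by (intro integrable_continuous_real continuous_intros contf continuous_on_subset_UNIV[OF f(2)])+
    thus ?thesis
      by (subst Henstock_Kurzweil_Integration.integral_add) (simp_all only: integrable_on_mult_right integral_mult_right)
  qed
  finally show ?thesis by (simp add: algebra_simps divide_right_mono)
qed

section \<open>Periodic analytic functions and their sublevel sets\<close>

text \<open>The form in which compactness of the circle is used: a single parameter \<open>N\<close>, to be enlarged at
  will, encodes all constants of a local statement.\<close>

lemma periodic_locally_uniform_imp_uniform:
  fixes P :: "nat \<Rightarrow> real \<Rightarrow> bool"
  assumes loc: "\<And>x0. \<exists>N. \<exists>d>0. \<forall>x. \<bar>x - x0\<bar> < d \<longrightarrow> P N x"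
    and mono: "\<And>N N' x. N \<le> N' \<Longrightarrow> P N x \<Longrightarrow> P N' x"
    and per: "\<And>N x. P N (x + 1) = P N x"
  shows "\<exists>N. \<forall>x. P N x"
proof -
  obtain N d where Nd: "\<And>x0. d x0 > 0" "\<And>x0 x. \<bar>x - x0\<bar> < d x0 \<Longrightarrow> P (N x0) x"
    using loc by metis
  have "{0..1::real} \<subseteq> (\<Union>x0\<in>UNIV. ball x0 (d x0))"
    using Nd(1) by (auto intro: centre_in_ball[THEN iffD2])
  then obtain S where S: "finite S" "{0..1} \<subseteq> (\<Union>x0\<in>S. ball x0 (d x0))"
    by (rule compactE_image[OF compact_Icc, rotated]) auto
  have "P (\<Sum>x\<in>S. N x) x" for x
  proof -
    have "frac x \<in> {0..1}" using frac_lt_1[of x] by (auto simp: less_imp_le)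
    with S(2) have "frac x \<in> (\<Union>x0\<in>S. ball x0 (d x0))" by (rule subsetD)
    then obtain x0 where x0: "x0 \<in> S" "frac x \<in> ball x0 (d x0)" by (rule UN_E)
    hence "P (N x0) (frac x)" by (intro Nd(2)) (auto simp: dist_real_def abs_minus_commute)
    moreover have "N x0 \<le> (\<Sum>x\<in>S. N x)" by (rule member_le_sum) (use x0 S in auto)
    ultimately have "P (\<Sum>x\<in>S. N x) (frac x)" using mono by blast
    thus ?thesis
      using periodic_add_int[of "P (\<Sum>x\<in>S. N x)" "frac x" "\<lfloor>x\<rfloor>"] per by (simp add: frac_def)
  qed
  thus ?thesis by blast
qed

text \<open>The sequence of all derivatives of a periodic real-analytic function. The bound by
  \<open>C * fact p * Q ^ p\<close> is the Cauchy estimate, and it characterises analyticity on the circle; unlike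
  power series it passes easily to derivatives and to series of rescaled copies.\<close>

definition analytic_jet :: "(nat \<Rightarrow> real \<Rightarrow> real) \<Rightarrow> bool" where
  "analytic_jet F \<longleftrightarrow>
     (\<forall>p x. (F p has_real_derivative F (Suc p) x) (at x)) \<and>
     (\<forall>p x. F p (x + 1) = F p x) \<and>
     (\<exists>C>0. \<exists>Q>0. \<forall>p x. \<bar>F p x\<bar> \<le> C * fact p * Q ^ p)"

lemma fact_add_le: "(fact (n + p) :: real) \<le> fact n * fact p * 2 ^ (n + p)"
proof -
  have "(fact (n + p) :: real) = fact n * fact p * real ((n + p) choose n)"
  proof -
    have "fact n * fact p * ((n + p) choose n) = (fact (n + p) :: nat)"
      using binomial_fact_lemma[of n "n + p"] by simp
    hence "real (fact n * fact p * ((n + p) choose n)) = real (fact (n + p))"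
      by (rule arg_cong)
    thus ?thesis by (simp only: of_nat_mult of_nat_fact)
  qed
  also have "real ((n + p) choose n) \<le> 2 ^ (n + p)"
  proof -
    have "real ((n + p) choose n) \<le> real (2 ^ (n + p))"
      unfolding of_nat_le_iff by (rule binomial_le_pow2)
    thus ?thesis by simp
  qed
  finally show ?thesis by (simp add: mult_left_mono)
qed

lemma funpow_diffs: "(diffs ^^ p) a n = fact (n + p) / fact n * (a (n + p) :: real)"
proof (induction p arbitrary: n)
  case (Suc p)
  have "(diffs ^^ Suc p) a n = real (Suc n) * (diffs ^^ p) a (Suc n)"
    by (simp add: diffs_def)
  also have "\<dots> = fact (n + Suc p) / fact n * a (n + Suc p)"
    by (simp only: Suc fact_Suc add_Suc_right add_Suc) (simp del: of_nat_Suc)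
  finally show ?case .
qed simp

lemma real_analytic_local_derivatives:
  assumes sums: "\<And>x. \<bar>x - x0\<bar> < r \<Longrightarrow> (\<lambda>k. a k * (x - x0) ^ k) sums f x" and r: "0 < r"
  shows "\<bar>h\<bar> < r \<Longrightarrow> summable (\<lambda>k. (diffs ^^ p) a k * h ^ k)"
    and "\<bar>x - x0\<bar> < r \<Longrightarrow> (deriv ^^ p) f x = (\<Sum>k. (diffs ^^ p) a k * (x - x0) ^ k)"
    and "\<bar>x - x0\<bar> < r \<Longrightarrow> ((deriv ^^ p) f has_real_derivative (deriv ^^ Suc p) f x) (at x)"
proof -
  have "(\<forall>h. \<bar>h\<bar> < r \<longrightarrow> summable (\<lambda>k. (diffs ^^ p) a k * h ^ k)) \<and>
    (\<forall>x. \<bar>x - x0\<bar> < r \<longrightarrow> (deriv ^^ p) f x = (\<Sum>k. (diffs ^^ p) a k * (x - x0) ^ k))" for p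
  proof (induction p)
    case 0
    have "summable (\<lambda>k. a k * h ^ k)" if "\<bar>h\<bar> < r" for h
      using sums[of "x0 + h"] that by (auto simp: sums_iff)
    thus ?case using sums by (auto simp: sums_iff)
  next
    case (Suc p)
    let ?a = "(diffs ^^ p) a"
    have 1: "summable (\<lambda>k. diffs ?a k * h ^ k)" if "\<bar>h\<bar> < r" for h
      using that Suc by (intro termdiff_converges[of h r]) auto
    have 2: "deriv ((deriv ^^ p) f) x = (\<Sum>k. diffs ?a k * (x - x0) ^ k)" if x: "\<bar>x - x0\<bar> < r" for x
    proof -
      have "((\<lambda>h. \<Sum>k. ?a k * h ^ k) has_real_derivative (\<Sum>k. diffs ?a k * (x - x0) ^ k)) (at (x - x0))"
        by (rule termdiffs_strong'[of r]) (use x Suc in auto)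
      hence "((\<lambda>x. \<Sum>k. ?a k * (x - x0) ^ k) has_real_derivative (\<Sum>k. diffs ?a k * (x - x0) ^ k)) (at x)"
        using DERIV_shift[of "\<lambda>h. \<Sum>k. ?a k * h ^ k" _ x "- x0"] by simp
      hence "((deriv ^^ p) f has_real_derivative (\<Sum>k. diffs ?a k * (x - x0) ^ k)) (at x)"
      proof (rule has_field_derivative_transform_within_open[of _ _ _ "ball x0 r"])
        fix y assume "y \<in> ball x0 r"
        hence "\<bar>y - x0\<bar> < r" by (simp add: dist_real_def abs_minus_commute)
        thus "(\<Sum>k. ?a k * (y - x0) ^ k) = (deriv ^^ p) f y" using Suc by auto
      qed (use x in \<open>auto simp: dist_real_def abs_minus_commute\<close>)
      thus ?thesis by (rule DERIV_imp_deriv)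
    qed
    show ?case using 1 2 by simp
  qed
  hence S: "\<And>p h. \<bar>h\<bar> < r \<Longrightarrow> summable (\<lambda>k. (diffs ^^ p) a k * h ^ k)"
    and E: "\<And>p x. \<bar>x - x0\<bar> < r \<Longrightarrow> (deriv ^^ p) f x = (\<Sum>k. (diffs ^^ p) a k * (x - x0) ^ k)"
    by auto
  show "\<bar>h\<bar> < r \<Longrightarrow> summable (\<lambda>k. (diffs ^^ p) a k * h ^ k)"
    and "\<bar>x - x0\<bar> < r \<Longrightarrow> (deriv ^^ p) f x = (\<Sum>k. (diffs ^^ p) a k * (x - x0) ^ k)"
    using S E by auto
  assume x: "\<bar>x - x0\<bar> < r"
  have "((\<lambda>h. \<Sum>k. (diffs ^^ p) a k * h ^ k) has_real_derivative (\<Sum>k. diffs ((diffs ^^ p) a) k * (x - x0) ^ k)) (at (x - x0))"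
    by (rule termdiffs_strong'[of r]) (use x S in auto)
  hence "((\<lambda>x. \<Sum>k. (diffs ^^ p) a k * (x - x0) ^ k) has_real_derivative (\<Sum>k. diffs ((diffs ^^ p) a) k * (x - x0) ^ k)) (at x)"
    using DERIV_shift[of "\<lambda>h. \<Sum>k. (diffs ^^ p) a k * h ^ k" _ x "- x0"] by simp
  hence "((\<lambda>x. \<Sum>k. (diffs ^^ p) a k * (x - x0) ^ k) has_real_derivative (deriv ^^ Suc p) f x) (at x)"
    using E[OF x, of "Suc p"] by simp
  thus "((deriv ^^ p) f has_real_derivative (deriv ^^ Suc p) f x) (at x)"
  proof (rule has_field_derivative_transform_within_open[of _ _ _ "ball x0 r"])
    fix y assume "y \<in> ball x0 r"
    hence "\<bar>y - x0\<bar> < r" by (simp add: dist_real_def abs_minus_commute)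
    thus "(\<Sum>k. (diffs ^^ p) a k * (y - x0) ^ k) = (deriv ^^ p) f y" using E by auto
  qed (use x in \<open>auto simp: dist_real_def abs_minus_commute\<close>)
qed

text \<open>Differentiating \<open>p\<close> times multiplies the coefficient of order \<open>k + p\<close> by at most \<open>fact p * 2 ^ (k + p)\<close>. At a
  quarter of the radius \<open>\<rho>\<close> a geometric series with ratio \<open>1/2\<close> remains.\<close>

lemma real_analytic_local_bound:
  assumes sums: "\<And>x. \<bar>x - x0\<bar> < r \<Longrightarrow> (\<lambda>k. a k * (x - x0) ^ k) sums f x" and r: "0 < r"
  shows "\<exists>N::nat. \<exists>d>0. \<forall>x. \<bar>x - x0\<bar> < d \<longrightarrow> (\<forall>p. \<bar>(deriv ^^ p) f x\<bar> \<le> real N * fact p * real N ^ p)"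
proof -
  define \<rho> where "\<rho> = r / 2"
  have \<rho>: "0 < \<rho>" "\<rho> < r" using r by (auto simp: \<rho>_def)
  have "summable (\<lambda>k. a k * \<rho> ^ k)"
    using real_analytic_local_derivatives(1)[OF sums r, of \<rho> 0] \<rho> by simp
  hence "Bseq (\<lambda>k. a k * \<rho> ^ k)"
    by (intro convergent_imp_Bseq) (auto simp: convergent_def dest: summable_LIMSEQ_zero)
  then obtain M where M: "0 < M" "\<And>k. norm (a k * \<rho> ^ k) \<le> M"
    by (auto simp: Bseq_def)
  have ak: "\<bar>a k\<bar> \<le> M / \<rho> ^ k" for k
    using M(2)[of k] \<rho> by (simp add: abs_mult field_simps)
  obtain N where N: "2 * M \<le> real N" "2 / \<rho> \<le> real N"
    by (metis linorder_le_cases max.coboundedI1 max.coboundedI2 max.bounded_iff real_arch_simple)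
  have "\<bar>(deriv ^^ p) f x\<bar> \<le> real N * fact p * real N ^ p" if x: "\<bar>x - x0\<bar> < \<rho> / 4" for x p
  proof -
    define h where "h = x - x0"
    have h: "\<bar>h\<bar> < \<rho> / 4" "\<bar>h\<bar> < r" using x \<rho> by (auto simp: h_def)
    have tm: "norm ((diffs ^^ p) a k * h ^ k) \<le> M * fact p * (2 / \<rho>) ^ p * (1 / 2) ^ k" for k
    proof -
      have "norm ((diffs ^^ p) a k * h ^ k) = fact (k + p) / fact k * \<bar>a (k + p)\<bar> * \<bar>h\<bar> ^ k"
        by (simp add: funpow_diffs abs_mult power_abs)
      also have "\<dots> \<le> fact p * 2 ^ (k + p) * (M / \<rho> ^ (k + p)) * (\<rho> / 4) ^ k"
        using fact_add_le[of k p] h \<rho> M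
        by (intro mult_mono ak power_mono) (auto simp: field_simps)
      also have "\<dots> = M * fact p * (2 / \<rho>) ^ p * (2 / \<rho> * (\<rho> / 4)) ^ k"
        by (simp add: power_add power_divide power_mult_distrib)
      also have "2 / \<rho> * (\<rho> / 4) = 1 / 2" using \<rho> by simp
      finally show ?thesis .
    qed
    have geo: "summable (\<lambda>k. M * fact p * (2 / \<rho>) ^ p * (1 / 2) ^ k)"
      by (intro summable_mult summable_geometric) auto
    have "\<bar>(deriv ^^ p) f x\<bar> = norm (\<Sum>k. (diffs ^^ p) a k * h ^ k)"
      using real_analytic_local_derivatives(2)[OF sums r, of x p] h by (simp add: h_def)
    also have "\<dots> \<le> (\<Sum>k. M * fact p * (2 / \<rho>) ^ p * (1 / 2) ^ k)"
      by (rule norm_suminf_le[OF tm geo])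
    also have "\<dots> = 2 * M * fact p * (2 / \<rho>) ^ p"
      by (subst suminf_mult) (simp_all add: summable_geometric suminf_geometric)
    also have "\<dots> \<le> real N * fact p * real N ^ p"
      using N M \<rho> by (intro mult_mono power_mono) auto
    finally show ?thesis .
  qed
  moreover have "0 < \<rho> / 4" using \<rho> by simp
  ultimately show ?thesis by blast
qed

lemma real_analytic_periodic_jet:
  assumes an: "real_analytic f" and per: "\<And>x. f (x + 1) = f x"
  shows "analytic_jet (\<lambda>p. (deriv ^^ p) f)"
proof -
  let ?F = "\<lambda>p. (deriv ^^ p) f"
  have der: "(?F p has_real_derivative ?F (Suc p) x) (at x)" for p x
  proof -
    obtain a r where "r > 0" "\<And>y. \<bar>y - x\<bar> < r \<Longrightarrow> (\<lambda>k. a k * (y - x) ^ k) sums f y"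
      using an unfolding real_analytic_def by metis
    from real_analytic_local_derivatives(3)[OF this(2) this(1), of x p] this(1) show ?thesis by simp
  qed
  have perF: "?F p (x + 1) = ?F p x" for p x
  proof (induction p arbitrary: x)
    case (Suc p)
    have "((\<lambda>y. ?F p (y + 1)) has_real_derivative ?F (Suc p) (x + 1)) (at x)"
      using der[of p "x + 1"] DERIV_shift[of "?F p" _ x 1] by simp
    hence "(?F p has_real_derivative ?F (Suc p) (x + 1)) (at x)"
      by (simp only: Suc)
    thus ?case using der DERIV_unique by blast
  qed (simp add: per)
  have "\<exists>N::nat. \<forall>x. \<forall>p. \<bar>?F p x\<bar> \<le> real N * fact p * real N ^ p"
  proof (rule periodic_locally_uniform_imp_uniform)
    fix x0 :: real
    obtain a r where "r > 0" "\<And>y. \<bar>y - x0\<bar> < r \<Longrightarrow> (\<lambda>k. a k * (y - x0) ^ k) sums f y"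
      using an unfolding real_analytic_def by metis
    from real_analytic_local_bound[OF this(2) this(1)]
    show "\<exists>N. \<exists>d>0. \<forall>x. \<bar>x - x0\<bar> < d \<longrightarrow> (\<forall>p. \<bar>?F p x\<bar> \<le> real N * fact p * real N ^ p)" .
  next
    fix N N' :: nat and x assume *: "N \<le> N'" "\<forall>p. \<bar>?F p x\<bar> \<le> real N * fact p * real N ^ p"
    show "\<forall>p. \<bar>?F p x\<bar> \<le> real N' * fact p * real N' ^ p"
    proof
      fix p
      have "real N * fact p * real N ^ p \<le> real N' * fact p * real N' ^ p"
        using *(1) by (intro mult_mono power_mono) auto
      thus "\<bar>?F p x\<bar> \<le> real N' * fact p * real N' ^ p" using *(2) order_trans by blast
    qed
  qed (simp only: perF)
  then obtain N :: nat where N: "\<And>x p. \<bar>?F p x\<bar> \<le> real N * fact p * real N ^ p" by blast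
  have "\<bar>?F p x\<bar> \<le> (real N + 1) * fact p * (real N + 1) ^ p" for p x
    by (rule order_trans[OF N]) (intro mult_mono power_mono, auto)
  moreover have "real N + 1 > 0" by simp
  ultimately show ?thesis unfolding analytic_jet_def using der perF by blast
qed

context
  fixes F :: "nat \<Rightarrow> real \<Rightarrow> real"
  assumes jet: "analytic_jet F"
begin

lemma jet_derivative: "(F p has_real_derivative F (Suc p) x) (at x)"
  using jet by (simp add: analytic_jet_def)

lemma jet_periodic: "F p (x + 1) = F p x"
  using jet by (simp add: analytic_jet_def)

lemma jet_continuous: "continuous_on A (F p)"
  by (rule continuous_on_line_real_derivative[OF jet_derivative])

lemma jet_bounded:
  obtains M where "0 < M" and "\<And>x. \<bar>F p x\<bar> \<le> M"
  using periodic_continuous_bounded[OF jet_continuous jet_periodic, of p] by (metis real_norm_def)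

text \<open>The remainder of Taylor's formula at \<open>y\<close> tends to 0 at a distance from \<open>y\<close> that depends on \<open>Q\<close> alone.\<close>

lemma jet_vanishing_step:
  assumes bound: "\<And>p x. \<bar>F p x\<bar> \<le> C * fact p * Q ^ p" and Q: "0 < Q"
    and zero: "\<And>p. 1 \<le> p \<Longrightarrow> F p y = 0" and x: "\<bar>x - y\<bar> \<le> 1 / (4 * Q)"
  shows "F p x = F p y"
proof (cases "x = y")
  case False
  have "0 \<le> C" using bound[of 0 0] by simp
  have est: "\<bar>F p x - F p y\<bar> \<le> C * fact p * (2 * Q) ^ p * (1 / 2) ^ Suc n" for n
  proof -
    obtain t where "F p x = (\<Sum>m<Suc n. F (p + m) y / fact m * (x - y) ^ m) + F (p + Suc n) t / fact (Suc n) * (x - y) ^ Suc n"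
      using Taylor[of "Suc n" "\<lambda>m. F (p + m)" "F p" "min x y" "max x y" y x] jet_derivative False by auto
    moreover have "(\<Sum>m<Suc n. F (p + m) y / fact m * (x - y) ^ m) = F p y"
      by (subst sum.lessThan_Suc_shift) (simp add: zero)
    ultimately have "\<bar>F p x - F p y\<bar> = \<bar>F (p + Suc n) t\<bar> / fact (Suc n) * \<bar>x - y\<bar> ^ Suc n"
      by (simp add: abs_mult power_abs)
    also have "\<dots> \<le> (C * (fact p * fact (Suc n) * 2 ^ (p + Suc n)) * Q ^ (p + Suc n)) / fact (Suc n) * (1 / (4 * Q)) ^ Suc n"
      using \<open>0 \<le> C\<close> Q x fact_add_le[of p "Suc n"]
      by (intro mult_mono divide_right_mono power_mono order_trans[OF bound] mult_right_mono mult_left_mono) auto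
    also have "\<dots> = C * fact p * (2 * Q) ^ p * (2 * Q * (1 / (4 * Q))) ^ Suc n"
    proof -
      have "C * (P * G * 2 ^ (p + k)) * Q ^ (p + k) / G * R ^ k = C * P * (2 * Q) ^ p * (2 * Q * R) ^ k"
        if "G \<noteq> 0" for P G R :: real and k
        using that by (simp add: power_add power_mult_distrib)
      thus ?thesis by (metis fact_nonzero)
    qed
    also have "2 * Q * (1 / (4 * Q)) = 1 / 2" using Q by simp
    finally show ?thesis .
  qed
  have "(\<lambda>n. C * fact p * (2 * Q) ^ p * (1 / 2) ^ Suc n) \<longlonglongrightarrow> C * fact p * (2 * Q) ^ p * 0"
    by (intro tendsto_intros LIMSEQ_Suc LIMSEQ_power_zero) auto
  hence "\<bar>F p x - F p y\<bar> \<le> 0"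
    using est by (intro LIMSEQ_le_const) (auto simp del: power_Suc)
  thus ?thesis by simp
qed simp

text \<open>Since the distance reached in \<open>jet_vanishing_step\<close> does not depend on the point, finitely many steps
  lead from \<open>y\<close> to any other point.\<close>

lemma jet_constant_if_vanishing:
  assumes zero: "\<And>p. 1 \<le> p \<Longrightarrow> F p y = 0"
  shows "F 0 x = F 0 y"
proof -
  obtain C Q where bound: "\<And>p x. \<bar>F p x\<bar> \<le> C * fact p * Q ^ p" and Q: "0 < Q"
    using jet unfolding analytic_jet_def by blast
  define r where "r = 1 / (4 * Q)"
  have r: "0 < r" using Q by (simp add: r_def)
  have all: "\<bar>x - y\<bar> \<le> real k * r \<Longrightarrow> F p x = F p y" for k x p
  proof (induction k arbitrary: x p)
    case 0
    thus ?case by simp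
  next
    case (Suc k)
    \<comment> \<open>The point at \<open>k / (k + 1)\<close> of the way is within reach of both the induction hypothesis and a
      single step.\<close>
    define x' where "x' = y + (x - y) * (real k / real (Suc k))"
    have "\<bar>x' - y\<bar> = \<bar>x - y\<bar> * (real k / real (Suc k))" by (simp add: x'_def abs_mult)
    also have "\<dots> \<le> (real (Suc k) * r) * (real k / real (Suc k))" by (intro mult_right_mono Suc.prems) auto
    also have "\<dots> = real k * r" by simp
    finally have x': "\<bar>x' - y\<bar> \<le> real k * r" .
    have "x - x' = (x - y) / real (Suc k)" by (simp add: x'_def field_simps)
    hence "\<bar>x - x'\<bar> = \<bar>x - y\<bar> / real (Suc k)" by (simp add: abs_divide)
    also have "\<dots> \<le> (real (Suc k) * r) / real (Suc k)" by (intro divide_right_mono Suc.prems) auto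
    finally have "\<bar>x - x'\<bar> \<le> 1 / (4 * Q)" by (simp add: r_def)
    moreover have "F q x' = 0" if "1 \<le> q" for q using Suc.IH[OF x', of q] zero[OF that] by simp
    ultimately have "F p x = F p x'" by (intro jet_vanishing_step[OF bound Q]) auto
    thus ?case using Suc.IH[OF x', of p] by simp
  qed
  obtain k :: nat where "\<bar>x - y\<bar> / r \<le> real k" using real_arch_simple by blast
  hence "\<bar>x - y\<bar> \<le> real k * r" using r by (simp add: field_simps)
  from all[OF this] show ?thesis .
qed

lemma jet_finite_type:
  assumes "F 0 u \<noteq> F 0 v"
  shows "\<exists>N::nat. 1 \<le> N \<and> (\<forall>y. \<exists>p\<in>{1..N}. 1 / real N \<le> \<bar>F p y\<bar>)"
proof -
  have "\<exists>N::nat. \<forall>y. \<exists>p\<in>{1..N}. 1 / real N \<le> \<bar>F p y\<bar>"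
  proof (rule periodic_locally_uniform_imp_uniform)
    fix y
    obtain p where p: "1 \<le> p" "F p y \<noteq> 0"
      using jet_constant_if_vanishing[of y u] jet_constant_if_vanishing[of y v] assms by metis
    have "isCont (F p) y" using jet_derivative by (rule DERIV_isCont)
    then obtain d where d: "d > 0" "\<And>x. \<bar>x - y\<bar> < d \<Longrightarrow> \<bar>F p x - F p y\<bar> < \<bar>F p y\<bar> / 2"
      using p(2) unfolding continuous_at_eps_delta dist_real_def by (metis half_gt_zero zero_less_abs_iff)
    obtain K :: nat where K: "2 / \<bar>F p y\<bar> \<le> real K" using real_arch_simple by blast
    define N where "N = max (Suc K) p"
    have "1 / real N \<le> \<bar>F p x\<bar>" if "\<bar>x - y\<bar> < d" for x
    proof -
      have "2 / \<bar>F p y\<bar> \<le> real N" using K by (simp add: N_def)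
      hence "1 / real N \<le> \<bar>F p y\<bar> / 2" using p(2) by (simp add: N_def field_simps)
      also have "\<dots> \<le> \<bar>F p x\<bar>" using d(2)[OF that] by linarith
      finally show ?thesis .
    qed
    moreover have "p \<in> {1..N}" using p by (auto simp: N_def)
    ultimately show "\<exists>N. \<exists>d>0. \<forall>x. \<bar>x - y\<bar> < d \<longrightarrow> (\<exists>p\<in>{1..N}. 1 / real N \<le> \<bar>F p x\<bar>)"
      using d(1) by blast
  next
    fix N N' :: nat and x assume *: "N \<le> N'" "\<exists>p\<in>{1..N}. 1 / real N \<le> \<bar>F p x\<bar>"
    then obtain p where p: "p \<in> {1..N}" "1 / real N \<le> \<bar>F p x\<bar>" by blast
    have "1 / real N' \<le> 1 / real N" using * p by (intro divide_left_mono) auto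
    with p * show "\<exists>p\<in>{1..N'}. 1 / real N' \<le> \<bar>F p x\<bar>"
      by (intro bexI[of _ p]) auto
  qed (simp only: jet_periodic)
  then obtain N :: nat where N: "\<forall>y. \<exists>p\<in>{1..N}. 1 / real N \<le> \<bar>F p y\<bar>" by blast
  moreover have "1 \<le> N" using spec[OF N, of 0] by auto
  ultimately show ?thesis by blast
qed

end

text \<open>Where \<open>g'\<close> is not small, \<open>g\<close> passes quickly through its small values. Quantitatively,
  \<open>g' * (arctan (g / \<eta>))'\<close> is \<open>g'^2 * \<eta> / (g^2 + \<eta>^2)\<close>, and integration by parts moves the
  derivative from the bounded function \<open>arctan (g / \<eta>)\<close> to \<open>g'\<close>.\<close>

lemma integral_bump_descent:
  assumes g: "\<And>x. (g has_real_derivative g1 x) (at x)" "\<And>x. (g1 has_real_derivative g2 x) (at x)"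
    and g2: "continuous_on UNIV g2" "\<And>x. \<bar>g2 x\<bar> \<le> M"
    and per: "\<And>x. g (x + 1) = g x" "\<And>x. g1 (x + 1) = g1 x" and pos: "0 < \<eta>" "0 < c"
  shows "mean (\<lambda>x. bump \<eta> (g x) * (1 - bump c (g1 x))) \<le> 2 * M * \<eta> / c^2"
proof -
  have contg: "continuous_on A g" "continuous_on A g1" "continuous_on A g2" for A
    using continuous_on_line_real_derivative[OF g(1)] continuous_on_line_real_derivative[OF g(2)]
      continuous_on_subset_UNIV[OF g2(1)] by blast+
  have nz: "(g x)^2 + \<eta>^2 > 0" "(g1 x)^2 + c^2 > 0" for x using pos by (auto simp: add_nonneg_pos)
  have at: "((\<lambda>x. arctan (g x / \<eta>)) has_real_derivative g1 x * \<eta> / ((g x)^2 + \<eta>^2)) (at x)" for x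
  proof -
    have "inverse (1 + (g x / \<eta>)^2) * (g1 x / \<eta>) = g1 x * \<eta> / ((g x)^2 + \<eta>^2)"
      using nz(1)[of x] pos by (simp add: field_simps power2_eq_square)
    thus ?thesis using DERIV_chain2[OF DERIV_arctan DERIV_cdivide[OF g(1)[of x], of \<eta>]] by metis
  qed
  have "((\<lambda>x. g1 x * arctan (g x / \<eta>)) has_real_derivative
      (g1 x * (g1 x * \<eta> / ((g x)^2 + \<eta>^2)) + g2 x * arctan (g x / \<eta>))) (at x)" for x
    using DERIV_mult[OF g(2) at, of x] by (simp add: algebra_simps)
  hence v: "((\<lambda>x. g1 x * arctan (g x / \<eta>)) has_vector_derivative
      (g1 x * (g1 x * \<eta> / ((g x)^2 + \<eta>^2)) + g2 x * arctan (g x / \<eta>))) (at x)" for x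
    by (simp add: has_real_derivative_iff_has_vector_derivative)
  let ?A = "\<lambda>x. g1 x * (g1 x * \<eta> / ((g x)^2 + \<eta>^2))" and ?B = "\<lambda>x. g2 x * arctan (g x / \<eta>)"
  have contA: "continuous_on {0..1} ?A" and contB: "continuous_on {0..1} ?B"
    using nz(1) pos by (auto intro!: continuous_intros contg simp: less_imp_neq[THEN not_sym])
  have intA: "?A integrable_on {0..1}" and intB: "?B integrable_on {0..1}"
    using contA contB by (auto intro: integrable_continuous_real)
  have "mean (\<lambda>x. ?A x + ?B x) = 0"
    by (rule integral_circle_derivative[OF v]) (simp add: per)
  hence "mean ?A = - mean ?B"
    by (subst (asm) Henstock_Kurzweil_Integration.integral_add[OF intA intB]) simp
  also have "\<dots> \<le> norm (mean ?B)" by simp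
  also have "\<dots> \<le> mean (\<lambda>x::real. M * 2)"
  proof (rule integral_norm_bound_integral[OF intB])
    show "norm (g2 x * arctan (g x / \<eta>)) \<le> M * 2" for x
    proof -
      have "\<bar>arctan (g x / \<eta>)\<bar> \<le> 2"
        using arctan_bounded[of "g x / \<eta>"] pi_half_less_two by linarith
      thus ?thesis using g2(2)[of x] unfolding real_norm_def abs_mult by (intro mult_mono) auto
    qed
  qed auto
  finally have A: "mean ?A \<le> 2 * M" by simp
  have "mean (\<lambda>x. bump \<eta> (g x) * (1 - bump c (g1 x))) \<le> mean (\<lambda>x. \<eta> / c^2 * ?A x)"
  proof (rule integral_le)
    show "(\<lambda>x. bump \<eta> (g x) * (1 - bump c (g1 x))) integrable_on {0..1}"
      by (intro integrable_continuous_real continuous_on_mult continuous_on_diff continuous_on_const continuous_on_bump contg pos)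
    show "bump \<eta> (g x) * (1 - bump c (g1 x)) \<le> \<eta> / c^2 * ?A x" for x
    proof -
      have "1 - bump c (g1 x) = (g1 x)^2 / ((g1 x)^2 + c^2)"
      proof -
        have "(g1 x)^2 / ((g1 x)^2 + c^2) + c^2 / ((g1 x)^2 + c^2) = 1"
          unfolding add_divide_distrib[symmetric] using pos by simp
        thus ?thesis by (simp add: bump_def)
      qed
      also have "\<dots> \<le> (g1 x)^2 / c^2" using pos by (intro divide_left_mono) (auto simp: add_nonneg_pos)
      finally have "bump \<eta> (g x) * (1 - bump c (g1 x)) \<le> bump \<eta> (g x) * ((g1 x)^2 / c^2)"
        by (intro mult_left_mono bump_nonneg)
      also have "\<dots> = \<eta> / c^2 * ?A x" by (simp add: bump_def power2_eq_square mult_ac)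
      finally show ?thesis .
    qed
  qed (intro integrable_on_mult_right intA)
  also have "\<dots> = \<eta> / c^2 * mean ?A" by (rule integral_mult_right)
  also have "\<dots> \<le> \<eta> / c^2 * (2 * M)" using pos by (intro mult_left_mono A) auto
  finally show ?thesis by (simp add: mult_ac)
qed

text \<open>A product of numbers in \<open>[0, 1]\<close> decreases with \<open>n\<close>, and the loss at each step is recorded in the sum.\<close>

lemma prod_telescope_bound:
  fixes b :: "nat \<Rightarrow> real"
  assumes "\<And>p. 0 \<le> b p" "\<And>p. b p \<le> 1"
  shows "b 0 \<le> (\<Sum>p<n. b p * (1 - b (Suc p))) + (\<Prod>p\<le>n. b p)"
proof (induction n)
  case (Suc n)
  have "(\<Prod>p\<le>n. b p) \<le> b n"
  proof (cases n)
    case (Suc m)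
    have "(\<Prod>p\<le>m. b p) * b n \<le> 1 * b n" by (intro mult_right_mono prod_le_1) (use assms in auto)
    thus ?thesis by (simp add: Suc)
  qed simp
  hence "(\<Prod>p\<le>n. b p) * (1 - b (Suc n)) \<le> b n * (1 - b (Suc n))"
    using assms by (intro mult_right_mono) auto
  hence "(\<Prod>p\<le>n. b p) \<le> b n * (1 - b (Suc n)) + (\<Prod>p\<le>Suc n. b p)"
    by (simp add: algebra_simps)
  with Suc show ?case by simp
qed simp

text \<open>At every point some derivative of order \<open>1, \<dots>, N\<close> is bounded below. Along the chain of scales
  \<open>h p = \<eta> powr (3\<^sup>-\<^sup>p)\<close> either all derivatives up to order \<open>N\<close> are small simultaneously, which is
  excluded up to \<open>h N\<close>, or there is a first order \<open>p\<close> at which the function of order \<open>p\<close> is small while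
  the next one is not, which is rare by \<open>integral_bump_descent\<close>. Subtracting \<open>b\<close> changes no derivative,
  hence the uniformity in \<open>b\<close>.\<close>

lemma analytic_sublevel_estimate:
  assumes jet: "analytic_jet F" and nonconst: "F 0 u \<noteq> F 0 v"
  shows "\<exists>C>0. \<exists>\<kappa>. 0 < \<kappa> \<and> \<kappa> \<le> 1 \<and>
    (\<forall>b \<eta>. 0 < \<eta> \<and> \<eta> \<le> 1 \<longrightarrow> mean (\<lambda>y. bump \<eta> (F 0 y - b)) \<le> C * \<eta> powr \<kappa>)"
proof -
  obtain N :: nat where N: "1 \<le> N" "\<And>y. \<exists>p\<in>{1..N}. 1 / real N \<le> \<bar>F p y\<bar>"
    using jet_finite_type[OF jet nonconst] by blast
  obtain m where m: "\<And>p. 0 < m p" "\<And>p x. \<bar>F p x\<bar> \<le> m p"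
  proof -
    have "\<forall>p. \<exists>M. 0 < M \<and> (\<forall>x. \<bar>F p x\<bar> \<le> M)" using jet_bounded[OF jet] by metis
    thus ?thesis using that by metis
  qed
  define M where "M = (\<Sum>p<N. m (Suc (Suc p)))"
  define \<kappa> where "\<kappa> = (1 / 3 :: real) ^ N"
  define C where "C = 2 * M + (real N)^2 + 1"
  have M: "0 \<le> M" unfolding M_def using m(1) by (intro sum_nonneg) (auto intro: less_imp_le)
  have "mean (\<lambda>y. bump \<eta> (F 0 y - b)) \<le> C * \<eta> powr \<kappa>" if \<eta>: "0 < \<eta>" "\<eta> \<le> 1" for b \<eta>
  proof -
    define h where "h p = \<eta> powr ((1 / 3) ^ p)" for p :: nat
    have h: "0 < h p" "h p \<le> 1" for p
      using \<eta> by (auto simp: h_def powr_le1)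
    have h_mono: "h p \<le> h q" if "p \<le> q" for p q
      unfolding h_def using \<eta> that by (intro powr_mono' power_decreasing) auto
    have h_cube: "h p = h (Suc p) ^ 3" for p
    proof -
      have "h (Suc p) ^ 3 = h (Suc p) powr 3" using h[of "Suc p"] by (simp add: powr_numeral)
      also have "\<dots> = \<eta> powr ((1 / 3) ^ p)" by (simp add: h_def powr_powr)
      finally show ?thesis by (simp add: h_def)
    qed
    define G where "G p y = (if p = 0 then F 0 y - b else F p y)" for p y
    have G: "(G p has_real_derivative F (Suc p) x) (at x)" for p x
      unfolding G_def by (cases "p = 0") (auto intro!: derivative_eq_intros jet_derivative[OF jet])
    have contG: "continuous_on A (G p)" for A p
      by (rule continuous_on_line_real_derivative[OF G])
    have perG: "G p (x + 1) = G p x" for p x by (simp add: G_def jet_periodic[OF jet])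
    define B where "B p y = bump (h p) (G p y)" for p y
    have B: "0 \<le> B p y" "B p y \<le> 1" for p y by (simp_all add: B_def bump_nonneg bump_le_1)
    have contB: "continuous_on A (B p)" for A p
      unfolding B_def by (intro continuous_on_bump contG h)
    have descent: "mean (\<lambda>y. B p y * (1 - B (Suc p) y)) \<le> 2 * m (Suc (Suc p)) * h N"
      if "p < N" for p
    proof -
      have "mean (\<lambda>y. B p y * (1 - B (Suc p) y)) \<le> 2 * m (Suc (Suc p)) * h p / (h (Suc p))^2"
        unfolding B_def
      proof (rule integral_bump_descent[where ?g2.0 = "F (Suc (Suc p))"])
        show "(G p has_real_derivative G (Suc p) x) (at x)" for x
          using G[of p x] by (simp add: G_def)
        show "(G (Suc p) has_real_derivative F (Suc (Suc p)) x) (at x)" for x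
          using G[of "Suc p" x] .
      qed (use m h perG jet_continuous[OF jet] in auto)
      also have "\<dots> = 2 * m (Suc (Suc p)) * h (Suc p)"
        using h(1)[of "Suc p"] unfolding h_cube[of p] by (simp add: power2_eq_square power3_eq_cube)
      also have "\<dots> \<le> 2 * m (Suc (Suc p)) * h N"
        using that m(1)[of "Suc (Suc p)"] by (intro mult_left_mono h_mono) auto
      finally show ?thesis .
    qed
    have "mean (B 0) \<le> mean (\<lambda>y. (\<Sum>p<N. B p y * (1 - B (Suc p) y)) + (real N)^2 * h N)"
    proof (rule integral_le)
      show "B 0 integrable_on {0..1}" by (intro integrable_continuous_real contB)
      show "(\<lambda>y. (\<Sum>p<N. B p y * (1 - B (Suc p) y)) + (real N)^2 * h N) integrable_on {0..1}"
        by (intro integrable_continuous_real continuous_intros contB)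
      fix y
      obtain q where q: "q \<in> {1..N}" "1 / real N \<le> \<bar>F q y\<bar>" using N by blast
      have "(\<Prod>p\<le>N. B p y) \<le> B q y"
      proof -
        have "(\<Prod>p\<le>N. B p y) = B q y * (\<Prod>p\<in>{..N} - {q}. B p y)"
          using q by (intro prod.remove) auto
        also have "\<dots> \<le> B q y * 1" using B by (intro mult_left_mono prod_le_1) auto
        finally show ?thesis by simp
      qed
      also have "B q y \<le> (real N)^2 * h N"
      proof -
        have "0 < \<bar>F q y\<bar>" using q N(1) by (smt (verit) divide_pos_pos of_nat_0_less_iff One_nat_def Suc_le_eq)
        hence F0: "F q y \<noteq> 0" by simp
        have "B q y = (h q)^2 / ((F q y)^2 + (h q)^2)" using q by (simp add: B_def bump_def G_def)
        also have "\<dots> \<le> (h q)^2 / (F q y)^2" using F0 by (intro divide_left_mono) (auto simp: add_pos_nonneg)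
        also have "\<dots> = (h q)^2 * (1 / \<bar>F q y\<bar>)^2" by (simp add: power_divide)
        also have "\<dots> \<le> h N * (real N)^2"
        proof (intro mult_mono power_mono)
          have "(h q)^2 \<le> h q" using h[of q] by (simp add: power2_eq_square mult_left_le)
          also have "\<dots> \<le> h N" using q by (intro h_mono) auto
          finally show "(h q)^2 \<le> h N" .
          show "1 / \<bar>F q y\<bar> \<le> real N" using q(2) N(1) F0 by (simp add: field_simps)
        qed (use h[of N] in auto)
        finally show ?thesis by (simp add: mult.commute)
      qed
      finally show "B 0 y \<le> (\<Sum>p<N. B p y * (1 - B (Suc p) y)) + (real N)^2 * h N"
        using prod_telescope_bound[of "\<lambda>p. B p y" N, OF B] by linarith
    qed
    also have "\<dots> = (\<Sum>p<N. mean (\<lambda>y. B p y * (1 - B (Suc p) y))) + (real N)^2 * h N"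
    proof -
      have i: "(\<lambda>y. B p y * (1 - B (Suc p) y)) integrable_on {0..1}" for p
        by (intro integrable_continuous_real continuous_intros contB)
      have "mean (\<lambda>y. \<Sum>p<N. B p y * (1 - B (Suc p) y)) = (\<Sum>p<N. mean (\<lambda>y. B p y * (1 - B (Suc p) y)))"
        by (intro integral_sum finite_lessThan i)
      moreover have "(\<lambda>y. \<Sum>p<N. B p y * (1 - B (Suc p) y)) integrable_on {0..1}"
        by (intro integrable_sum finite_lessThan i)
      ultimately show ?thesis
        by (subst Henstock_Kurzweil_Integration.integral_add) auto
    qed
    also have "\<dots> \<le> (\<Sum>p<N. 2 * m (Suc (Suc p)) * h N) + (real N)^2 * h N"
      by (intro add_mono sum_mono descent) auto
    also have "\<dots> = (2 * M + (real N)^2) * h N"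
      by (simp add: M_def sum_distrib_left sum_distrib_right algebra_simps)
    also have "\<dots> \<le> C * h N" using h[of N] by (intro mult_right_mono) (auto simp: C_def)
    finally have "mean (B 0) \<le> C * h N" .
    moreover have "B 0 = (\<lambda>y. bump \<eta> (F 0 y - b))" using \<eta> by (auto simp: B_def G_def h_def)
    ultimately show ?thesis by (simp add: h_def \<kappa>_def)
  qed
  moreover have "0 < C" using M by (simp add: C_def add_nonneg_pos)
  moreover have "0 < \<kappa>" "\<kappa> \<le> 1" by (auto simp: \<kappa>_def power_le_one)
  ultimately show ?thesis by blast
qed

lemma bump_comparison:
  assumes "\<bar>x - y\<bar> \<le> M * \<eta>" and "0 < \<eta>"
  shows "bump \<eta> x \<le> (2 * M^2 + 2) * bump \<eta> y"
proof -
  have "y^2 \<le> 2 * x^2 + 2 * (x - y)^2"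
    using sum_squares_ge_zero[of "2 * x - y" 0] by (simp add: power2_eq_square algebra_simps)
  also have "(x - y)^2 \<le> (M * \<eta>)^2"
    using assms(1) by (rule abs_le_square_iff[THEN iffD1, OF order_trans]) simp
  finally have "y^2 + \<eta>^2 \<le> 2 * x^2 + (2 * M^2 + 1) * \<eta>^2"
    by (simp add: power_mult_distrib algebra_simps)
  also have "\<dots> \<le> (2 * M^2 + 2) * (x^2 + \<eta>^2)"
    by (simp add: algebra_simps)
  finally have le: "y^2 + \<eta>^2 \<le> (2 * M^2 + 2) * (x^2 + \<eta>^2)" .
  have "0 < x^2 + \<eta>^2" "0 < y^2 + \<eta>^2" using assms(2) by (auto simp: add_nonneg_pos)
  hence "1 / (x^2 + \<eta>^2) \<le> (2 * M^2 + 2) / (y^2 + \<eta>^2)"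
    using le by (simp add: field_simps)
  from mult_left_mono[OF this, of "\<eta>^2"] show ?thesis by (simp add: bump_def mult_ac)
qed

text \<open>A Riemann sum with \<open>l\<close> points is controlled by the integral as soon as the scale \<open>\<eta>\<close> of the bump is
  not finer than the spacing, since \<open>bump\<close> changes by a bounded factor between neighbouring points.\<close>

lemma average_bump_le_integral:
  fixes g :: "real \<Rightarrow> real"
  assumes g: "\<And>x. (g has_real_derivative g1 x) (at x)" "\<And>x. \<bar>g1 x\<bar> \<le> M" and per: "\<And>x. g (x + 1) = g x"
    and \<eta>: "1 / real l \<le> \<eta>" and l: "0 < l"
  shows "1 / real l * (\<Sum>k<l. bump \<eta> (g ((x + real k) / real l) - b))
    \<le> (2 * M^2 + 2) * mean (\<lambda>y. bump \<eta> (g y - b))"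
proof -
  have \<eta>0: "0 < \<eta>" using \<eta> l by (smt (verit) divide_pos_pos of_nat_0_less_iff)
  have contg: "continuous_on A g" for A by (rule continuous_on_line_real_derivative[OF g(1)])
  have M: "0 \<le> M" using g(2)[of 0] by linarith
  have lip: "\<bar>g y - g z\<bar> \<le> M * \<bar>y - z\<bar>" for y z
    using field_differentiable_bound[of UNIV g g1 M y z] g by (simp add: has_field_derivative_at_within)
  define h where "h y = bump \<eta> (g y - b)" for y
  have conth: "continuous_on A h" for A
    unfolding h_def by (intro continuous_on_bump continuous_intros contg \<eta>0)
  have perh: "h (y + 1) = h y" for y by (simp add: h_def per)
  have sh: "continuous_on UNIV (\<lambda>y. h (y + x / real l))"
    by (rule continuous_on_compose2[of UNIV h]) (auto intro!: continuous_intros conth)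
  let ?K = "2 * M^2 + 2"
  have "real l * (1 / real l * (\<Sum>k<l. h ((x + real k) / real l))) = mean (\<lambda>x'::real. \<Sum>k<l. h ((x + real k) / real l))"
    using l by simp
  also have "\<dots> \<le> mean (\<lambda>x'. ?K * (\<Sum>k<l. h ((x' + real k) / real l + x / real l)))"
  proof (rule integral_le)
    show "(\<lambda>x'. ?K * (\<Sum>k<l. h ((x' + real k) / real l + x / real l))) integrable_on {0..1}"
      using l by (intro integrable_continuous_real continuous_intros continuous_on_compose2[OF conth[of UNIV]]) auto
    fix x' :: real assume x': "x' \<in> {0..1}"
    have "h ((x + real k) / real l) \<le> ?K * h ((x' + real k) / real l + x / real l)" for k
      unfolding h_def
    proof (rule bump_comparison)
      have "\<bar>(x + real k) / real l - ((x' + real k) / real l + x / real l)\<bar> = \<bar>x'\<bar> / real l"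
        using l by (simp add: add_divide_distrib abs_divide)
      also have "\<dots> \<le> \<eta>" using x' \<eta> l by (smt (verit) atLeastAtMost_iff divide_right_mono of_nat_0_le_iff)
      finally have "M * \<bar>(x + real k) / real l - ((x' + real k) / real l + x / real l)\<bar> \<le> M * \<eta>"
        by (intro mult_left_mono M)
      thus "\<bar>g ((x + real k) / real l) - b - (g ((x' + real k) / real l + x / real l) - b)\<bar> \<le> M * \<eta>"
        using lip[of "(x + real k) / real l" "(x' + real k) / real l + x / real l"] by simp
    qed (rule \<eta>0)
    thus "(\<Sum>k<l. h ((x + real k) / real l)) \<le> ?K * (\<Sum>k<l. h ((x' + real k) / real l + x / real l))"
      unfolding sum_distrib_left by (intro sum_mono)
  qed auto
  also have "\<dots> = ?K * mean (\<lambda>x'. \<Sum>k<l. h ((x' + real k) / real l + x / real l))"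
    by (rule integral_mult_right)
  also have "mean (\<lambda>x'. \<Sum>k<l. h ((x' + real k) / real l + x / real l))
      = real l * mean (\<lambda>y. h (y + x / real l))"
    using integral_circle_branches[OF sh l] by simp
  also have "mean (\<lambda>y. h (y + x / real l)) = mean h"
    by (rule integral_circle_shift[OF conth perh])
  finally have "real l * (1 / real l * (\<Sum>k<l. h ((x + real k) / real l))) \<le> real l * (?K * mean h)"
    by (simp only: mult_ac)
  hence "1 / real l * (\<Sum>k<l. h ((x + real k) / real l)) \<le> ?K * mean h"
    by (rule mult_left_le_imp_le) (use l in simp)
  thus ?thesis unfolding h_def[abs_def] .
qed

text \<open>A periodic function with constant derivative has slope 0.\<close>

lemma jet_constant_if_derivative_constant:
  assumes jet: "analytic_jet F" and const: "\<And>x y. F (Suc p) x = F (Suc p) y"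
  shows "F p x = F p y"
proof -
  define c where "c = F (Suc p) 0"
  have "((\<lambda>x. F p x - c * x) has_real_derivative 0) (at x)" for x
    using jet_derivative[OF jet, of p x] const[of x 0] by (auto intro!: derivative_eq_intros simp: c_def)
  hence lin: "F p x - c * x = F p y - c * y" for x y
    by (intro DERIV_isconst_all) auto
  have "c = 0" using lin[of 1 0] jet_periodic[OF jet, of p 0] by simp
  thus ?thesis using lin[of x y] by simp
qed

lemma jet_derivatives_not_constant:
  assumes jet: "analytic_jet F" and nonconst: "F 0 u \<noteq> F 0 v"
  shows "\<exists>u v. F p u \<noteq> F p v"
proof (induction p)
  case (Suc p)
  thus ?case using jet_constant_if_derivative_constant[OF jet] by metis
qed (use nonconst in blast)

lemma analytic_jet_derivative:
  assumes "analytic_jet F"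
  shows "analytic_jet (\<lambda>q. F (p + q))"
proof -
  obtain C Q where C: "0 < C" and Q: "0 < Q" and bound: "\<And>p x. \<bar>F p x\<bar> \<le> C * fact p * Q ^ p"
    using assms unfolding analytic_jet_def by blast
  have "\<bar>F (p + q) x\<bar> \<le> (C * fact p * (2 * Q) ^ p) * fact q * (2 * Q) ^ q" for q x
  proof -
    have "\<bar>F (p + q) x\<bar> \<le> C * fact (p + q) * Q ^ (p + q)" by (rule bound)
    also have "\<dots> \<le> C * (fact p * fact q * 2 ^ (p + q)) * Q ^ (p + q)"
      using C Q by (intro mult_right_mono mult_left_mono fact_add_le) auto
    also have "\<dots> = (C * fact p * (2 * Q) ^ p) * fact q * (2 * Q) ^ q"
      by (simp add: power_add power_mult_distrib)
    finally show ?thesis .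
  qed
  moreover have "0 < C * fact p * (2 * Q) ^ p" "0 < 2 * Q" using C Q by auto
  moreover have "(F (p + q) has_real_derivative F (p + Suc q) x) (at x)" for q x
    using jet_derivative[OF assms, of "p + q"] by simp
  ultimately show ?thesis unfolding analytic_jet_def using jet_periodic[OF assms] by blast
qed

section \<open>Weierstrass functions\<close>

text \<open>The factor \<open>g\<close> of modulus 1 is lost, and what remains is that the mean of \<open>\<bar>f\<bar>\<close> is at most its
  quadratic mean.\<close>

lemma square_norm_integral_le:
  fixes f g :: "real \<Rightarrow> complex"
  assumes f: "continuous_on {0..1} f" and g: "continuous_on {0..1} g" and norm1: "\<And>x. cmod (g x) = 1"
  shows "(cmod (mean (\<lambda>x. f x * g x)))^2 \<le> mean (\<lambda>x. (cmod (f x))^2)"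
proof -
  define m where "m = mean (\<lambda>x. cmod (f x))"
  have i: "(\<lambda>x. cmod (f x)) integrable_on {0..1}" "(\<lambda>x. (cmod (f x))^2) integrable_on {0..1}"
    by (intro integrable_continuous_real continuous_intros f)+
  have "cmod (mean (\<lambda>x. f x * g x)) \<le> m"
    unfolding m_def using norm1
    by (intro integral_norm_bound_integral integrable_continuous_real continuous_intros f g) (auto simp: norm_mult)
  hence "(cmod (mean (\<lambda>x. f x * g x)))^2 \<le> m^2" by (intro power_mono) auto
  also have "m^2 \<le> mean (\<lambda>x. (cmod (f x))^2)"
  proof -
    have "0 \<le> mean (\<lambda>x. (cmod (f x) - m)^2)"
      by (intro integral_nonneg integrable_continuous_real continuous_intros f) auto
    also have "(\<lambda>x. (cmod (f x) - m)^2) = (\<lambda>x. (cmod (f x))^2 + ((-2 * m) * cmod (f x) + m^2))"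
      by (auto simp: power2_diff algebra_simps)
    also have "mean \<dots> = mean (\<lambda>x. (cmod (f x))^2) + ((-2 * m) * m + m^2)"
    proof -
      have j: "(\<lambda>x. (-2 * m) * cmod (f x)) integrable_on {0..1}" by (rule integrable_on_mult_right[OF i(1)])
      have k: "(\<lambda>x::real. m^2) integrable_on {0..1}" by (rule integrable_const_ivl)
      show ?thesis
        by (simp only: Henstock_Kurzweil_Integration.integral_add[OF i(2) integrable_add[OF j k]]
            Henstock_Kurzweil_Integration.integral_add[OF j k] integral_mult_right m_def[symmetric]) simp
    qed
    finally show ?thesis by (simp add: power2_eq_square)
  qed
  finally show ?thesis .
qed

context
  fixes \<phi> :: "real \<Rightarrow> real" and \<mu> :: real and l :: nat
  assumes \<phi>: "continuous_on UNIV \<phi>" "\<And>x. \<phi> (x + 1) = \<phi> x" and \<mu>: "0 < \<mu>" "\<mu> < 1"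
begin

lemma weierstrass_term_bound:
  obtains C where "0 < C" "\<And>j x. norm (\<mu> ^ j * \<phi> (real l ^ j * x)) \<le> C * \<mu> ^ j"
proof -
  obtain C where "0 < C" "\<And>x. norm (\<phi> x) \<le> C"
    using periodic_continuous_bounded[OF \<phi>] by metis
  with \<mu> show ?thesis by (intro that[of C]) (auto simp: abs_mult)
qed

lemma weierstrass_summable: "summable (\<lambda>j. \<mu> ^ j * \<phi> (real l ^ j * x))"
proof -
  obtain C where "0 < C" "\<And>j x. norm (\<mu> ^ j * \<phi> (real l ^ j * x)) \<le> C * \<mu> ^ j"
    using weierstrass_term_bound by blast
  thus ?thesis using \<mu>
    by (intro summable_comparison_test[OF _ summable_mult[OF summable_geometric], of _ C \<mu>]) auto
qed

lemma weierstrass_continuous: "continuous_on A (weierstrass \<phi> \<mu> l)"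
proof -
  obtain C where C: "0 < C" "\<And>j x. norm (\<mu> ^ j * \<phi> (real l ^ j * x)) \<le> C * \<mu> ^ j"
    using weierstrass_term_bound by blast
  have "uniform_limit UNIV (\<lambda>n x. \<Sum>j<n. \<mu> ^ j * \<phi> (real l ^ j * x)) (weierstrass \<phi> \<mu> l) sequentially"
    unfolding weierstrass_def[abs_def]
    using C \<mu> by (intro Weierstrass_m_test[of _ _ "\<lambda>j. C * \<mu> ^ j"] summable_mult summable_geometric) auto
  note ul = this
  have "continuous_on UNIV (\<lambda>x. \<phi> (real l ^ j * x))" for j
    by (rule continuous_on_compose2[OF \<phi>(1)]) (auto intro!: continuous_intros)
  hence "\<forall>n. continuous_on UNIV (\<lambda>x. \<Sum>j<n. \<mu> ^ j * \<phi> (real l ^ j * x))"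
    by (auto intro!: continuous_intros)
  hence "continuous_on UNIV (weierstrass \<phi> \<mu> l)"
    by (intro uniform_limit_theorem[OF always_eventually ul]) auto
  thus ?thesis by (rule continuous_on_subset_UNIV)
qed

lemma weierstrass_periodic: "weierstrass \<phi> \<mu> l (x + 1) = weierstrass \<phi> \<mu> l x"
proof -
  have "\<phi> (real l ^ j * (x + 1)) = \<phi> (real l ^ j * x)" for j
    using periodic_add_nat[of \<phi> "real l ^ j * x" "l ^ j", OF \<phi>(2)] by (simp add: distrib_left)
  thus ?thesis by (simp add: weierstrass_def)
qed

lemma weierstrass_split:
  "weierstrass \<phi> \<mu> l x = (\<Sum>j<m. \<mu> ^ j * \<phi> (real l ^ j * x)) + \<mu> ^ m * weierstrass \<phi> \<mu> l (real l ^ m * x)"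
proof -
  have "(\<Sum>j. \<mu> ^ (j + m) * \<phi> (real l ^ (j + m) * x)) = (\<Sum>j. \<mu> ^ m * (\<mu> ^ j * \<phi> (real l ^ j * (real l ^ m * x))))"
    by (simp add: power_add mult_ac)
  also have "\<dots> = \<mu> ^ m * weierstrass \<phi> \<mu> l (real l ^ m * x)"
    unfolding weierstrass_def by (rule suminf_mult[OF weierstrass_summable])
  finally show ?thesis
    unfolding weierstrass_def[of _ _ _ x] using suminf_split_initial_segment[OF weierstrass_summable, of x m] by simp
qed

lemma osc_integral_cis:
  "osc_integral \<phi> \<mu> l n t = mean (\<lambda>\<theta>. cis (2 * pi * of_int n * \<theta>) * cis (t * weierstrass \<phi> \<mu> l \<theta>))"
  unfolding osc_integral_def by (intro arg_cong[where f = "mean"] ext) (simp add: cis_conv_exp mult_ac)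

lemma osc_integral_le_1: "cmod (osc_integral \<phi> \<mu> l n t) \<le> 1"
proof -
  have "cmod (osc_integral \<phi> \<mu> l n t) \<le> mean (\<lambda>x::real. 1::real)"
    unfolding osc_integral_cis
    by (intro integral_norm_bound_integral integrable_continuous_real continuous_intros weierstrass_continuous)
      (auto simp: norm_mult)
  thus ?thesis by simp
qed

lemma sup_osc_bigo:
  assumes "\<And>n t. T \<le> \<bar>t\<bar> \<Longrightarrow> cmod (osc_integral \<phi> \<mu> l n t) \<le> C * \<bar>t\<bar> powr (- \<beta>)"
  shows "(\<lambda>t. sup_osc \<phi> \<mu> l t) \<in> O[at_infinity](\<lambda>t. \<bar>t\<bar> powr (- \<beta>))"
proof (rule landau_o.bigI[of "max 1 C"])
  have "norm (sup_osc \<phi> \<mu> l t) \<le> max 1 C * norm (\<bar>t\<bar> powr (- \<beta>))" if "T \<le> \<bar>t\<bar>" for t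
  proof -
    have bdd: "bdd_above (range (\<lambda>n. cmod (osc_integral \<phi> \<mu> l n t)))"
      using osc_integral_le_1 by (intro bdd_aboveI[of _ 1]) auto
    have "0 \<le> sup_osc \<phi> \<mu> l t"
      unfolding sup_osc_def by (rule cSUP_upper2[OF bdd, of 0]) auto
    moreover have "sup_osc \<phi> \<mu> l t \<le> C * \<bar>t\<bar> powr (- \<beta>)"
      unfolding sup_osc_def by (rule cSUP_least) (use assms that in auto)
    moreover have "C * \<bar>t\<bar> powr (- \<beta>) \<le> max 1 C * \<bar>t\<bar> powr (- \<beta>)"
      by (intro mult_right_mono) auto
    ultimately show ?thesis by simp
  qed
  thus "\<forall>\<^sub>F t in at_infinity. norm (sup_osc \<phi> \<mu> l t) \<le> max 1 C * norm (\<bar>t\<bar> powr (- \<beta>))"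
    unfolding eventually_at_infinity by (intro exI[of _ T]) auto
qed auto

end

section \<open>Decay for large bases\<close>

text \<open>The quantity that contracts by \<open>q\<close> at each step is \<open>\<integral>\<bar>f\<bar>^2 + l / s^2 * \<integral>\<bar>f' - \<i> \<nu> f\<bar>^2\<close>. The weight \<open>l\<close> makes
  the derivative harmless in \<open>transfer_L2_bound\<close> (with \<open>\<gamma> = \<bar>s\<bar> / sqrt l\<close>), and the factor \<open>1/l^2\<close> gained in
  \<open>transfer_covariant_derivative_bound\<close> pays for this weight and for the passage from \<open>s\<close> to
  \<open>s * \<mu>\<close>.\<close>

lemma iterated_transfer_decay:
  fixes \<phi> \<phi>1 \<phi>2 :: "real \<Rightarrow> real"
  assumes \<phi>: "\<And>x. (\<phi> has_real_derivative \<phi>1 x) (at x)" "\<And>x. (\<phi>1 has_real_derivative \<phi>2 x) (at x)"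
      "continuous_on UNIV \<phi>2" "\<And>x. \<bar>\<phi>1 x\<bar> \<le> M" "\<And>x. \<bar>\<phi>2 x\<bar> \<le> M"
    and per: "\<And>x. \<phi> (x + 1) = \<phi> x" "\<And>x. \<phi>1 (x + 1) = \<phi>1 x"
    and \<mu>: "0 < \<mu>" "\<mu> < 1" and l: "0 < l" and \<delta>: "0 < \<delta>"
    and coinc: "\<And>y. 1 / real l * (\<Sum>e<l. bump \<delta> (\<phi>1 (y + real e / real l) - \<phi>1 y)) \<le> K"
  defines "q \<equiv> K + 1 / (2 * \<delta> * sqrt (real l)) + 2 * M / (real l * \<delta>^2) + 2 * (M^2 + 1) / (real l * \<mu>^2)"
  assumes f: "\<And>x. (f has_vector_derivative f' x) (at x)" "continuous_on UNIV f'"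
      "\<And>x. f (x + 1) = f x" "\<And>x. f' (x + 1) = f' x"
    and s: "real l \<le> \<bar>s\<bar> * \<mu> ^ m"
  shows "(cmod (mean (\<lambda>x. f x * cis (s * weierstrass \<phi> \<mu> l x))))^2
    \<le> q ^ m * (mean (\<lambda>x. (cmod (f x))^2)
        + real l / s^2 * mean (\<lambda>x. (cmod (f' x - \<i> * of_real \<nu> * f x))^2))"
  using f s
proof (induction m arbitrary: f f' s \<nu>)
  case (0 f f' s \<nu>)
  note contf = continuous_on_line_vector_derivative[OF 0(1)]
  have contW: "continuous_on {0..1} (weierstrass \<phi> \<mu> l)"
    by (rule weierstrass_continuous[OF continuous_on_line_real_derivative[OF \<phi>(1)] per(1) \<mu>])
  have "(cmod (mean (\<lambda>x. f x * cis (s * weierstrass \<phi> \<mu> l x))))^2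
      \<le> mean (\<lambda>x. (cmod (f x))^2)"
    by (rule square_norm_integral_le) (auto intro!: continuous_intros contf contW)
  moreover have "0 \<le> mean (\<lambda>x. (cmod (f' x - \<i> * of_real \<nu> * f x))^2)"
    by (intro integral_nonneg integrable_continuous_real continuous_intros contf continuous_on_subset_UNIV[OF 0(2)]) auto
  ultimately show ?case by (simp add: add_increasing2)
next
  case (Suc m f f' s \<nu>)
  note cont\<phi> = continuous_on_line_real_derivative[OF \<phi>(1)] continuous_on_line_real_derivative[OF \<phi>(2)]
  note contf = continuous_on_line_vector_derivative[OF Suc.prems(1)]
  note contf' = continuous_on_subset_UNIV[OF Suc.prems(2)]
  let ?W = "weierstrass \<phi> \<mu> l"
  let ?A = "\<lambda>f. mean (\<lambda>x. (cmod (f x :: complex))^2)"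
  define A where "A = ?A f"
  define B where "B = ?A (\<lambda>x. f' x - \<i> * of_real \<nu> * f x)"
  define g where "g = transfer l \<phi> s f"
  define g' where "g' x = of_real (1 / real l) * transfer l \<phi> s (\<lambda>y. f' y + \<i> * of_real (s * \<phi>1 y) * f y) x" for x
  have A0: "0 \<le> A" and B0: "0 \<le> B" unfolding A_def B_def
    by (intro integral_nonneg integrable_continuous_real continuous_intros contf contf'; simp)+
  have M0: "0 \<le> M" using \<phi>(4)[of 0] by linarith
  have K0: "0 \<le> K" using coinc[of 0] by (rule order_trans[rotated]) (auto intro!: divide_nonneg_nonneg sum_nonneg bump_nonneg)
  have "\<bar>s\<bar> * \<mu> ^ Suc m \<le> \<bar>s\<bar> * 1" using \<mu> by (intro mult_left_mono power_le_one) auto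
  hence s: "real l \<le> \<bar>s\<bar>" using Suc.prems(5) by linarith
  hence s0: "s \<noteq> 0" using l by auto
  define R where "R = sqrt (real l)"
  have R: "0 < R" "R^2 = real l" using l by (auto simp: R_def)
  have contW: "continuous_on UNIV ?W"
    by (rule weierstrass_continuous[OF cont\<phi>(1) per(1) \<mu>])
  have W: "?W x = \<phi> x + \<mu> * ?W (real l * x)" for x
    using weierstrass_split[OF cont\<phi>(1) per(1) \<mu>, of l x 1] by simp
  have pw: "f x * cis (s * ?W x) = cis (s * \<phi> x) * f x * cis ((s * \<mu>) * ?W (real l * x))" for x
  proof -
    have "s * ?W x = s * \<phi> x + (s * \<mu>) * ?W (real l * x)" by (subst W) (simp add: algebra_simps)
    hence "cis (s * ?W x) = cis (s * \<phi> x) * cis ((s * \<mu>) * ?W (real l * x))" by (simp add: cis_mult)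
    thus ?thesis by (simp only: mult_ac)
  qed
  have "mean (\<lambda>x. f x * cis (s * ?W x)) = mean (\<lambda>x. cis (s * \<phi> x) * f x * cis ((s * \<mu>) * ?W (real l * x)))"
    by (simp only: pw)
  also have "\<dots> = mean (\<lambda>x. g x * cis ((s * \<mu>) * ?W x))"
    unfolding g_def
    by (rule integral_eq_integral_transfer[of \<phi> f "\<lambda>x. cis ((s * \<mu>) * ?W x)" l s, OF cont\<phi>(1) contf])
      (auto intro!: continuous_intros contW simp: weierstrass_periodic[OF cont\<phi>(1) per(1) \<mu>] l)
  finally have eq: "mean (\<lambda>x. f x * cis (s * ?W x)) = mean (\<lambda>x. g x * cis ((s * \<mu>) * ?W x))" .
  have g_der: "(g has_vector_derivative g' x) (at x)" for x
    unfolding g_def g'_def by (rule transfer_derivative[OF \<phi>(1) Suc.prems(1) l])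
  have g'_cont: "continuous_on UNIV g'"
    unfolding g'_def by (intro continuous_intros continuous_on_transfer cont\<phi> contf Suc.prems(2) l)
  have "(cmod (mean (\<lambda>x. g x * cis ((s * \<mu>) * ?W x))))^2
    \<le> q ^ m * (?A g + real l / (s * \<mu>)^2 * ?A (\<lambda>x. g' x - \<i> * of_real (\<nu> / real l) * g x))"
  proof (rule Suc.IH[OF g_der g'_cont])
    show "g (x + 1) = g x" for x
      unfolding g_def by (rule transfer_periodic[of \<phi> f l s, OF per(1) Suc.prems(3) l])
    show "g' (x + 1) = g' x" for x
      unfolding g'_def
      using transfer_periodic[of \<phi> "\<lambda>y. f' y + \<i> * of_real (s * \<phi>1 y) * f y" l s x] l
      by (simp only: per Suc.prems(3,4))
    show "real l \<le> \<bar>s * \<mu>\<bar> * \<mu> ^ m" using Suc.prems(5) \<mu> by (simp add: abs_mult mult_ac)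
  qed
  also have "\<dots> \<le> q ^ m * (q * (A + real l / s^2 * B))"
  proof (rule mult_left_mono)
    define V where "V = A + real l / s^2 * B"
    have BV: "B / s^2 \<le> real l / s^2 * B"
    proof -
      have "1 * (B / s^2) \<le> real l * (B / s^2)" using l B0 by (intro mult_right_mono) auto
      thus ?thesis by simp
    qed
    have V: "A \<le> V" "B / s^2 \<le> V" "0 \<le> V" using A0 B0 BV s0 by (auto simp: V_def)
    have gA: "?A g \<le> (K + 1 / (2 * \<delta> * R) + 2 * M / (real l * \<delta>^2)) * V"
    proof -
      have "?A g \<le> 1 / real l * mean (\<lambda>y. (\<Sum>e<l. bump \<delta> (\<phi>1 (y + real e / real l) - \<phi>1 y)) * (cmod (f y))^2)
        + 1 / \<bar>s\<bar> * (((\<bar>s\<bar> / R) * A + B / (\<bar>s\<bar> / R)) / (2 * \<delta>) + 2 * M / \<delta>^2 * A)"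
        unfolding g_def A_def B_def
        by (rule transfer_L2_bound[of \<phi> \<phi>1 \<phi>2 M f f' s \<delta> "\<bar>s\<bar> / R" l \<nu>, OF \<phi>(1,2,3,5) Suc.prems(1,2) per Suc.prems(3,4) s0 \<delta> _ l]) (use R s0 in auto)
      also have "1 / real l * mean (\<lambda>y. (\<Sum>e<l. bump \<delta> (\<phi>1 (y + real e / real l) - \<phi>1 y)) * (cmod (f y))^2)
        = mean (\<lambda>y. 1 / real l * (\<Sum>e<l. bump \<delta> (\<phi>1 (y + real e / real l) - \<phi>1 y)) * (cmod (f y))^2)"
        by (simp only: integral_mult_right[symmetric] mult.assoc)
      also have "\<dots> \<le> mean (\<lambda>y. K * (cmod (f y))^2)"
      proof (rule integral_le)
        have "continuous_on {0..1} (\<lambda>y. bump \<delta> (\<phi>1 (y + real e / real l) - \<phi>1 y))" for e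
          by (intro continuous_on_bump continuous_on_diff continuous_on_shift cont\<phi> \<delta>)
        thus "(\<lambda>y. 1 / real l * (\<Sum>e<l. bump \<delta> (\<phi>1 (y + real e / real l) - \<phi>1 y)) * (cmod (f y))^2) integrable_on {0..1}"
          by (intro integrable_continuous_real continuous_on_mult continuous_on_const continuous_on_sum
              continuous_on_power continuous_on_norm contf)
        show "(\<lambda>y. K * (cmod (f y))^2) integrable_on {0..1}"
          by (intro integrable_continuous_real continuous_intros contf)
      qed (intro mult_right_mono coinc, simp)
      also have "\<dots> = K * A" unfolding A_def by (rule integral_mult_right)
      also have "1 / \<bar>s\<bar> * (((\<bar>s\<bar> / R) * A + B / (\<bar>s\<bar> / R)) / (2 * \<delta>) + 2 * M / \<delta>^2 * A)
        = 1 / (2 * \<delta> * R) * V + 2 * M / (\<bar>s\<bar> * \<delta>^2) * A"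
      proof -
        have "1 / \<bar>s\<bar> * (((\<bar>s\<bar> / R) * A + B / (\<bar>s\<bar> / R)) / (2 * \<delta>)) = 1 / (2 * \<delta> * R) * (A + R^2 / \<bar>s\<bar>^2 * B)"
          using s0 R(1) \<delta> by (simp add: field_simps power2_eq_square)
        thus ?thesis using R(2) by (simp add: V_def distrib_left)
      qed
      also have "2 * M / (\<bar>s\<bar> * \<delta>^2) * A \<le> 2 * M / (real l * \<delta>^2) * A"
        using s l \<delta> M0 A0 by (intro mult_right_mono divide_left_mono mult_pos_pos) auto
      also have "K * A + (1 / (2 * \<delta> * R) * V + 2 * M / (real l * \<delta>^2) * A)
          \<le> K * V + (1 / (2 * \<delta> * R) * V + 2 * M / (real l * \<delta>^2) * V)"
        using V K0 M0 R \<delta> by (intro add_mono mult_left_mono) auto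
      finally show ?thesis by (simp add: algebra_simps)
    qed
    have gB: "real l / (s * \<mu>)^2 * ?A (\<lambda>x. g' x - \<i> * of_real (\<nu> / real l) * g x) \<le> 2 * (M^2 + 1) / (real l * \<mu>^2) * V"
    proof -
      have "?A (\<lambda>x. g' x - \<i> * of_real (\<nu> / real l) * g x) \<le> 2 / (real l)^2 * (B + (s * M)^2 * A)"
        unfolding g_def g'_def A_def B_def
        by (rule transfer_covariant_derivative_bound[of \<phi> \<phi>1 M f f' l s \<nu>, OF \<phi>(1) cont\<phi>(2) \<phi>(4) Suc.prems(1,2) l])
      hence "real l / (s * \<mu>)^2 * ?A (\<lambda>x. g' x - \<i> * of_real (\<nu> / real l) * g x)
        \<le> real l / (s * \<mu>)^2 * (2 / (real l)^2 * (B + (s * M)^2 * A))"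
        by (intro mult_left_mono) auto
      also have "\<dots> = 2 / (real l * \<mu>^2) * (B / s^2 + M^2 * A)"
        using s0 l \<mu> by (simp add: field_simps power2_eq_square)
      also have "\<dots> \<le> 2 / (real l * \<mu>^2) * (V + M^2 * V)"
        using V by (intro mult_left_mono add_mono) auto
      also have "\<dots> = 2 * (M^2 + 1) / (real l * \<mu>^2) * V" by (simp add: algebra_simps add_divide_distrib)
      finally show ?thesis .
    qed
    have "q * V = (K + 1 / (2 * \<delta> * R) + 2 * M / (real l * \<delta>^2)) * V + 2 * (M^2 + 1) / (real l * \<mu>^2) * V"
      by (simp add: q_def R_def distrib_right)
    with add_mono[OF gA gB] show "?A g + real l / (s * \<mu>)^2 * ?A (\<lambda>x. g' x - \<i> * of_real (\<nu> / real l) * g x)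
        \<le> q * (A + real l / s^2 * B)" by (simp add: V_def)
    show "0 \<le> q ^ m" using K0 M0 \<delta> by (auto simp: q_def)
  qed
  also have "\<dots> = q ^ Suc m * (A + real l / s^2 * B)" by simp
  finally show ?case unfolding eq A_def B_def .
qed

text \<open>The largest admissible number of steps is \<open>(ln \<bar>t\<bar> - ln l) / \<bar>ln \<mu>\<bar>\<close>, up to rounding.\<close>

lemma decay_exponent_from_steps:
  fixes t :: real
  assumes t: "real l \<le> \<bar>t\<bar>" and l: "1 < l" and \<mu>: "0 < \<mu>" "\<mu> < 1" and c: "0 < c"
    and bound: "\<And>m. real l \<le> \<bar>t\<bar> * \<mu> ^ m \<Longrightarrow> I^2 \<le> (real l powr (- 2 * c)) ^ m" and I: "0 \<le> I"
  shows "I \<le> real l powr (c * (1 + ln (real l) / \<bar>ln \<mu>\<bar>)) * \<bar>t\<bar> powr (- (c * (ln (real l) / \<bar>ln \<mu>\<bar>)))"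
proof -
  define L where "L = \<bar>ln \<mu>\<bar>"
  have L: "0 < L" "ln \<mu> = - L" using \<mu> by (auto simp: L_def ln_less_zero abs_of_neg)
  have t0: "0 < \<bar>t\<bar>" and l0: "0 < real l" and lnl: "0 < ln (real l)" using t l by auto
  define x where "x = (ln \<bar>t\<bar> - ln (real l)) / L"
  have x: "0 \<le> x" unfolding x_def using t L l0 t0 by (intro divide_nonneg_pos) auto
  define m where "m = nat \<lfloor>x\<rfloor>"
  have m: "real m \<le> x" "x - 1 \<le> real m" using x by (auto simp: m_def)
  have "real l \<le> \<bar>t\<bar> * \<mu> ^ m"
  proof -
    have "ln (real l) \<le> ln \<bar>t\<bar> - real m * L"
      using m(1) L by (simp add: x_def field_simps)
    also have "\<dots> = ln (\<bar>t\<bar> * \<mu> ^ m)"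
      using t0 \<mu> L by (subst ln_mult) (auto simp: ln_realpow)
    finally show ?thesis using l0 t0 \<mu> by simp
  qed
  hence "I^2 \<le> (real l powr (- 2 * c)) ^ m" by (rule bound)
  also have "\<dots> = (real l powr (- c * real m))^2"
    using l0 by (simp add: powr_powr powr_realpow[symmetric] powr_numeral[symmetric] mult_ac del: powr_numeral)
  finally have "I \<le> real l powr (- c * real m)" by (rule power2_le_imp_le) simp
  also have "\<dots> \<le> real l powr (- c * (x - 1))"
    using m(2) c l by (intro powr_mono) auto
  also have "\<dots> = real l powr (c * (1 + ln (real l) / L)) * \<bar>t\<bar> powr (- (c * (ln (real l) / L)))"
  proof -
    have "real l powr (- c * (x - 1)) = exp (- c * (x - 1) * ln (real l))" using l0 by (simp add: powr_def)
    also have "- c * (x - 1) * ln (real l) = c * (1 + ln (real l) / L) * ln (real l) + - (c * (ln (real l) / L)) * ln \<bar>t\<bar>"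
      using L by (simp add: x_def field_simps)
    also have "exp \<dots> = real l powr (c * (1 + ln (real l) / L)) * \<bar>t\<bar> powr (- (c * (ln (real l) / L)))"
      using l0 t0 by (subst exp_add) (simp add: powr_def)
    finally show ?thesis .
  qed
  finally show ?thesis unfolding L_def .
qed

lemma character_derivative:
  "((\<lambda>x. cis (a * x)) has_vector_derivative (\<i> * of_real a * cis (a * x))) (at x)"
  unfolding has_vector_derivative_def
  by (rule derivative_eq_intros refl)+ (auto simp: fun_eq_iff scaleR_conv_of_real algebra_simps)

lemma character_periodic: "cis (2 * pi * of_int n * (x + 1)) = cis (2 * pi * of_int n * x)"
proof -
  have "cis (2 * pi * of_int n * (x + 1)) = cis (2 * pi * of_int n * x) * cis (2 * pi * of_int n)"
    by (simp only: cis_mult distrib_left mult_1_right)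
  also have "cis (2 * pi * of_int n) = 1" by (rule cis_multiple_2pi) auto
  finally show ?thesis by simp
qed

text \<open>With \<open>\<delta> = l powr (-1/8)\<close> each of the four terms of the contraction factor is a negative power of \<open>l\<close>;
  the weakest exponent, \<open>\<kappa>/8\<close>, comes from the sublevel estimate for \<open>\<phi>'\<close>. Half of it absorbs the
  constants that depend on \<open>\<mu>\<close>, at the price of a lower bound for \<open>l\<close>, so that the exponent depends
  on the function alone.\<close>

lemma large_base_decay:
  assumes jet: "analytic_jet F" and nonconst: "F 0 u \<noteq> F 0 v"
  shows "\<exists>c>0. \<forall>\<mu>. 0 < \<mu> \<and> \<mu> < 1 \<longrightarrow> (\<exists>L\<ge>2. \<forall>l. L \<le> real l \<longrightarrow>
     (\<forall>n t. real l \<le> \<bar>t\<bar> \<longrightarrow> cmod (osc_integral (F 0) \<mu> l n t)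
       \<le> real l powr (c * (1 + ln (real l) / \<bar>ln \<mu>\<bar>)) * \<bar>t\<bar> powr (- (c * (ln (real l) / \<bar>ln \<mu>\<bar>)))))"
proof -
  obtain u' v' where "F 1 u' \<noteq> F 1 v'" using jet_derivatives_not_constant[OF jet nonconst] by blast
  with analytic_sublevel_estimate[OF analytic_jet_derivative[OF jet, of 1], of u' v']
  obtain C \<kappa> where C: "0 < C" and \<kappa>: "0 < \<kappa>" "\<kappa> \<le> 1"
    and sublevel: "\<And>b \<eta>. 0 < \<eta> \<Longrightarrow> \<eta> \<le> 1 \<Longrightarrow> mean (\<lambda>y. bump \<eta> (F 1 y - b)) \<le> C * \<eta> powr \<kappa>"
    by auto
  obtain M1 where M1: "0 < M1" "\<And>x. \<bar>F 1 x\<bar> \<le> M1" using jet_bounded[OF jet, of 1] by blast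
  obtain M2 where M2: "0 < M2" "\<And>x. \<bar>F 2 x\<bar> \<le> M2" using jet_bounded[OF jet, of 2] by blast
  define M where "M = max M1 M2"
  have M: "0 < M" "\<And>x. \<bar>F 1 x\<bar> \<le> M" "\<And>x. \<bar>F 2 x\<bar> \<le> M"
    using M1 M2 by (auto simp: M_def le_max_iff_disj)
  have der: "(F 0 has_real_derivative F 1 x) (at x)" "(F 1 has_real_derivative F 2 x) (at x)" for x
    using jet_derivative[OF jet, of 0 x] jet_derivative[OF jet, of 1 x] by (simp_all add: numeral_2_eq_2)
  define c where "c = \<kappa> / 32"
  have c: "0 < c" using \<kappa> by (simp add: c_def)
  have main: "\<exists>L\<ge>2. \<forall>l. L \<le> real l \<longrightarrow> (\<forall>n t. real l \<le> \<bar>t\<bar> \<longrightarrow> cmod (osc_integral (F 0) \<mu> l n t)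
       \<le> real l powr (c * (1 + ln (real l) / \<bar>ln \<mu>\<bar>)) * \<bar>t\<bar> powr (- (c * (ln (real l) / \<bar>ln \<mu>\<bar>))))"
    if \<mu>: "0 < \<mu>" "\<mu> < 1" for \<mu>
  proof -
    define K where "K = (2 * M^2 + 2) * C"
    define K' where "K' = K + 1 / 2 + 2 * M + 2 * (M^2 + 1) / \<mu>^2"
    have K: "0 < K" using C by (auto simp: K_def intro!: mult_pos_pos add_nonneg_pos)
    have K': "0 < K'" using K M unfolding K'_def by (intro add_pos_nonneg) auto
    define L where "L = max 2 (K' powr (16 / \<kappa>))"
    have "cmod (osc_integral (F 0) \<mu> l n t)
       \<le> real l powr (c * (1 + ln (real l) / \<bar>ln \<mu>\<bar>)) * \<bar>t\<bar> powr (- (c * (ln (real l) / \<bar>ln \<mu>\<bar>)))"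
      if l: "L \<le> real l" and t: "real l \<le> \<bar>t\<bar>" for l n t
    proof -
      have l2: "2 \<le> real l" and lK: "K' powr (16 / \<kappa>) \<le> real l" using l by (auto simp: L_def)
      have l0: "0 < l" and l1: "1 < l" using l2 by auto
      have linv: "1 / real l = real l powr (- 1)"
        using l2 by (simp only: powr_minus_divide) simp
      define \<delta> where "\<delta> = real l powr (- 1 / 8)"
      have \<delta>: "0 < \<delta>" "\<delta> \<le> 1" "1 / real l \<le> \<delta>"
      proof -
        show "0 < \<delta>" using l2 by (simp add: \<delta>_def)
        have "real l powr (- 1 / 8) \<le> real l powr 0" using l2 by (intro powr_mono) auto
        thus "\<delta> \<le> 1" using l2 by (simp add: \<delta>_def)
        have "real l powr (- 1) \<le> real l powr (- 1 / 8)" using l2 by (intro powr_mono) auto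
        thus "1 / real l \<le> \<delta>" unfolding \<delta>_def linv .
      qed
      define q where "q = K * \<delta> powr \<kappa> + 1 / (2 * \<delta> * sqrt (real l)) + 2 * M / (real l * \<delta>^2) + 2 * (M^2 + 1) / (real l * \<mu>^2)"
      have coinc: "1 / real l * (\<Sum>e<l. bump \<delta> (F 1 (y + real e / real l) - F 1 y)) \<le> K * \<delta> powr \<kappa>" for y
      proof -
        have "1 / real l * (\<Sum>e<l. bump \<delta> (F 1 ((real l * y + real e) / real l) - F 1 y))
          \<le> (2 * M^2 + 2) * mean (\<lambda>z. bump \<delta> (F 1 z - F 1 y))"
          by (rule average_bump_le_integral[OF der(2) M(3) jet_periodic[OF jet] \<delta>(3) l0])
        also have "\<dots> \<le> (2 * M^2 + 2) * (C * \<delta> powr \<kappa>)"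
          by (intro mult_left_mono sublevel \<delta>) auto
        finally show ?thesis using l0 by (simp add: K_def add_divide_distrib mult.assoc)
      qed
      have q_le: "q \<le> real l powr (- 2 * c)"
      proof -
        define w where "w = real l powr (- \<kappa> / 8)"
        have w: "real l powr e \<le> w" if "e \<le> - \<kappa> / 8" for e
          unfolding w_def using that l2 by (intro powr_mono) auto
        have 1: "\<delta> powr \<kappa> = w" by (simp add: \<delta>_def w_def powr_powr)
        have 2: "1 / (2 * \<delta> * sqrt (real l)) = 1 / 2 * real l powr (- 3 / 8)"
        proof -
          have "\<delta> * sqrt (real l) = real l powr (3 / 8)"
            using l2 by (simp add: \<delta>_def powr_half_sqrt[symmetric] powr_add[symmetric])
          hence "1 / (2 * \<delta> * sqrt (real l)) = 1 / 2 * (1 / real l powr (3 / 8))" by (simp add: mult.assoc)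
          also have "1 / real l powr (3 / 8) = real l powr (- (3 / 8))" by (simp only: powr_minus_divide)
          finally show ?thesis by simp
        qed
        have 3: "2 * M / (real l * \<delta>^2) = 2 * M * real l powr (- 3 / 4)"
        proof -
          have "real l * \<delta>^2 = real l powr 1 * real l powr (- 1 / 4)"
            using l2 by (simp add: \<delta>_def power2_eq_square powr_add[symmetric])
          also have "\<dots> = real l powr (3 / 4)" by (simp only: powr_add[symmetric]) simp
          finally have "2 * M / (real l * \<delta>^2) = 2 * M * (1 / real l powr (3 / 4))" by simp
          also have "1 / real l powr (3 / 4) = real l powr (- (3 / 4))" by (simp only: powr_minus_divide)
          finally show ?thesis by simp
        qed
        have 4: "2 * (M^2 + 1) / (real l * \<mu>^2) = 2 * (M^2 + 1) / \<mu>^2 * real l powr (- 1)"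
          unfolding linv[symmetric] by simp
        have "q \<le> K * w + 1 / 2 * w + 2 * M * w + 2 * (M^2 + 1) / \<mu>^2 * w"
          unfolding q_def 1 2 3 4 using \<kappa> M K by (intro add_mono mult_left_mono w) auto
        also have "\<dots> = K' * w" by (simp add: K'_def algebra_simps)
        also have "K' \<le> real l powr (\<kappa> / 16)"
        proof -
          have "K' = (K' powr (16 / \<kappa>)) powr (\<kappa> / 16)" using K' \<kappa> by (simp add: powr_powr)
          also have "\<dots> \<le> real l powr (\<kappa> / 16)" using lK \<kappa> by (intro powr_mono2) auto
          finally show ?thesis .
        qed
        also have "real l powr (\<kappa> / 16) * w = real l powr (- 2 * c)"
          by (simp add: w_def c_def powr_add[symmetric])
        finally show ?thesis by (simp add: w_def mult_right_mono)
      qed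
      have q0: "0 \<le> q" unfolding q_def using K M \<delta> by (intro add_nonneg_nonneg) auto
      have "(cmod (osc_integral (F 0) \<mu> l n t))^2 \<le> (real l powr (- 2 * c)) ^ m" if m: "real l \<le> \<bar>t\<bar> * \<mu> ^ m" for m
      proof -
        let ?a = "2 * pi * of_int n"
        have "(cmod (mean (\<lambda>x. cis (?a * x) * cis (t * weierstrass (F 0) \<mu> l x))))^2
          \<le> q ^ m * (mean (\<lambda>x. (cmod (cis (?a * x)))^2) + real l / t^2 *
             mean (\<lambda>x. (cmod (\<i> * of_real ?a * cis (?a * x) - \<i> * of_real ?a * cis (?a * x)))^2))"
          unfolding q_def
        proof (rule iterated_transfer_decay[OF der _ M(2,3) _ _ \<mu> l0 \<delta>(1) coinc character_derivative])
          show "continuous_on UNIV (\<lambda>x. \<i> * of_real ?a * cis (?a * x))" by (intro continuous_intros)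
        qed (use jet_continuous[OF jet] jet_periodic[OF jet] m character_periodic in auto)
        also have "\<dots> = q ^ m" by simp
        also have "\<dots> \<le> (real l powr (- 2 * c)) ^ m" by (intro power_mono q_le q0)
        finally show ?thesis
          by (subst osc_integral_cis) (use jet_continuous[OF jet] jet_periodic[OF jet] \<mu> in auto)
      qed
      from decay_exponent_from_steps[OF t l1 \<mu> c this] show ?thesis by simp
    qed
    moreover have "2 \<le> L" by (simp add: L_def)
    ultimately show ?thesis by blast
  qed
  show ?thesis using c main by blast
qed

section \<open>Sums over inverse branches\<close>

text \<open>The integer part of \<open>x\<close>, read in base \<open>l\<close>, selects an inverse branch: for \<open>k < l\<^sup>m\<close> the points
  \<open>(x + k) / l, \<dots>, (x + k) / l\<^sup>m\<close> are, modulo 1, the successive preimages of \<open>x\<close> along the branch with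
  the digits of \<open>k\<close>. The weights decrease away from \<open>x\<close>.\<close>

definition inverse_sum :: "(real \<Rightarrow> real) \<Rightarrow> real \<Rightarrow> nat \<Rightarrow> nat \<Rightarrow> real \<Rightarrow> real" where
  "inverse_sum \<psi> \<kappa> l m x = (\<Sum>j<m. \<kappa> ^ Suc j * \<psi> (x / real l ^ Suc j))"

definition inverse_series :: "(real \<Rightarrow> real) \<Rightarrow> real \<Rightarrow> nat \<Rightarrow> real \<Rightarrow> real" where
  "inverse_series \<psi> \<kappa> l x = (\<Sum>j. \<kappa> ^ Suc j * \<psi> (x / real l ^ Suc j))"

lemma inverse_sum_periodic:
  assumes "\<And>x. \<psi> (x + 1) = \<psi> x" and "0 < l"
  shows "inverse_sum \<psi> \<kappa> l m (x + real l ^ m * of_int k) = inverse_sum \<psi> \<kappa> l m x"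
  unfolding inverse_sum_def
proof (rule sum.cong)
  fix j assume "j \<in> {..<m}"
  hence j: "real l ^ m = real l ^ Suc j * real l ^ (m - Suc j)" by (simp add: power_add[symmetric] del: power_Suc)
  have "(x + real l ^ m * of_int k) / real l ^ Suc j = x / real l ^ Suc j + of_int (int l ^ (m - Suc j) * k)"
    unfolding j using assms(2) by (simp add: add_divide_distrib)
  thus "\<kappa> ^ Suc j * \<psi> ((x + real l ^ m * of_int k) / real l ^ Suc j) = \<kappa> ^ Suc j * \<psi> (x / real l ^ Suc j)"
    by (simp only: periodic_add_int[of \<psi>, OF assms(1)])
qed simp

lemma inverse_sum_add:
  "inverse_sum \<psi> \<kappa> l (m + n) x = inverse_sum \<psi> \<kappa> l m x + \<kappa> ^ m * inverse_sum \<psi> \<kappa> l n (x / real l ^ m)"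
proof -
  have "(\<Sum>j<m + n. \<kappa> ^ Suc j * \<psi> (x / real l ^ Suc j))
    = (\<Sum>j<m. \<kappa> ^ Suc j * \<psi> (x / real l ^ Suc j)) + (\<Sum>j<n. \<kappa> ^ Suc (m + j) * \<psi> (x / real l ^ Suc (m + j)))"
    by (induction n) simp_all
  also have "(\<Sum>j<n. \<kappa> ^ Suc (m + j) * \<psi> (x / real l ^ Suc (m + j)))
     = \<kappa> ^ m * (\<Sum>j<n. \<kappa> ^ Suc j * \<psi> (x / real l ^ m / real l ^ Suc j))"
    unfolding sum_distrib_left by (intro sum.cong refl) (simp add: power_add mult_ac)
  finally show ?thesis by (simp add: inverse_sum_def)
qed

context
  fixes \<psi> :: "real \<Rightarrow> real" and \<kappa> C :: real and l :: nat
  assumes bounded: "\<And>x. \<bar>\<psi> x\<bar> \<le> C" and \<kappa>: "0 < \<kappa>" "\<kappa> < 1" and l: "0 < l"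
begin

lemma inverse_term_bound: "norm (\<kappa> ^ Suc j * \<psi> (x / real l ^ Suc j)) \<le> C * \<kappa> ^ Suc j"
  using bounded[of "x / real l ^ Suc j"] \<kappa> by (simp add: abs_mult mult.commute del: power_Suc)

lemma inverse_majorant_summable: "summable (\<lambda>j. C * \<kappa> ^ Suc j)"
  using \<kappa> by (intro summable_mult) (simp add: summable_Suc_iff summable_geometric)

lemma inverse_summable: "summable (\<lambda>j. \<kappa> ^ Suc j * \<psi> (x / real l ^ Suc j))"
  by (rule summable_comparison_test[OF _ inverse_majorant_summable]) (use inverse_term_bound in blast)

lemma inverse_series_uniform_limit:
  "uniform_limit A (\<lambda>m x. inverse_sum \<psi> \<kappa> l m x) (inverse_series \<psi> \<kappa> l) sequentially"
  unfolding inverse_sum_def inverse_series_def[abs_def]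
  by (rule Weierstrass_m_test[OF inverse_term_bound inverse_majorant_summable])

lemma inverse_series_continuous:
  assumes "continuous_on UNIV \<psi>"
  shows "continuous_on A (inverse_series \<psi> \<kappa> l)"
proof -
  have "continuous_on UNIV (\<lambda>x. \<psi> (x / real l ^ j))" for j
    by (rule continuous_on_compose2[OF assms]) (use l in \<open>auto intro!: continuous_intros\<close>)
  hence "\<forall>m. continuous_on UNIV (\<lambda>x. inverse_sum \<psi> \<kappa> l m x)"
    unfolding inverse_sum_def by (intro allI continuous_on_sum continuous_on_mult continuous_on_const) blast
  hence "continuous_on UNIV (inverse_series \<psi> \<kappa> l)"
    by (intro uniform_limit_theorem[OF always_eventually inverse_series_uniform_limit]) auto
  thus ?thesis by (rule continuous_on_subset_UNIV)
qed

lemma inverse_series_split: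
  "inverse_series \<psi> \<kappa> l x = inverse_sum \<psi> \<kappa> l m x + \<kappa> ^ m * inverse_series \<psi> \<kappa> l (x / real l ^ m)"
proof -
  have "(\<Sum>j. \<kappa> ^ Suc (j + m) * \<psi> (x / real l ^ Suc (j + m)))
     = (\<Sum>j. \<kappa> ^ m * (\<kappa> ^ Suc j * \<psi> (x / real l ^ m / real l ^ Suc j)))"
    by (simp add: power_add mult_ac)
  also have "\<dots> = \<kappa> ^ m * inverse_series \<psi> \<kappa> l (x / real l ^ m)"
    unfolding inverse_series_def by (rule suminf_mult[OF inverse_summable])
  finally show ?thesis
    using suminf_split_initial_segment[OF inverse_summable, of x m]
    unfolding inverse_series_def[of _ _ _ x] inverse_sum_def by simp
qed

lemma inverse_series_bound: "\<bar>inverse_series \<psi> \<kappa> l x\<bar> \<le> C / (1 - \<kappa>)"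
  and inverse_sum_bound: "\<bar>inverse_sum \<psi> \<kappa> l m x\<bar> \<le> C / (1 - \<kappa>)"
proof -
  have C: "0 \<le> C" using bounded[of 0] by linarith
  have maj: "(\<Sum>j. C * \<kappa> ^ Suc j) \<le> C / (1 - \<kappa>)"
  proof -
    have "(\<Sum>j. C * \<kappa> ^ Suc j) = (C * \<kappa>) * (\<Sum>j. \<kappa> ^ j)"
      using \<kappa> by (subst suminf_mult[symmetric]) (auto simp: summable_geometric mult_ac)
    also have "\<dots> = C * \<kappa> / (1 - \<kappa>)" using \<kappa> by (simp add: suminf_geometric)
    also have "\<dots> \<le> C / (1 - \<kappa>)" using \<kappa> C by (intro divide_right_mono) (auto simp: mult_left_le)
    finally show ?thesis .
  qed
  have "norm (\<Sum>j. \<kappa> ^ Suc j * \<psi> (x / real l ^ Suc j)) \<le> (\<Sum>j. C * \<kappa> ^ Suc j)"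
    by (rule norm_suminf_le[OF inverse_term_bound inverse_majorant_summable])
  thus "\<bar>inverse_series \<psi> \<kappa> l x\<bar> \<le> C / (1 - \<kappa>)"
    using maj by (simp add: inverse_series_def)
  have "norm (\<Sum>j<m. \<kappa> ^ Suc j * \<psi> (x / real l ^ Suc j)) \<le> (\<Sum>j<m. C * \<kappa> ^ Suc j)"
    by (intro sum_norm_le inverse_term_bound)
  also have "\<dots> \<le> (\<Sum>j. C * \<kappa> ^ Suc j)"
    using C \<kappa> by (intro sum_le_suminf inverse_majorant_summable) auto
  finally show "\<bar>inverse_sum \<psi> \<kappa> l m x\<bar> \<le> C / (1 - \<kappa>)"
    using maj by (simp add: inverse_sum_def)
qed

end

lemma inverse_series_derivative:
  assumes \<psi>: "\<And>x. (\<psi> has_real_derivative \<psi>' x) (at x)" "\<And>x. \<bar>\<psi> x\<bar> \<le> C" "\<And>x. \<bar>\<psi>' x\<bar> \<le> C'"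
    and \<kappa>: "0 < \<kappa>" "\<kappa> < 1" and l: "0 < l"
  shows "(inverse_series \<psi> \<kappa> l has_real_derivative inverse_series \<psi>' (\<kappa> / real l) l x) (at x)"
proof -
  have \<kappa>': "0 < \<kappa> / real l" "\<kappa> / real l < 1"
  proof -
    show "0 < \<kappa> / real l" using \<kappa> l by simp
    have "\<kappa> / real l \<le> \<kappa> / 1" using \<kappa> l by (intro divide_left_mono) auto
    thus "\<kappa> / real l < 1" using \<kappa> by simp
  qed
  have "((\<lambda>x. \<Sum>j. \<kappa> ^ Suc j * \<psi> (x / real l ^ Suc j)) has_field_derivative
      (\<Sum>j. (\<kappa> / real l) ^ Suc j * \<psi>' (x / real l ^ Suc j))) (at x)"
  proof (rule has_field_derivative_series'(2)[of UNIV _ _ 0])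
    fix j x
    have "((\<lambda>x. \<kappa> ^ Suc j * \<psi> (x / real l ^ Suc j)) has_field_derivative
       (\<kappa> ^ Suc j * (\<psi>' (x / real l ^ Suc j) * (1 / real l ^ Suc j)))) (at x)"
      by (intro DERIV_cmult DERIV_chain2[OF \<psi>(1)] DERIV_cdivide DERIV_ident)
    thus "((\<lambda>x. \<kappa> ^ Suc j * \<psi> (x / real l ^ Suc j)) has_field_derivative
       ((\<kappa> / real l) ^ Suc j * \<psi>' (x / real l ^ Suc j))) (at x within UNIV)"
      by (simp add: power_divide mult_ac)
  next
    have "uniform_limit UNIV (\<lambda>m x. inverse_sum \<psi>' (\<kappa> / real l) l m x) (inverse_series \<psi>' (\<kappa> / real l) l) sequentially"
      by (rule inverse_series_uniform_limit[of \<psi>' C' "\<kappa> / real l" l, OF \<psi>(3) \<kappa>' l])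
    thus "uniformly_convergent_on UNIV (\<lambda>m x. \<Sum>i<m. (\<kappa> / real l) ^ Suc i * \<psi>' (x / real l ^ Suc i))"
      unfolding inverse_sum_def by (rule uniformly_convergentI)
  next
    show "summable (\<lambda>j. \<kappa> ^ Suc j * \<psi> (0 / real l ^ Suc j))"
      by (rule inverse_summable[of \<psi> C, OF \<psi>(2) \<kappa> l])
  qed auto
  thus ?thesis unfolding inverse_series_def[abs_def] .
qed

text \<open>If the series has the same value on all branches above \<open>x\<close>, then by \<open>inverse_series_split\<close> it has
  the same property above every preimage \<open>(x + k) / l\<^sup>m\<close>. These are dense, so by continuity the
  series would be 1-periodic.\<close>

lemma inverse_series_dichotomy:
  assumes \<psi>: "continuous_on UNIV \<psi>" "\<And>x. \<psi> (x + 1) = \<psi> x" "\<And>x. \<bar>\<psi> x\<bar> \<le> C"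
    and \<kappa>: "0 < \<kappa>" "\<kappa> < 1" and l: "2 \<le> l"
    and z: "inverse_series \<psi> \<kappa> l (z + 1) \<noteq> inverse_series \<psi> \<kappa> l z"
  shows "\<exists>k::int. inverse_series \<psi> \<kappa> l (x + of_int k) \<noteq> inverse_series \<psi> \<kappa> l x"
proof (rule ccontr)
  let ?Z = "inverse_series \<psi> \<kappa> l"
  assume "\<nexists>k::int. ?Z (x + of_int k) \<noteq> ?Z x"
  hence x: "?Z (x + of_int k) = ?Z x" for k by blast
  have l0: "0 < l" using l by simp
  \<comment> \<open>A preimage of \<open>x\<close> under multiplication by \<open>l\<^sup>m\<close>, modulo 1, within \<open>l powr (-m)\<close> of \<open>z\<close>.\<close>
  define y where "y m = (x + of_int \<lfloor>real l ^ m * z - x\<rfloor>) / real l ^ m" for m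
  have y: "?Z (y m + 1) = ?Z (y m)" for m
  proof -
    define X where "X = x + of_int \<lfloor>real l ^ m * z - x\<rfloor>"
    have "?Z (X + real l ^ m * of_int 1) = ?Z X"
      using x[of "\<lfloor>real l ^ m * z - x\<rfloor> + int l ^ m"] x[of "\<lfloor>real l ^ m * z - x\<rfloor>"]
      by (simp add: X_def add_ac)
    hence "\<kappa> ^ m * ?Z ((X + real l ^ m * of_int 1) / real l ^ m) = \<kappa> ^ m * ?Z (X / real l ^ m)"
      using inverse_series_split[of \<psi> C \<kappa> l "X + real l ^ m * of_int 1" m, OF \<psi>(3) \<kappa> l0]
        inverse_series_split[of \<psi> C \<kappa> l X m, OF \<psi>(3) \<kappa> l0]
        inverse_sum_periodic[of \<psi> l \<kappa> m X 1, OF \<psi>(2) l0] by linarith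
    moreover have "(X + real l ^ m * of_int 1) / real l ^ m = y m + 1" "X / real l ^ m = y m"
      using l0 by (simp_all add: X_def y_def add_divide_distrib)
    ultimately show ?thesis using \<kappa> by simp
  qed
  have "y \<longlonglongrightarrow> z"
  proof (rule LIMSEQ_I)
    fix e :: real assume e: "0 < e"
    have "(\<lambda>m. (1 / real l) ^ m) \<longlonglongrightarrow> 0" using l by (intro LIMSEQ_power_zero) auto
    then obtain M where M: "\<And>m. M \<le> m \<Longrightarrow> norm ((1 / real l) ^ m - 0) < e"
      using e by (meson LIMSEQ_D)
    have "norm (y m - z) < e" if "M \<le> m" for m
    proof -
      have "\<bar>x + of_int \<lfloor>real l ^ m * z - x\<rfloor> - real l ^ m * z\<bar> \<le> 1" by linarith
      hence "\<bar>x + of_int \<lfloor>real l ^ m * z - x\<rfloor> - real l ^ m * z\<bar> / real l ^ m \<le> 1 / real l ^ m"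
        by (intro divide_right_mono) auto
      moreover have "y m - z = (x + of_int \<lfloor>real l ^ m * z - x\<rfloor> - real l ^ m * z) / real l ^ m"
        using l0 by (simp add: y_def diff_divide_distrib)
      ultimately have "norm (y m - z) \<le> (1 / real l) ^ m" by (simp add: abs_divide power_divide)
      thus ?thesis using M[OF that] by (simp add: abs_of_pos)
    qed
    thus "\<exists>no. \<forall>n\<ge>no. norm (y n - z) < e" by blast
  qed
  moreover have "isCont ?Z w" for w
    using inverse_series_continuous[of \<psi> C \<kappa> l UNIV, OF \<psi>(3) \<kappa> l0 \<psi>(1)] by (simp add: continuous_on_eq_continuous_at)
  ultimately have "(\<lambda>m. ?Z (y m)) \<longlonglongrightarrow> ?Z z" "(\<lambda>m. ?Z (y m + 1)) \<longlonglongrightarrow> ?Z (z + 1)"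
    by (auto intro!: isCont_tendsto_compose[of _ ?Z] tendsto_intros)
  hence "?Z (z + 1) = ?Z z" unfolding y by (rule LIMSEQ_unique[rotated])
  with z show False by contradiction
qed

text \<open>Two arbitrary branches are compared, and not a branch with \<open>x\<close> itself, so that the condition is
  invariant under integer translations and compactness of the circle applies.\<close>

lemma inverse_series_uniform_oscillation:
  assumes \<psi>: "continuous_on UNIV \<psi>" "\<And>x. \<psi> (x + 1) = \<psi> x" "\<And>x. \<bar>\<psi> x\<bar> \<le> C"
    and \<kappa>: "0 < \<kappa>" "\<kappa> < 1" and l: "2 \<le> l"
    and z: "inverse_series \<psi> \<kappa> l (z + 1) \<noteq> inverse_series \<psi> \<kappa> l z"
  shows "\<exists>c>0. \<forall>x. \<exists>i j::int. c \<le> \<bar>inverse_series \<psi> \<kappa> l (x + of_int i) - inverse_series \<psi> \<kappa> l (x + of_int j)\<bar>"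
proof -
  let ?Z = "inverse_series \<psi> \<kappa> l"
  let ?P = "\<lambda>(N::nat) x. \<exists>i j::int. 1 / real (Suc N) \<le> \<bar>?Z (x + of_int i) - ?Z (x + of_int j)\<bar>"
  have l0: "0 < l" using l by simp
  have cont: "continuous_on UNIV ?Z" by (rule inverse_series_continuous[of \<psi> C \<kappa> l, OF \<psi>(3) \<kappa> l0 \<psi>(1)])
  have "\<exists>N. \<forall>x. ?P N x"
  proof (rule periodic_locally_uniform_imp_uniform)
    fix x0
    obtain k :: int where k: "?Z (x0 + of_int k) \<noteq> ?Z x0"
      using inverse_series_dichotomy[OF \<psi> \<kappa> l z] by blast
    define h where "h x = \<bar>?Z (x + of_int k) - ?Z (x + of_int 0)\<bar>" for x
    have h0: "0 < h x0" using k by (simp add: h_def)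
    have "continuous_on UNIV h"
      unfolding h_def by (intro continuous_on_rabs continuous_on_diff continuous_on_shift cont)
    hence "isCont h x0" by (simp add: continuous_on_eq_continuous_at)
    then obtain d where d: "d > 0" "\<And>x. \<bar>x - x0\<bar> < d \<Longrightarrow> \<bar>h x - h x0\<bar> < h x0 / 2"
      using h0 unfolding continuous_at_eps_delta dist_real_def by (metis half_gt_zero)
    obtain N :: nat where N: "2 / h x0 \<le> real N" using real_arch_simple by blast
    have "?P N x" if "\<bar>x - x0\<bar> < d" for x
    proof -
      have "2 / h x0 \<le> real (Suc N)" using N by simp
      hence "1 / real (Suc N) \<le> h x0 / 2" using h0 by (simp add: field_simps)
      also have "\<dots> \<le> h x" using d(2)[OF that] by linarith
      finally show ?thesis unfolding h_def by blast
    qed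
    thus "\<exists>N. \<exists>d>0. \<forall>x. \<bar>x - x0\<bar> < d \<longrightarrow> ?P N x" using d(1) by blast
  next
    fix N N' :: nat and x assume "N \<le> N'" "?P N x"
    moreover have "1 / real (Suc N') \<le> 1 / real (Suc N)" using \<open>N \<le> N'\<close> by (intro divide_left_mono) auto
    ultimately show "?P N' x" by (meson order_trans)
  next
    fix N x
    have "?P N (x + of_int a)" if P: "?P N x" for x and a :: int
    proof -
      obtain i j :: int where "1 / real (Suc N) \<le> \<bar>?Z (x + of_int i) - ?Z (x + of_int j)\<bar>" using P by blast
      hence "1 / real (Suc N) \<le> \<bar>?Z (x + of_int a + of_int (i - a)) - ?Z (x + of_int a + of_int (j - a))\<bar>" by simp
      thus ?thesis by blast
    qed
    from this[of x 1] this[of "x + 1" "- 1"] show "?P N (x + 1) = ?P N x" by auto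
  qed
  then obtain N where "\<forall>x. ?P N x" by blast
  moreover have "0 < 1 / real (Suc N)" by simp
  ultimately show ?thesis by blast
qed

lemma sum_digits:
  fixes f :: "nat \<Rightarrow> 'a::comm_monoid_add"
  shows "(\<Sum>k<b * q. f k) = (\<Sum>i<b. \<Sum>j<q. f (i + b * j))"
proof -
  have "(\<Sum>k<b * q. f k) = (\<Sum>j<q. sum f {j * b..<j * b + b})"
    using sum.nat_group[of f b q] by (simp add: mult.commute)
  also have "\<dots> = (\<Sum>j<q. \<Sum>i<b. f (i + b * j))"
  proof (rule sum.cong)
    fix j
    show "sum f {j * b..<j * b + b} = (\<Sum>i<b. f (i + b * j))"
      using sum.shift_bounds_nat_ivl[of f 0 "j * b" b] by (simp add: atLeast0LessThan mult.commute add.commute)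
  qed simp
  also have "\<dots> = (\<Sum>i<b. \<Sum>j<q. f (i + b * j))" by (rule sum.swap)
  finally show ?thesis .
qed

text \<open>In a block of \<open>n\<close> digits, at least one choice keeps the sum away from a given value \<open>a\<close>: two choices
  differ by \<open>c/2\<close>, whereas all later terms and the tolerance together amount to at most \<open>c/4\<close>. This choice is lost,
  and the others reduce to the same problem at the next scale, with \<open>m\<close> smaller by \<open>n\<close>. Hence the factor
  \<open>l\<^sup>n - 1\<close> instead of \<open>l\<^sup>n\<close> for each block.\<close>

lemma inverse_sum_anticoncentration:
  assumes \<psi>: "continuous_on UNIV \<psi>" "\<And>x. \<psi> (x + 1) = \<psi> x" "\<And>x. \<bar>\<psi> x\<bar> \<le> C"
    and \<kappa>: "0 < \<kappa>" "\<kappa> < 1" and l: "2 \<le> l"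
    and z: "inverse_series \<psi> \<kappa> l (z + 1) \<noteq> inverse_series \<psi> \<kappa> l z"
  shows "\<exists>\<epsilon>>0. \<exists>n\<ge>1. \<forall>i r x a.
    (\<Sum>k<l ^ (i * n + r). of_bool (\<bar>inverse_sum \<psi> \<kappa> l (i * n + r) (x + real k) - a\<bar> < \<epsilon> * \<kappa> ^ (i * n)))
      \<le> (real l ^ n - 1) ^ i * real l ^ r"
proof -
  let ?Z = "inverse_series \<psi> \<kappa> l" and ?S = "inverse_sum \<psi> \<kappa> l"
  have l0: "0 < l" using l by simp
  obtain c where c: "0 < c" "\<And>x. \<exists>i j::int. c \<le> \<bar>?Z (x + of_int i) - ?Z (x + of_int j)\<bar>"
    using inverse_series_uniform_oscillation[OF \<psi> \<kappa> l z] by blast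
  define D where "D = C / (1 - \<kappa>)"
  have SD: "\<bar>?S m x\<bar> \<le> D" and ZD: "\<bar>?Z x\<bar> \<le> D" for m x
    unfolding D_def by (rule inverse_sum_bound[of \<psi>, OF \<psi>(3) \<kappa> l0] inverse_series_bound[of \<psi>, OF \<psi>(3) \<kappa> l0])+
  have "(\<lambda>n. \<kappa> ^ n * D) \<longlonglongrightarrow> 0 * D" using \<kappa> by (intro tendsto_intros LIMSEQ_power_zero) auto
  hence "\<forall>\<^sub>F n in sequentially. \<kappa> ^ n * D < c / 8"
    using c(1) by (intro order_tendstoD(2)) auto
  hence "\<forall>\<^sub>F n in sequentially. \<kappa> ^ n * D < c / 8 \<and> 1 \<le> n"
    by (intro eventually_conj eventually_ge_at_top)
  then obtain n where n: "\<kappa> ^ n * D < c / 8" "1 \<le> n"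
    using eventually_happens' sequentially_bot by blast
  have spread: "\<exists>k<l ^ n. \<exists>k'<l ^ n. c / 2 \<le> \<bar>?S n (x + real k) - ?S n (x + real k')\<bar>" for x
  proof -
    obtain i j :: int where ij: "c \<le> \<bar>?Z (x + of_int i) - ?Z (x + of_int j)\<bar>" using c(2) by blast
    have approx: "\<bar>?Z w - ?S n w\<bar> \<le> c / 8" for w
    proof -
      have "?Z w - ?S n w = \<kappa> ^ n * ?Z (w / real l ^ n)"
        using inverse_series_split[of \<psi> C \<kappa> l w n, OF \<psi>(3) \<kappa> l0] by simp
      hence "\<bar>?Z w - ?S n w\<bar> = \<kappa> ^ n * \<bar>?Z (w / real l ^ n)\<bar>" using \<kappa> by (simp add: abs_mult)
      also have "\<dots> \<le> \<kappa> ^ n * D" using \<kappa> by (intro mult_left_mono ZD) auto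
      finally show ?thesis using n by simp
    qed
    have reduce: "\<exists>k<l ^ n. ?S n (x + of_int i) = ?S n (x + real k)" for i :: int
    proof -
      define k where "k = nat (i mod int (l ^ n))"
      have pos: "0 < int (l ^ n)" using l0 by simp
      have k: "int k = i mod int (l ^ n)" "k < l ^ n"
        using pos_mod_bound[OF pos, of i] pos_mod_sign[OF pos, of i] by (auto simp: k_def nat_less_iff)
      have "i = int k + int (l ^ n) * (i div int (l ^ n))" by (simp only: k(1) mod_mult_div_eq)
      hence "real_of_int i = real_of_int (int k + int (l ^ n) * (i div int (l ^ n)))" by (rule arg_cong)
      hence "x + of_int i = (x + real k) + real l ^ n * of_int (i div int (l ^ n))" by simp
      hence "?S n (x + of_int i) = ?S n (x + real k)"
        by (simp only: inverse_sum_periodic[of \<psi>, OF \<psi>(2) l0])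
      with k show ?thesis by blast
    qed
    obtain k k' where "k < l ^ n" "?S n (x + of_int i) = ?S n (x + real k)"
      "k' < l ^ n" "?S n (x + of_int j) = ?S n (x + real k')"
      using reduce by metis
    moreover have "c / 2 \<le> \<bar>?S n (x + of_int i) - ?S n (x + of_int j)\<bar>"
      using ij approx[of "x + of_int i"] approx[of "x + of_int j"] c(1) by linarith
    ultimately show ?thesis by metis
  qed
  define \<epsilon> where "\<epsilon> = c / 8"
  define count where "count m x a e = (\<Sum>k<l ^ m. of_bool (\<bar>?S m (x + real k) - a\<bar> < e) :: real)" for m x a e
  have "count (i * n + r) x a (\<epsilon> * \<kappa> ^ (i * n)) \<le> (real l ^ n - 1) ^ i * real l ^ r" for i r x a
  proof (induction i arbitrary: x a)
    case 0
    have "count r x a (\<epsilon> * \<kappa> ^ 0) \<le> (\<Sum>k<l ^ r. 1)"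
      unfolding count_def by (intro sum_mono) auto
    thus ?case by simp
  next
    case (Suc i)
    define m where "m = i * n + r"
    define e where "e = \<epsilon> * \<kappa> ^ (i * n)"
    define a' where "a' j = (a - ?S n (x + real j)) / \<kappa> ^ n" for j :: nat
    have e: "e \<le> \<epsilon>" using \<kappa> c by (auto simp: e_def \<epsilon>_def intro!: mult_left_le power_le_one)
    have \<kappa>n: "0 < \<kappa> ^ n" "\<kappa> ^ n \<le> 1" using \<kappa> by (auto simp: power_le_one)
    have a'_eq: "\<kappa> ^ n * a' j = a - ?S n (x + real j)" for j
      using \<kappa> by (simp add: a'_def)
    \<comment> \<open>The first \<open>n\<close> terms see only the lowest \<open>n\<close> digits \<open>j\<close>.\<close>
    have step: "?S (n + m) (x + real (j + l ^ n * k)) - a = \<kappa> ^ n * (?S m ((x + real j) / real l ^ n + real k) - a' j)" for j k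
    proof -
      have 1: "x + real (j + l ^ n * k) = (x + real j) + real l ^ n * of_int (int k)" by simp
      have 2: "(x + real (j + l ^ n * k)) / real l ^ n = (x + real j) / real l ^ n + real k"
        using l0 by (simp add: add_divide_distrib)
      have 3: "?S n (x + real (j + l ^ n * k)) = ?S n (x + real j)"
        unfolding 1 by (rule inverse_sum_periodic[of \<psi>, OF \<psi>(2) l0])
      have "?S (n + m) (x + real (j + l ^ n * k)) = ?S n (x + real j) + \<kappa> ^ n * ?S m ((x + real j) / real l ^ n + real k)"
        unfolding inverse_sum_add 2 3 ..
      thus ?thesis by (simp add: right_diff_distrib a'_eq)
    qed
    have inner: "(\<Sum>k<l ^ m. of_bool (\<bar>?S (n + m) (x + real (j + l ^ n * k)) - a\<bar> < \<kappa> ^ n * e)) = count m ((x + real j) / real l ^ n) (a' j) e" for j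
      unfolding count_def step abs_mult using \<kappa>n by simp
    have "\<exists>j0<l ^ n. count m ((x + real j0) / real l ^ n) (a' j0) e = 0"
    proof (rule ccontr)
      assume none: "\<not> ?thesis"
      have near: "\<bar>?S n (x + real j) - a\<bar> < c / 4" if "j < l ^ n" for j
      proof -
        have "count m ((x + real j) / real l ^ n) (a' j) e \<noteq> 0" using none that by blast
        then obtain k where "\<bar>?S m ((x + real j) / real l ^ n + real k) - a' j\<bar> < e"
          unfolding count_def by (metis (mono_tags, lifting) of_bool_eq(1) sum.neutral)
        hence "\<kappa> ^ n * \<bar>?S m ((x + real j) / real l ^ n + real k) - a' j\<bar> \<le> 1 * e"
          using \<kappa>n by (intro mult_mono) auto
        moreover have "\<kappa> ^ n * (?S m ((x + real j) / real l ^ n + real k) - a' j)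
           = \<kappa> ^ n * ?S m ((x + real j) / real l ^ n + real k) + (?S n (x + real j) - a)"
          by (simp add: right_diff_distrib a'_eq)
        moreover have "\<bar>\<kappa> ^ n * ?S m ((x + real j) / real l ^ n + real k)\<bar> \<le> \<kappa> ^ n * D"
          unfolding abs_mult using \<kappa>n by (intro mult_mono SD) auto
        moreover have "\<kappa> ^ n * \<bar>?S m ((x + real j) / real l ^ n + real k) - a' j\<bar>
           = \<bar>\<kappa> ^ n * (?S m ((x + real j) / real l ^ n + real k) - a' j)\<bar>"
          using \<kappa>n by (simp add: abs_mult)
        ultimately show ?thesis using e n(1) unfolding \<epsilon>_def by linarith
      qed
      obtain k k' where "k < l ^ n" "k' < l ^ n" "c / 2 \<le> \<bar>?S n (x + real k) - ?S n (x + real k')\<bar>"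
        using spread by blast
      thus False using near[of k] near[of k'] by linarith
    qed
    then obtain j0 where j0: "j0 < l ^ n" "count m ((x + real j0) / real l ^ n) (a' j0) e = 0" by blast
    have "count (Suc i * n + r) x a (\<epsilon> * \<kappa> ^ (Suc i * n))
       = (\<Sum>k<l ^ n * l ^ m. of_bool (\<bar>?S (n + m) (x + real k) - a\<bar> < \<kappa> ^ n * e))"
      unfolding count_def by (simp add: m_def e_def power_add mult_ac add_ac)
    also have "\<dots> = (\<Sum>j<l ^ n. count m ((x + real j) / real l ^ n) (a' j) e)"
      unfolding sum_digits inner ..
    also have "\<dots> = (\<Sum>j\<in>{..<l ^ n} - {j0}. count m ((x + real j) / real l ^ n) (a' j) e)"
      using j0 by (subst sum.remove[of _ j0]) auto
    also have "\<dots> \<le> (\<Sum>j\<in>{..<l ^ n} - {j0}. (real l ^ n - 1) ^ i * real l ^ r)"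
      unfolding m_def e_def by (intro sum_mono Suc.IH)
    also have "\<dots> = real (l ^ n - 1) * ((real l ^ n - 1) ^ i * real l ^ r)"
      using j0 by simp
    also have "real (l ^ n - 1) = real l ^ n - 1" using l0 by (simp add: of_nat_diff)
    finally show ?case by simp
  qed
  thus ?thesis unfolding count_def using c(1) n(2) by (intro exI[of _ \<epsilon>] conjI exI[of _ n]) (auto simp: \<epsilon>_def)
qed

lemma bump_le_of_large:
  assumes "e \<le> \<bar>z\<bar>" "0 < e"
  shows "bump \<eta> z \<le> \<eta>^2 / e^2"
proof -
  have "e^2 \<le> \<bar>z\<bar>^2" using assms by (intro power_mono) auto
  hence "e^2 \<le> z^2 + \<eta>^2" by (simp add: add_increasing2)
  thus ?thesis unfolding bump_def using assms(2) by (intro divide_left_mono mult_pos_pos) (auto intro: less_le_trans[of 0 "e^2"])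
qed

text \<open>Only exponential rates matter, for the scale as well as for the proportion. The rates must be uniform
  in \<open>x\<close> and \<open>a\<close>, since \<open>a\<close> will be the value at another branch above the same point.\<close>

definition branches_spread :: "(real \<Rightarrow> real) \<Rightarrow> real \<Rightarrow> nat \<Rightarrow> bool" where
  "branches_spread \<psi> \<kappa> l \<longleftrightarrow> (\<exists>K>0. \<exists>\<rho> \<beta>. 0 < \<rho> \<and> \<rho> < 1 \<and> 0 < \<beta> \<and> \<beta> \<le> 1 \<and> (\<forall>m x a.
    1 / real (l ^ m) * (\<Sum>k<l ^ m. bump (\<beta> ^ m) ((1 / \<kappa>) ^ m * inverse_sum \<psi> \<kappa> l m (x + real k) - a)) \<le> K * \<rho> ^ m))"

lemma inverse_series_jet:
  assumes jet: "analytic_jet G" and \<kappa>: "0 < \<kappa>" "\<kappa> < 1" and l: "0 < l"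
    and per: "\<And>x. inverse_series (G 0) \<kappa> l (x + 1) = inverse_series (G 0) \<kappa> l x"
  shows "analytic_jet (\<lambda>p. inverse_series (G p) (\<kappa> / real l ^ p) l)"
proof -
  let ?Z = "\<lambda>p. inverse_series (G p) (\<kappa> / real l ^ p) l"
  have \<kappa>p: "0 < \<kappa> / real l ^ p" "\<kappa> / real l ^ p < 1" "\<kappa> / real l ^ p \<le> \<kappa>" for p
  proof -
    show "0 < \<kappa> / real l ^ p" using \<kappa> l by simp
    have "\<kappa> / real l ^ p \<le> \<kappa> / 1" using \<kappa> l by (intro divide_left_mono) auto
    thus "\<kappa> / real l ^ p \<le> \<kappa>" by simp
    thus "\<kappa> / real l ^ p < 1" using \<kappa> by linarith
  qed
  have der: "(?Z p has_real_derivative ?Z (Suc p) x) (at x)" for p x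
  proof -
    obtain M where "\<And>x. \<bar>G p x\<bar> \<le> M" using jet_bounded[OF jet] by metis
    moreover obtain M' where "\<And>x. \<bar>G (Suc p) x\<bar> \<le> M'" using jet_bounded[OF jet] by metis
    ultimately have "(?Z p has_real_derivative inverse_series (G (Suc p)) (\<kappa> / real l ^ p / real l) l x) (at x)"
      by (rule inverse_series_derivative[OF jet_derivative[OF jet] _ _ \<kappa>p(1,2) l])
    thus ?thesis by (simp add: mult.commute)
  qed
  have perZ: "?Z p (x + 1) = ?Z p x" for p x
  proof (induction p arbitrary: x)
    case 0
    show ?case using per by simp
  next
    case (Suc p)
    have "((\<lambda>y. ?Z p (y + 1)) has_real_derivative ?Z (Suc p) (x + 1)) (at x)"
      using der[of p "x + 1"] DERIV_shift[of "?Z p" _ x 1] by simp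
    hence "(?Z p has_real_derivative ?Z (Suc p) (x + 1)) (at x)" by (simp only: Suc)
    thus ?case by (rule DERIV_unique[OF _ der])
  qed
  obtain C Q where C: "0 < C" and Q: "0 < Q" and bound: "\<And>p x. \<bar>G p x\<bar> \<le> C * fact p * Q ^ p"
    using jet unfolding analytic_jet_def by blast
  have "\<bar>?Z p x\<bar> \<le> (C / (1 - \<kappa>)) * fact p * Q ^ p" for p x
  proof -
    have "\<bar>?Z p x\<bar> \<le> (C * fact p * Q ^ p) / (1 - \<kappa> / real l ^ p)"
      by (rule inverse_series_bound[of "G p", OF bound \<kappa>p(1,2) l])
    also have "\<dots> \<le> (C * fact p * Q ^ p) / (1 - \<kappa>)"
      using C Q \<kappa> \<kappa>p[of p] by (intro divide_left_mono mult_pos_pos) auto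
    finally show ?thesis by simp
  qed
  moreover have "0 < C / (1 - \<kappa>)" using C \<kappa> by simp
  ultimately show ?thesis unfolding analytic_jet_def using der perZ Q by blast
qed

text \<open>When the series \<open>Z\<close> is periodic, \<open>inverse_series_split\<close> shows that the sum along the branch \<open>k\<close> is
  \<open>Z(x) - \<kappa>\<^sup>m Z((x + k) / l\<^sup>m)\<close>: it depends on the branch only through the value of the analytic function \<open>Z\<close>
  at its end point. This is the case in which the Weierstrass function is itself analytic.\<close>

lemma inverse_sum_nonconcentration_periodic:
  assumes jet: "analytic_jet G" and nonconst: "G 0 u \<noteq> G 0 v" and \<kappa>: "0 < \<kappa>" "\<kappa> < 1" and l: "2 \<le> l"
    and per: "\<And>x. inverse_series (G 0) \<kappa> l (x + 1) = inverse_series (G 0) \<kappa> l x"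
  shows "branches_spread (G 0) \<kappa> l"
proof -
  let ?Z = "inverse_series (G 0) \<kappa> l"
  have l0: "0 < l" using l by simp
  obtain M0 where M0: "\<And>x. \<bar>G 0 x\<bar> \<le> M0" using jet_bounded[OF jet] by metis
  note split = inverse_series_split[of "G 0" M0 \<kappa> l, OF M0 \<kappa> l0]
  define Zj where "Zj p = inverse_series (G p) (\<kappa> / real l ^ p) l" for p
  have Zjet: "analytic_jet Zj" unfolding Zj_def by (rule inverse_series_jet[OF jet \<kappa> l0 per])
  have Z0: "Zj 0 = ?Z" by (simp add: Zj_def)
  have "\<exists>u v. ?Z u \<noteq> ?Z v"
  proof (rule ccontr)
    assume "\<not> ?thesis"
    hence const: "?Z x = ?Z 0" for x by blast
    have "\<kappa> * G 0 y = (1 - \<kappa>) * ?Z 0" for y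
    proof -
      have "?Z (real l * y) = \<kappa> * G 0 y + \<kappa> * ?Z y"
        using split[of "real l * y" 1] l0 by (simp add: inverse_sum_def)
      thus ?thesis using const[of "real l * y"] const[of y] by (simp add: algebra_simps)
    qed
    hence "\<kappa> * G 0 u = \<kappa> * G 0 v" by metis
    with nonconst \<kappa> show False by simp
  qed
  then obtain u' v' where "Zj 0 u' \<noteq> Zj 0 v'" unfolding Z0 by blast
  from analytic_sublevel_estimate[OF Zjet this] obtain C \<gamma> where C: "0 < C" and \<gamma>: "0 < \<gamma>" "\<gamma> \<le> 1"
    and sub: "\<And>b \<eta>. 0 < \<eta> \<Longrightarrow> \<eta> \<le> 1 \<Longrightarrow> mean (\<lambda>y. bump \<eta> (?Z y - b)) \<le> C * \<eta> powr \<gamma>"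
    unfolding Z0 by auto
  obtain M where M: "0 < M" "\<And>x. \<bar>Zj 1 x\<bar> \<le> M" using jet_bounded[OF Zjet] by metis
  have der: "(?Z has_real_derivative Zj 1 x) (at x)" for x
    using jet_derivative[OF Zjet, of 0 x] by (simp add: Z0)
  define \<beta> where "\<beta> = 1 / real l"
  have \<beta>: "0 < \<beta>" "\<beta> \<le> 1" "\<beta> < 1" using l by (auto simp: \<beta>_def)
  define \<rho> where "\<rho> = \<beta> powr \<gamma>"
  have \<rho>: "0 < \<rho>" "\<rho> < 1"
  proof -
    show "0 < \<rho>" using \<beta> by (simp add: \<rho>_def)
    have "\<beta> powr \<gamma> < 1 powr \<gamma>" using \<beta> \<gamma> by (intro powr_less_mono2) auto
    thus "\<rho> < 1" by (simp add: \<rho>_def)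
  qed
  define K where "K = (2 * M^2 + 2) * C"
  have K: "0 < K" using C by (auto simp: K_def intro!: mult_pos_pos add_nonneg_pos)
  have "1 / real (l ^ m) * (\<Sum>k<l ^ m. bump (\<beta> ^ m) ((1 / \<kappa>) ^ m * inverse_sum (G 0) \<kappa> l m (x + real k) - a)) \<le> K * \<rho> ^ m"
    for m x a
  proof -
    define b where "b = (1 / \<kappa>) ^ m * ?Z x - a"
    have "(1 / \<kappa>) ^ m * inverse_sum (G 0) \<kappa> l m (x + real k) - a = b - ?Z ((x + real k) / real (l ^ m))" for k
    proof -
      have "inverse_sum (G 0) \<kappa> l m (x + real k) = ?Z x - \<kappa> ^ m * ?Z ((x + real k) / real (l ^ m))"
        using split[of "x + real k" m] periodic_add_nat[of ?Z x k, OF per] by simp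
      thus ?thesis using \<kappa> by (simp add: b_def right_diff_distrib power_divide)
    qed
    hence "1 / real (l ^ m) * (\<Sum>k<l ^ m. bump (\<beta> ^ m) ((1 / \<kappa>) ^ m * inverse_sum (G 0) \<kappa> l m (x + real k) - a))
       = 1 / real (l ^ m) * (\<Sum>k<l ^ m. bump (\<beta> ^ m) (?Z ((x + real k) / real (l ^ m)) - b))"
      by (simp only: bump_commute)
    also have "\<dots> \<le> (2 * M^2 + 2) * mean (\<lambda>y. bump (\<beta> ^ m) (?Z y - b))"
      by (rule average_bump_le_integral[OF der M(2) per]) (use l0 in \<open>auto simp: \<beta>_def power_divide\<close>)
    also have "\<dots> \<le> (2 * M^2 + 2) * (C * (\<beta> ^ m) powr \<gamma>)"
      using \<beta> by (intro mult_left_mono sub) (auto intro: power_le_one)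
    also have "(\<beta> ^ m) powr \<gamma> = \<rho> ^ m"
      using \<beta> by (simp add: \<rho>_def powr_realpow[symmetric] powr_powr mult.commute)
    finally show ?thesis by (simp add: K_def mult.assoc)
  qed
  with K \<rho> \<beta> show ?thesis unfolding branches_spread_def by blast
qed

lemma inverse_sum_nonconcentration_nonperiodic:
  assumes \<psi>: "continuous_on UNIV \<psi>" "\<And>x. \<psi> (x + 1) = \<psi> x" "\<And>x. \<bar>\<psi> x\<bar> \<le> C"
    and \<kappa>: "0 < \<kappa>" "\<kappa> < 1" and l: "2 \<le> l"
    and z: "inverse_series \<psi> \<kappa> l (z + 1) \<noteq> inverse_series \<psi> \<kappa> l z"
  shows "branches_spread \<psi> \<kappa> l"
proof -
  let ?S = "inverse_sum \<psi> \<kappa> l"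
  obtain \<epsilon> n where \<epsilon>: "0 < \<epsilon>" and n: "1 \<le> n" and count: "\<And>i r x a.
    (\<Sum>k<l ^ (i * n + r). of_bool (\<bar>?S (i * n + r) (x + real k) - a\<bar> < \<epsilon> * \<kappa> ^ (i * n)))
      \<le> (real l ^ n - 1) ^ i * real l ^ r"
    using inverse_sum_anticoncentration[OF \<psi> \<kappa> l z] by blast
  define \<theta> where "\<theta> = 1 - 1 / real l ^ n"
  have ln: "1 < real l ^ n" using l n by (intro one_less_power) auto
  have \<theta>: "0 < \<theta>" "\<theta> < 1" using ln l by (auto simp: \<theta>_def divide_less_eq)
  define \<rho> where "\<rho> = root n \<theta>"
  have \<rho>: "0 < \<rho>" "\<rho> < 1" "\<rho> ^ n = \<theta>"
    using \<theta> n by (auto simp: \<rho>_def real_root_lt_1_iff real_root_pow_pos2)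
  define K where "K = 1 / \<theta> + 1 / \<epsilon>^2"
  have K: "0 < K" using \<theta> \<epsilon> by (auto simp: K_def intro!: add_pos_pos)
  have "1 / real (l ^ m) * (\<Sum>k<l ^ m. bump (\<rho> ^ m) ((1 / \<kappa>) ^ m * ?S m (x + real k) - a)) \<le> K * \<rho> ^ m"
    for m x a
  proof -
    define i r where "i = m div n" and "r = m mod n"
    have m: "m = i * n + r" by (simp add: i_def r_def)
    have r: "r < n" using n by (simp add: r_def)
    let ?b = "\<lambda>k. of_bool (\<bar>?S m (x + real k) - \<kappa> ^ m * a\<bar> < \<epsilon> * \<kappa> ^ (i * n)) :: real"
    have pw: "bump (\<rho> ^ m) ((1 / \<kappa>) ^ m * ?S m (x + real k) - a) \<le> ?b k + (\<rho> ^ m)^2 / \<epsilon>^2" for k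
    proof (cases "\<bar>?S m (x + real k) - \<kappa> ^ m * a\<bar> < \<epsilon> * \<kappa> ^ (i * n)")
      case True
      have "bump (\<rho> ^ m) ((1 / \<kappa>) ^ m * ?S m (x + real k) - a) \<le> 1 + 0" using bump_le_1 by simp
      also have "\<dots> \<le> ?b k + (\<rho> ^ m)^2 / \<epsilon>^2" using True by (intro add_mono) auto
      finally show ?thesis .
    next
      case False
      have "\<epsilon> * \<kappa> ^ m \<le> \<epsilon> * \<kappa> ^ (i * n)" using \<epsilon> \<kappa> by (intro mult_left_mono power_decreasing) (auto simp: m)
      hence "\<epsilon> * \<kappa> ^ m \<le> \<bar>?S m (x + real k) - \<kappa> ^ m * a\<bar>" using False by linarith
      hence "\<epsilon> \<le> \<bar>?S m (x + real k) - \<kappa> ^ m * a\<bar> / \<kappa> ^ m" using \<kappa> by (simp add: pos_le_divide_eq)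
      also have "\<dots> = \<bar>(?S m (x + real k) - \<kappa> ^ m * a) / \<kappa> ^ m\<bar>" using \<kappa> by (simp add: abs_divide)
      also have "(?S m (x + real k) - \<kappa> ^ m * a) / \<kappa> ^ m = (1 / \<kappa>) ^ m * ?S m (x + real k) - a"
        using \<kappa> by (simp add: diff_divide_distrib power_divide)
      finally show ?thesis using bump_le_of_large[OF _ \<epsilon>] False by simp
    qed
    have "1 / real (l ^ m) * (\<Sum>k<l ^ m. bump (\<rho> ^ m) ((1 / \<kappa>) ^ m * ?S m (x + real k) - a))
       \<le> 1 / real (l ^ m) * (\<Sum>k<l ^ m. ?b k + (\<rho> ^ m)^2 / \<epsilon>^2)"
      by (intro mult_left_mono sum_mono pw) auto
    also have "\<dots> = 1 / real (l ^ m) * (\<Sum>k<l ^ m. ?b k) + (\<rho> ^ m)^2 / \<epsilon>^2"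
      using l by (simp add: sum.distrib distrib_left)
    also have "\<dots> \<le> \<rho> ^ m / \<theta> + \<rho> ^ m / \<epsilon>^2"
    proof (rule add_mono)
      have "1 / real (l ^ m) * (\<Sum>k<l ^ m. ?b k) \<le> 1 / real (l ^ m) * ((real l ^ n - 1) ^ i * real l ^ r)"
        using count[of i r x "\<kappa> ^ m * a"] by (intro mult_left_mono) (auto simp: m)
      also have "\<dots> = ((real l ^ n - 1) / real l ^ n) ^ i"
        using l by (simp add: m power_add power_mult power_divide mult.commute[of i n])
      also have "(real l ^ n - 1) / real l ^ n = \<rho> ^ n" using l by (simp add: \<rho>(3) \<theta>_def diff_divide_distrib)
      also have "(\<rho> ^ n) ^ i = \<rho> ^ (i * n)" by (simp only: power_mult[symmetric] mult.commute)
      also have "\<dots> = \<rho> ^ (i * n + n) / \<theta>" using \<theta> by (simp only: power_add \<rho>(3)) simp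
      also have "\<dots> \<le> \<rho> ^ m / \<theta>" using \<theta> \<rho> r by (intro divide_right_mono power_decreasing) (auto simp: m)
      finally show "1 / real (l ^ m) * (\<Sum>k<l ^ m. ?b k) \<le> \<rho> ^ m / \<theta>" .
      have "(\<rho> ^ m)^2 \<le> \<rho> ^ m" using \<rho> by (simp add: power2_eq_square mult_left_le power_le_one)
      thus "(\<rho> ^ m)^2 / \<epsilon>^2 \<le> \<rho> ^ m / \<epsilon>^2" by (intro divide_right_mono) auto
    qed
    finally show ?thesis by (simp add: K_def algebra_simps)
  qed
  with K \<rho> show ?thesis unfolding branches_spread_def by (intro exI[of _ K] conjI exI[of _ \<rho>]) auto
qed

text \<open>The factor \<open>(1 / \<kappa>)\<^sup>m\<close> turns the sum over the branch into a derivative of a partial sum of the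
  Weierstrass function; see \<open>lacunary_sum_eq_inverse_sum\<close>.\<close>

lemma inverse_sum_nonconcentration:
  assumes jet: "analytic_jet G" and nonconst: "G 0 u \<noteq> G 0 v" and \<kappa>: "0 < \<kappa>" "\<kappa> < 1" and l: "2 \<le> l"
  shows "branches_spread (G 0) \<kappa> l"
proof (cases "\<forall>x. inverse_series (G 0) \<kappa> l (x + 1) = inverse_series (G 0) \<kappa> l x")
  case True
  thus ?thesis by (intro inverse_sum_nonconcentration_periodic[OF jet nonconst \<kappa> l]) auto
next
  case False
  then obtain z where z: "inverse_series (G 0) \<kappa> l (z + 1) \<noteq> inverse_series (G 0) \<kappa> l z" by blast
  obtain M where "\<And>x. \<bar>G 0 x\<bar> \<le> M" using jet_bounded[OF jet] by metis
  thus ?thesis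
    by (rule inverse_sum_nonconcentration_nonperiodic[OF jet_continuous[OF jet] jet_periodic[OF jet] _ \<kappa> l z])
qed

section \<open>Decay for every base\<close>

lemma lacunary_sum_eq_inverse_sum:
  assumes "0 < \<kappa>" and "0 < l"
  shows "(\<Sum>j<m. (1 / \<kappa>) ^ j * \<psi> (real l ^ j * (x / real l ^ m))) = (1 / \<kappa>) ^ m * inverse_sum \<psi> \<kappa> l m x"
proof -
  have "(\<Sum>j<m. (1 / \<kappa>) ^ j * \<psi> (real l ^ j * (x / real l ^ m)))
     = (\<Sum>j<m. (1 / \<kappa>) ^ (m - Suc j) * \<psi> (real l ^ (m - Suc j) * (x / real l ^ m)))"
    by (rule sum.nat_diff_reindex[symmetric])
  also have "\<dots> = (\<Sum>j<m. (1 / \<kappa>) ^ m * (\<kappa> ^ Suc j * \<psi> (x / real l ^ Suc j)))"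
  proof (rule sum.cong)
    fix j assume "j \<in> {..<m}"
    hence m: "m = (m - Suc j) + Suc j" by simp
    have "a ^ m = a ^ (m - Suc j) * a ^ Suc j" for a :: real
      by (subst m) (rule power_add)
    note split = this[of "1 / \<kappa>"] this[of "real l"]
    have "real l ^ (m - Suc j) * (x / real l ^ m) = x / real l ^ Suc j"
      unfolding split using assms(2) by simp
    moreover have "(1 / \<kappa>) ^ (m - Suc j) = (1 / \<kappa>) ^ m * \<kappa> ^ Suc j"
      unfolding split using assms(1) by (simp add: power_divide)
    ultimately show "(1 / \<kappa>) ^ (m - Suc j) * \<psi> (real l ^ (m - Suc j) * (x / real l ^ m))
       = (1 / \<kappa>) ^ m * (\<kappa> ^ Suc j * \<psi> (x / real l ^ Suc j))" by (simp only: mult.assoc)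
  qed simp
  finally show ?thesis by (simp add: inverse_sum_def sum_distrib_left)
qed

text \<open>For \<open>F p\<close> the \<open>p\<close>-th derivative of \<open>\<phi>\<close>, this is the \<open>p\<close>-th derivative of the sum of the first \<open>m\<close> terms
  of the Weierstrass series.\<close>

definition lacunary_sum :: "(nat \<Rightarrow> real \<Rightarrow> real) \<Rightarrow> real \<Rightarrow> nat \<Rightarrow> nat \<Rightarrow> nat \<Rightarrow> real \<Rightarrow> real" where
  "lacunary_sum F \<mu> l m p x = (\<Sum>j<m. (\<mu> * real l ^ p) ^ j * F p (real l ^ j * x))"

text \<open>The smoothed proportion of pairs of points with a difference in \<open>(1/q)\<int>\<close> at which \<open>g\<close> takes the same value up
  to \<open>\<eta>\<close>.\<close>

definition mean_coincidence :: "nat \<Rightarrow> real \<Rightarrow> (real \<Rightarrow> real) \<Rightarrow> real" where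
  "mean_coincidence q \<eta> g = 1 / real q * (\<Sum>e<q. mean (\<lambda>y. bump \<eta> (g (y + real e / real q) - g y)))"

context
  fixes F :: "nat \<Rightarrow> real \<Rightarrow> real" and \<mu> :: real and l :: nat
  assumes jet: "analytic_jet F" and \<mu>: "0 < \<mu>" "\<mu> < 1" and l: "2 \<le> l"
begin

lemma lacunary_sum_derivative:
  "(lacunary_sum F \<mu> l m p has_real_derivative lacunary_sum F \<mu> l m (Suc p) x) (at x)"
  unfolding lacunary_sum_def
proof (rule DERIV_sum)
  fix j
  have "((\<lambda>x. (\<mu> * real l ^ p) ^ j * F p (real l ^ j * x)) has_real_derivative
     (\<mu> * real l ^ p) ^ j * (F (Suc p) (real l ^ j * x) * real l ^ j)) (at x)"
    by (intro DERIV_cmult DERIV_chain2[OF jet_derivative[OF jet]] DERIV_cmult_Id)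
  moreover have "(\<mu> * real l ^ p) ^ j * (F (Suc p) (real l ^ j * x) * real l ^ j)
     = (\<mu> * real l ^ Suc p) ^ j * F (Suc p) (real l ^ j * x)"
    by (simp add: power_mult_distrib)
  ultimately show "((\<lambda>x. (\<mu> * real l ^ p) ^ j * F p (real l ^ j * x)) has_real_derivative
     (\<mu> * real l ^ Suc p) ^ j * F (Suc p) (real l ^ j * x)) (at x)" by simp
qed

lemma lacunary_sum_periodic: "lacunary_sum F \<mu> l m p (x + 1) = lacunary_sum F \<mu> l m p x"
proof -
  have "F p (real l ^ j * (x + 1)) = F p (real l ^ j * x)" for j
    using periodic_add_nat[of "F p" "real l ^ j * x" "l ^ j", OF jet_periodic[OF jet]] by (simp add: distrib_left)
  thus ?thesis by (simp add: lacunary_sum_def)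
qed

lemma lacunary_sum_continuous: "continuous_on A (lacunary_sum F \<mu> l m p)"
  by (rule continuous_on_line_real_derivative[OF lacunary_sum_derivative])

lemma lacunary_sum_bound:
  assumes "\<And>x. \<bar>F p x\<bar> \<le> M"
  shows "\<bar>lacunary_sum F \<mu> l m p x\<bar> \<le> M * (1 + real l ^ p) ^ m"
proof (induction m)
  case 0
  show ?case using assms[of 0] by (simp add: lacunary_sum_def)
next
  case (Suc m)
  have M: "0 \<le> M" using assms[of 0] by linarith
  have lp: "1 \<le> real l ^ p" using l by simp
  have "\<bar>lacunary_sum F \<mu> l (Suc m) p x\<bar>
     \<le> \<bar>lacunary_sum F \<mu> l m p x\<bar> + \<bar>(\<mu> * real l ^ p) ^ m * F p (real l ^ m * x)\<bar>"
    by (simp add: lacunary_sum_def)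
  also have "\<bar>(\<mu> * real l ^ p) ^ m * F p (real l ^ m * x)\<bar> \<le> (1 + real l ^ p) ^ m * M"
    unfolding abs_mult
  proof (intro mult_mono assms)
    have "\<mu> * real l ^ p \<le> 1 * real l ^ p" using \<mu> by (intro mult_right_mono) auto
    hence "(\<mu> * real l ^ p) ^ m \<le> (1 + real l ^ p) ^ m" using \<mu> by (intro power_mono) auto
    thus "\<bar>(\<mu> * real l ^ p) ^ m\<bar> \<le> (1 + real l ^ p) ^ m" using \<mu> by simp
  qed (use lp in auto)
  also have "\<bar>lacunary_sum F \<mu> l m p x\<bar> + (1 + real l ^ p) ^ m * M \<le> 2 * (M * (1 + real l ^ p) ^ m)"
    using Suc by (simp add: mult.commute)
  also have "\<dots> \<le> (1 + real l ^ p) * (M * (1 + real l ^ p) ^ m)"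
    using lp M by (intro mult_right_mono) auto
  finally show ?case by (simp add: mult_ac)
qed

lemma mean_coincidence_descent:
  assumes M: "\<And>x. \<bar>F (Suc (Suc p)) x\<bar> \<le> M" and pos: "0 < \<eta>" "0 < c"
  shows "mean_coincidence (l ^ m) \<eta> (lacunary_sum F \<mu> l m p)
    \<le> mean_coincidence (l ^ m) c (lacunary_sum F \<mu> l m (Suc p)) + 4 * M * (1 + real l ^ Suc (Suc p)) ^ m * \<eta> / c^2"
proof -
  let ?f = "\<lambda>p. lacunary_sum F \<mu> l m p"
  define B where "B = M * (1 + real l ^ Suc (Suc p)) ^ m"
  have each: "mean (\<lambda>y. bump \<eta> (?f p (y + d) - ?f p y))
     \<le> mean (\<lambda>y. bump c (?f (Suc p) (y + d) - ?f (Suc p) y)) + 4 * B * \<eta> / c^2" for d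
  proof -
    define g where "g q y = ?f q (y + d) - ?f q y" for q y
    have g: "(g q has_real_derivative g (Suc q) y) (at y)" for q y
      using lacunary_sum_derivative[of m q "y + d"] lacunary_sum_derivative[of m q y]
      unfolding g_def by (intro DERIV_diff) (simp_all add: DERIV_shift)
    have contg: "continuous_on A (g q)" for A q by (rule continuous_on_line_real_derivative[OF g])
    have perg: "g q (y + 1) = g q y" for q y
    proof -
      have "y + 1 + d = (y + d) + 1" by simp
      thus ?thesis unfolding g_def by (simp only: lacunary_sum_periodic)
    qed
    have g2: "\<bar>g (Suc (Suc p)) y\<bar> \<le> 2 * B" for y
      using lacunary_sum_bound[OF M, of m "y + d"] lacunary_sum_bound[OF M, of m y] unfolding g_def B_def by linarith
    have "mean (\<lambda>y. bump \<eta> (g p y) * (1 - bump c (g (Suc p) y))) \<le> 2 * (2 * B) * \<eta> / c^2"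
      by (rule integral_bump_descent[OF g g contg g2 perg perg pos])
    moreover have "mean (\<lambda>y. bump \<eta> (g p y))
       \<le> mean (\<lambda>y. bump c (g (Suc p) y) + bump \<eta> (g p y) * (1 - bump c (g (Suc p) y)))"
    proof (rule integral_le)
      show "bump \<eta> (g p y) \<le> bump c (g (Suc p) y) + bump \<eta> (g p y) * (1 - bump c (g (Suc p) y))" for y
        using mult_right_mono[OF bump_le_1 bump_nonneg, of \<eta> "g p y" c "g (Suc p) y"] by (simp add: algebra_simps)
    qed (intro integrable_continuous_real continuous_on_add continuous_on_mult continuous_on_diff
        continuous_on_const continuous_on_bump contg pos)+
    moreover have "mean (\<lambda>y. bump c (g (Suc p) y) + bump \<eta> (g p y) * (1 - bump c (g (Suc p) y)))
       = mean (\<lambda>y. bump c (g (Suc p) y)) + mean (\<lambda>y. bump \<eta> (g p y) * (1 - bump c (g (Suc p) y)))"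
      by (intro Henstock_Kurzweil_Integration.integral_add integrable_continuous_real continuous_on_mult
        continuous_on_diff continuous_on_const continuous_on_bump contg pos)
    ultimately show ?thesis unfolding g_def by simp
  qed
  have "mean_coincidence (l ^ m) \<eta> (?f p) \<le> 1 / real (l ^ m) * (\<Sum>e<l ^ m.
      mean (\<lambda>y. bump c (?f (Suc p) (y + real e / real (l ^ m)) - ?f (Suc p) y)) + 4 * B * \<eta> / c^2)"
    unfolding mean_coincidence_def by (intro mult_left_mono sum_mono each) auto
  also have "\<dots> = mean_coincidence (l ^ m) c (?f (Suc p)) + 4 * B * \<eta> / c^2"
    unfolding mean_coincidence_def sum.distrib distrib_left using l by simp
  finally show ?thesis by (simp add: B_def mult.assoc)
qed

text \<open>Coincidences are exponentially rare at an exponentially small scale; both rates are allowed to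
  get worse when \<open>p\<close> is lowered.\<close>

definition small_coincidence :: "nat \<Rightarrow> bool" where
  "small_coincidence p \<longleftrightarrow> (\<exists>K>0. \<exists>\<rho> \<beta>. 0 < \<rho> \<and> \<rho> < 1 \<and> 0 < \<beta> \<and> \<beta> \<le> 1 \<and>
     (\<forall>m. mean_coincidence (l ^ m) (\<beta> ^ m) (lacunary_sum F \<mu> l m p) \<le> K * \<rho> ^ m))"

text \<open>The derivatives of \<open>lacunary_sum\<close> grow at most like \<open>H\<^sup>m\<close>, and the scale \<open>\<beta>'\<^sup>m = (\<beta>^2 \<rho> / H)\<^sup>m\<close> is chosen
  so that the error in \<open>mean_coincidence_descent\<close> is again of order \<open>\<rho>\<^sup>m\<close>.\<close>

lemma small_coincidence_descent:
  assumes "small_coincidence (Suc p)"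
  shows "small_coincidence p"
proof -
  obtain K \<rho> \<beta> where K: "0 < K" and \<rho>: "0 < \<rho>" "\<rho> < 1" and \<beta>: "0 < \<beta>" "\<beta> \<le> 1"
    and small: "\<And>m. mean_coincidence (l ^ m) (\<beta> ^ m) (lacunary_sum F \<mu> l m (Suc p)) \<le> K * \<rho> ^ m"
    using assms unfolding small_coincidence_def by blast
  obtain M where M: "0 < M" "\<And>x. \<bar>F (Suc (Suc p)) x\<bar> \<le> M" using jet_bounded[OF jet] by metis
  define H where "H = 1 + real l ^ Suc (Suc p)"
  have H: "1 \<le> H" by (simp add: H_def)
  define \<beta>' where "\<beta>' = \<beta>^2 * \<rho> / H"
  have \<beta>': "0 < \<beta>'" "\<beta>' \<le> 1"
  proof -
    show "0 < \<beta>'" using \<beta> \<rho> H by (simp add: \<beta>'_def)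
    have "\<beta>^2 * \<rho> / H \<le> 1 * 1 / 1" using \<beta> \<rho> H by (intro divide_mono mult_mono power_le_one) auto
    thus "\<beta>' \<le> 1" by (simp add: \<beta>'_def)
  qed
  have "mean_coincidence (l ^ m) (\<beta>' ^ m) (lacunary_sum F \<mu> l m p) \<le> (K + 4 * M) * \<rho> ^ m" for m
  proof -
    have "mean_coincidence (l ^ m) (\<beta>' ^ m) (lacunary_sum F \<mu> l m p)
      \<le> K * \<rho> ^ m + 4 * M * H ^ m * \<beta>' ^ m / (\<beta> ^ m)^2"
      using mean_coincidence_descent[OF M(2), of "\<beta>' ^ m" "\<beta> ^ m" m] small[of m] \<beta> \<beta>' unfolding H_def by simp
    also have "H ^ m * \<beta>' ^ m = (\<beta> ^ m)^2 * \<rho> ^ m"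
      using H by (simp add: \<beta>'_def power_mult_distrib[symmetric] power_mult[symmetric] mult.commute[of 2 m])
        (simp add: power_mult_distrib power_mult[symmetric] mult.commute)
    hence "4 * M * H ^ m * \<beta>' ^ m / (\<beta> ^ m)^2 = 4 * M * \<rho> ^ m" using \<beta> by (simp add: mult.assoc)
    finally show ?thesis by (simp add: algebra_simps)
  qed
  moreover have "0 < K + 4 * M" using K M by simp
  ultimately show ?thesis unfolding small_coincidence_def using \<rho> \<beta>' by blast
qed

lemma small_coincidence_high_derivative:
  assumes nonconst: "F 0 u \<noteq> F 0 v" and p: "1 < \<mu> * real l ^ p"
  shows "small_coincidence p"
proof -
  define \<kappa> where "\<kappa> = 1 / (\<mu> * real l ^ p)"
  have \<kappa>: "0 < \<kappa>" "\<kappa> < 1" "1 / \<kappa> = \<mu> * real l ^ p" using p by (auto simp: \<kappa>_def)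
  obtain u' v' where uv: "F (p + 0) u' \<noteq> F (p + 0) v'" using jet_derivatives_not_constant[OF jet nonconst, of p] by auto
  obtain K \<rho> \<beta> where K: "0 < K" and \<rho>: "0 < \<rho>" "\<rho> < 1" and \<beta>: "0 < \<beta>" "\<beta> \<le> 1"
    and conc: "\<And>m x a. 1 / real (l ^ m) * (\<Sum>k<l ^ m. bump (\<beta> ^ m)
        ((1 / \<kappa>) ^ m * inverse_sum (F (p + 0)) \<kappa> l m (x + real k) - a)) \<le> K * \<rho> ^ m"
    using inverse_sum_nonconcentration[OF analytic_jet_derivative[OF jet, of p] uv \<kappa>(1,2) l]
    unfolding branches_spread_def by blast
  have "mean_coincidence (l ^ m) (\<beta> ^ m) (lacunary_sum F \<mu> l m p) \<le> K * \<rho> ^ m" for m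
  proof -
    let ?f = "lacunary_sum F \<mu> l m p"
    let ?g = "\<lambda>e y. bump (\<beta> ^ m) (?f (y + real e / real (l ^ m)) - ?f y)"
    have cont: "continuous_on {0..1} (?g e)" for e
      using \<beta> by (intro continuous_on_bump continuous_on_diff continuous_on_shift lacunary_sum_continuous) auto
    have "mean (\<lambda>y. \<Sum>e<l ^ m. ?g e y) = (\<Sum>e<l ^ m. mean (?g e))"
      by (intro integral_sum finite_lessThan integrable_continuous_real cont)
    hence "mean_coincidence (l ^ m) (\<beta> ^ m) ?f = mean (\<lambda>y. 1 / real (l ^ m) * (\<Sum>e<l ^ m. ?g e y))"
      by (simp only: mean_coincidence_def integral_mult_right)
    also have "\<dots> \<le> mean (\<lambda>y::real. K * \<rho> ^ m)"
    proof (rule integral_le)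
      show "(\<lambda>y. 1 / real (l ^ m) * (\<Sum>e<l ^ m. ?g e y)) integrable_on {0..1}"
        by (intro integrable_continuous_real continuous_on_mult continuous_on_const continuous_on_sum cont)
      fix y :: real
      have "?f (y + real e / real (l ^ m)) = (1 / \<kappa>) ^ m * inverse_sum (F (p + 0)) \<kappa> l m (real l ^ m * y + real e)" for e
      proof -
        have "y + real e / real (l ^ m) = (real l ^ m * y + real e) / real l ^ m"
          using l by (simp add: add_divide_distrib)
        thus ?thesis unfolding lacunary_sum_def \<kappa>(3)[symmetric]
          using lacunary_sum_eq_inverse_sum[OF \<kappa>(1), where l = l and m = m and \<psi> = "F (p + 0)" and x = "real l ^ m * y + real e"] l by simp
      qed
      thus "1 / real (l ^ m) * (\<Sum>e<l ^ m. ?g e y) \<le> K * \<rho> ^ m"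
        using conc[of m "real l ^ m * y" "?f y"] by simp
    qed auto
    finally show ?thesis by simp
  qed
  thus ?thesis unfolding small_coincidence_def using K \<rho> \<beta> by blast
qed

lemma small_coincidence_first_derivative:
  assumes nonconst: "F 0 u \<noteq> F 0 v"
  shows "small_coincidence 1"
proof -
  obtain p where p: "1 / \<mu> < real l ^ p" using real_arch_pow[of "real l" "1 / \<mu>"] l by auto
  have "1 \<le> Suc p" by simp
  moreover have "small_coincidence (Suc p)"
  proof (rule small_coincidence_high_derivative[OF nonconst])
    have "1 < \<mu> * real l ^ p" using p \<mu> by (simp add: field_simps)
    also have "\<dots> \<le> \<mu> * real l ^ Suc p" using \<mu> l by (intro mult_left_mono power_increasing) auto
    finally show "1 < \<mu> * real l ^ Suc p" .
  qed
  ultimately show ?thesis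
    by (rule inc_induct) (use small_coincidence_descent in blast)
qed

text \<open>One application of the transfer operator with base \<open>l\<^sup>m\<close> to a character, for which
  \<open>f' - \<i> \<nu> f = 0\<close> and hence \<open>n\<close> does not appear in the bound.\<close>

lemma osc_integral_coincidence_bound:
  assumes M: "\<And>x. \<bar>F 2 x\<bar> \<le> M" and t: "t \<noteq> 0" and \<delta>: "0 < \<delta>"
  shows "(cmod (osc_integral (F 0) \<mu> l n t))^2 \<le> mean_coincidence (l ^ m) \<delta> (lacunary_sum F \<mu> l m 1)
    + (1 / \<bar>t\<bar>) * (1 / (2 * \<delta>) + 2 * (M * (1 + real l ^ 2) ^ m) / \<delta>^2)"
proof -
  let ?f = "lacunary_sum F \<mu> l m" and ?W = "weierstrass (F 0) \<mu> l"
  let ?a = "2 * pi * of_int n"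
  let ?e = "\<lambda>x. cis (?a * x)"
  note F0 = jet_continuous[OF jet, of UNIV 0] jet_periodic[OF jet, of 0]
  have lm: "0 < l ^ m" using l by simp
  have contW: "continuous_on A ?W" for A by (rule weierstrass_continuous[OF F0 \<mu>])
  have der: "(?f 0 has_real_derivative ?f 1 x) (at x)" "(?f 1 has_real_derivative ?f 2 x) (at x)" for x
    using lacunary_sum_derivative[of m 0 x] lacunary_sum_derivative[of m 1 x] by (simp_all add: numeral_2_eq_2)
  have W: "?W x = ?f 0 x + \<mu> ^ m * ?W (real (l ^ m) * x)" for x
    using weierstrass_split[OF F0 \<mu>, of l x m] by (simp add: lacunary_sum_def)
  have pw: "?e x * cis (t * ?W x) = cis (t * ?f 0 x) * ?e x * cis (t * \<mu> ^ m * ?W (real (l ^ m) * x))" for x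
  proof -
    have "t * ?W x = t * ?f 0 x + t * \<mu> ^ m * ?W (real (l ^ m) * x)" by (subst W) (simp add: algebra_simps)
    hence "cis (t * ?W x) = cis (t * ?f 0 x) * cis (t * \<mu> ^ m * ?W (real (l ^ m) * x))" by (simp add: cis_mult)
    thus ?thesis by (simp only: mult_ac)
  qed
  have conte: "continuous_on A ?e" for A by (intro continuous_intros)
  have "osc_integral (F 0) \<mu> l n t = mean (\<lambda>x. cis (t * ?f 0 x) * ?e x * cis (t * \<mu> ^ m * ?W (real (l ^ m) * x)))"
    unfolding osc_integral_cis[OF F0 \<mu>] pw ..
  also have "\<dots> = mean (\<lambda>x. transfer (l ^ m) (?f 0) t ?e x * cis (t * \<mu> ^ m * ?W x))"
    by (rule integral_eq_integral_transfer[of "?f 0" ?e "\<lambda>x. cis (t * \<mu> ^ m * ?W x)" "l ^ m" t, OF lacunary_sum_continuous conte])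
      (use l in \<open>auto intro!: continuous_intros contW simp: weierstrass_periodic[OF F0 \<mu>]\<close>)
  finally have "(cmod (osc_integral (F 0) \<mu> l n t))^2 \<le> mean (\<lambda>x. (cmod (transfer (l ^ m) (?f 0) t ?e x))^2)"
    using square_norm_integral_le[of "transfer (l ^ m) (?f 0) t ?e" "\<lambda>x. cis (t * \<mu> ^ m * ?W x)"]
      continuous_on_transfer[OF lacunary_sum_continuous conte lm] contW by (simp add: continuous_on_cis continuous_on_mult)
  also have "\<dots> \<le> 1 / real (l ^ m) * mean (\<lambda>y. (\<Sum>e<l ^ m. bump \<delta> (?f 1 (y + real e / real (l ^ m)) - ?f 1 y)) * (cmod (?e y))^2)
      + 1 / \<bar>t\<bar> * ((1 * mean (\<lambda>y. (cmod (?e y))^2)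
          + mean (\<lambda>y. (cmod (\<i> * of_real ?a * ?e y - \<i> * of_real ?a * ?e y))^2) / 1) / (2 * \<delta>)
        + 2 * (M * (1 + real l ^ 2) ^ m) / \<delta>^2 * mean (\<lambda>y. (cmod (?e y))^2))"
  proof (rule transfer_L2_bound[OF der lacunary_sum_continuous lacunary_sum_bound[OF M] character_derivative _
        lacunary_sum_periodic lacunary_sum_periodic character_periodic _ t \<delta> _ lm])
    show "continuous_on UNIV (\<lambda>y. \<i> * of_real ?a * ?e y)" by (intro continuous_intros)
    show "\<i> * of_real ?a * ?e (x + 1) = \<i> * of_real ?a * ?e x" for x by (simp only: character_periodic)
  qed simp
  also have "1 / real (l ^ m) * mean (\<lambda>y. (\<Sum>e<l ^ m. bump \<delta> (?f 1 (y + real e / real (l ^ m)) - ?f 1 y)) * (cmod (?e y))^2)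
     = mean_coincidence (l ^ m) \<delta> (?f 1)"
  proof -
    have "continuous_on {0..1} (\<lambda>y. bump \<delta> (?f 1 (y + real e / real (l ^ m)) - ?f 1 y))" for e
      using \<delta> by (intro continuous_on_bump continuous_on_diff continuous_on_shift lacunary_sum_continuous) auto
    hence "mean (\<lambda>y. \<Sum>e<l ^ m. bump \<delta> (?f 1 (y + real e / real (l ^ m)) - ?f 1 y))
       = (\<Sum>e<l ^ m. mean (\<lambda>y. bump \<delta> (?f 1 (y + real e / real (l ^ m)) - ?f 1 y)))"
      by (intro integral_sum finite_lessThan integrable_continuous_real)
    thus ?thesis by (simp only: mean_coincidence_def norm_cis power_one mult_1_right)
  qed
  finally show ?thesis by simp
qed

text \<open>With \<open>\<delta> = \<beta>\<^sup>m\<close> the error term is at most a constant times \<open>H\<^sup>m / \<bar>t\<bar>\<close>, so it is dominated by \<open>\<rho>\<^sup>m\<close> when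
  \<open>(H / \<rho>)\<^sup>m \<le> \<bar>t\<bar>\<close>; the largest such \<open>m\<close> is proportional to \<open>ln \<bar>t\<bar>\<close>.\<close>

lemma polynomial_decay:
  assumes nonconst: "F 0 u \<noteq> F 0 v"
  shows "\<exists>\<beta>>0. \<exists>C. \<forall>n t. 1 \<le> \<bar>t\<bar> \<longrightarrow> cmod (osc_integral (F 0) \<mu> l n t) \<le> C * \<bar>t\<bar> powr (- \<beta>)"
proof -
  obtain K \<rho> \<beta> where K: "0 < K" and \<rho>: "0 < \<rho>" "\<rho> < 1" and \<beta>: "0 < \<beta>" "\<beta> \<le> 1"
    and small: "\<And>m. mean_coincidence (l ^ m) (\<beta> ^ m) (lacunary_sum F \<mu> l m 1) \<le> K * \<rho> ^ m"
    using small_coincidence_first_derivative[OF nonconst] unfolding small_coincidence_def by blast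
  obtain M where M: "0 < M" "\<And>x. \<bar>F 2 x\<bar> \<le> M" using jet_bounded[OF jet] by metis
  define H where "H = (1 + real l ^ 2) / \<beta>^2"
  define b where "b = H / \<rho>"
  define K' where "K' = K + 1 / 2 + 2 * M"
  have K': "0 < K'" using K M by (simp add: K'_def)
  have H: "1 \<le> H"
  proof -
    have "1 * \<beta>^2 \<le> 1 + real l ^ 2" using \<beta> by (simp add: power_le_one add_increasing2)
    thus ?thesis using \<beta> by (simp add: H_def field_simps)
  qed
  have b: "1 < b"
  proof -
    have "\<rho> < H" using \<rho> H by linarith
    thus ?thesis using \<rho> by (simp add: b_def)
  qed
  have square: "(cmod (osc_integral (F 0) \<mu> l n t))^2 \<le> K' * \<rho> ^ m" if t: "b ^ m \<le> \<bar>t\<bar>" for n t m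
  proof -
    have bm: "0 < b ^ m" using b by simp
    have t0: "t \<noteq> 0" using t bm by auto
    have "1 / (2 * \<beta> ^ m) \<le> 1 / 2 * H ^ m"
    proof -
      have "1 / \<beta> \<le> H"
      proof -
        have "\<beta> \<le> 1" by fact
        hence "1 / \<beta> \<le> 1 / \<beta>^2" using \<beta> by (simp add: field_simps power2_eq_square)
        also have "\<dots> \<le> H" unfolding H_def using \<beta> by (intro divide_right_mono) auto
        finally show ?thesis .
      qed
      hence "(1 / \<beta>) ^ m \<le> H ^ m" using \<beta> by (intro power_mono) auto
      thus ?thesis by (simp add: power_divide)
    qed
    moreover have "2 * (M * (1 + real l ^ 2) ^ m) / (\<beta> ^ m)^2 = 2 * M * H ^ m"
      by (simp add: H_def power_divide power_mult[symmetric] mult.commute)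
    ultimately have "(cmod (osc_integral (F 0) \<mu> l n t))^2 \<le> K * \<rho> ^ m + (1 / \<bar>t\<bar>) * (1 / 2 * H ^ m + 2 * M * H ^ m)"
      by (intro order_trans[OF osc_integral_coincidence_bound[OF M(2) t0, of "\<beta> ^ m" n m]]
          add_mono mult_left_mono small) (use \<beta> in auto)
    also have "\<dots> \<le> K * \<rho> ^ m + (1 / b ^ m) * (1 / 2 * H ^ m + 2 * M * H ^ m)"
      using t bm t0 H M by (intro add_left_mono mult_right_mono divide_left_mono) auto
    also have "(1 / b ^ m) * (1 / 2 * H ^ m + 2 * M * H ^ m) = (1 / 2 + 2 * M) * \<rho> ^ m"
      using H \<rho> by (simp add: b_def power_divide field_simps)
    finally show ?thesis by (simp add: K'_def algebra_simps)
  qed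
  define r where "r = - ln \<rho>"
  have r: "0 < r" using \<rho> by (simp add: r_def)
  define \<beta>' where "\<beta>' = r / (2 * ln b)"
  have lnb: "0 < ln b" using b by simp
  have \<beta>': "0 < \<beta>'" using r lnb by (simp add: \<beta>'_def)
  have "cmod (osc_integral (F 0) \<mu> l n t) \<le> sqrt K' * exp (r / 2) * \<bar>t\<bar> powr (- \<beta>')" if t: "1 \<le> \<bar>t\<bar>" for n t
  proof -
    define x where "x = ln \<bar>t\<bar> / ln b"
    have x: "0 \<le> x" using t lnb by (simp add: x_def)
    define m where "m = nat \<lfloor>x\<rfloor>"
    have m: "real m \<le> x" "x - 1 \<le> real m" using x by (auto simp: m_def)
    have "b ^ m \<le> \<bar>t\<bar>"
    proof -
      have "ln (b ^ m) \<le> ln \<bar>t\<bar>" using m(1) lnb b by (simp add: x_def ln_realpow field_simps)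
      thus ?thesis using b t by simp
    qed
    from square[OF this, of n] have "cmod (osc_integral (F 0) \<mu> l n t) \<le> sqrt (K' * \<rho> ^ m)"
      by (intro real_le_rsqrt)
    also have "\<dots> = sqrt K' * exp (- (r / 2) * real m)"
    proof -
      have "\<rho> ^ m = (exp (- (r / 2) * real m))^2"
      proof -
        have "\<rho> ^ m = exp (ln \<rho>) ^ m" using \<rho> by simp
        also have "\<dots> = exp (real m * ln \<rho>)" by (rule exp_of_nat_mult[symmetric])
        also have "real m * ln \<rho> = - (r / 2) * real m + - (r / 2) * real m" by (simp add: r_def)
        also have "exp \<dots> = (exp (- (r / 2) * real m))^2" by (simp only: exp_add power2_eq_square)
        finally show ?thesis .
      qed
      thus ?thesis by (simp add: real_sqrt_mult)
    qed
    also have "\<dots> \<le> sqrt K' * exp (- (r / 2) * (x - 1))"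
      using m(2) r K' by (intro mult_left_mono) auto
    also have "exp (- (r / 2) * (x - 1)) = exp (r / 2) * \<bar>t\<bar> powr (- \<beta>')"
    proof -
      have "- (r / 2) * (x - 1) = r / 2 + - \<beta>' * ln \<bar>t\<bar>"
        using lnb by (simp add: x_def \<beta>'_def field_simps)
      hence "exp (- (r / 2) * (x - 1)) = exp (r / 2) * exp (- \<beta>' * ln \<bar>t\<bar>)" by (simp only: exp_add)
      thus ?thesis using t by (auto simp: powr_def)
    qed
    finally show ?thesis by (simp add: mult.assoc)
  qed
  with \<beta>' show ?thesis by blast
qed

end

theorem theorem1p4:
  fixes \<phi> :: "real \<Rightarrow> real"
  assumes "real_analytic \<phi>"
    and "\<forall>x. \<phi> (x + 1) = \<phi> x"
    and "\<not> \<phi> constant_on UNIV"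
  shows "(\<forall>(\<mu>::real) (l::nat). 0 < \<mu> \<and> \<mu> < 1 \<and> 2 \<le> l \<longrightarrow>
            (\<exists>\<beta>::real. 0 < \<beta> \<and>
               (\<lambda>t. sup_osc \<phi> \<mu> l t) \<in> O[at_infinity](\<lambda>t. \<bar>t\<bar> powr (- \<beta>))))
       \<and> (\<exists>c::real. 0 < c \<and>
            (\<forall>\<mu>::real. 0 < \<mu> \<and> \<mu> < 1 \<longrightarrow>
               (\<exists>L::real. 2 \<le> L \<and>
                  (\<forall>l::nat. L \<le> real l \<longrightarrow>
                     (\<lambda>t. sup_osc \<phi> \<mu> l t)
                       \<in> O[at_infinity](\<lambda>t. \<bar>t\<bar> powr (- (c * (ln (real l) / \<bar>ln \<mu>\<bar>))))))))"
proof -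
  define F where "F p = (deriv ^^ p) \<phi>" for p
  have jet: "analytic_jet F"
    unfolding F_def using assms(1,2) by (intro real_analytic_periodic_jet) auto
  have F0: "F 0 = \<phi>" by (simp add: F_def)
  obtain u v where nonconst: "F 0 u \<noteq> F 0 v"
    using assms(3) unfolding F0 constant_on_def by blast
  note cont = jet_continuous[OF jet, of UNIV 0, unfolded F0]
  note per = jet_periodic[OF jet, of 0, unfolded F0]
  have part1: "\<exists>\<beta>::real. 0 < \<beta> \<and> (\<lambda>t. sup_osc \<phi> \<mu> l t) \<in> O[at_infinity](\<lambda>t. \<bar>t\<bar> powr (- \<beta>))"
    if \<mu>: "0 < \<mu>" "\<mu> < 1" and l: "2 \<le> l" for \<mu> l
  proof -
    obtain \<beta> C where \<beta>: "0 < \<beta>"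
      and bound: "\<And>n t. 1 \<le> \<bar>t\<bar> \<Longrightarrow> cmod (osc_integral \<phi> \<mu> l n t) \<le> C * \<bar>t\<bar> powr (- \<beta>)"
      using polynomial_decay[OF jet \<mu> l nonconst] unfolding F0 by blast
    from \<beta> sup_osc_bigo[OF cont per \<mu> bound] show ?thesis by blast
  qed
  obtain c where c: "0 < c" and decay: "\<And>\<mu>. 0 < \<mu> \<Longrightarrow> \<mu> < 1 \<Longrightarrow> \<exists>L\<ge>2. \<forall>l. L \<le> real l \<longrightarrow>
     (\<forall>n t. real l \<le> \<bar>t\<bar> \<longrightarrow> cmod (osc_integral \<phi> \<mu> l n t)
       \<le> real l powr (c * (1 + ln (real l) / \<bar>ln \<mu>\<bar>)) * \<bar>t\<bar> powr (- (c * (ln (real l) / \<bar>ln \<mu>\<bar>))))"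
    using large_base_decay[OF jet nonconst] unfolding F0 by blast
  have part2: "\<exists>L::real. 2 \<le> L \<and> (\<forall>l::nat. L \<le> real l \<longrightarrow> (\<lambda>t. sup_osc \<phi> \<mu> l t)
      \<in> O[at_infinity](\<lambda>t. \<bar>t\<bar> powr (- (c * (ln (real l) / \<bar>ln \<mu>\<bar>)))))"
    if \<mu>: "0 < \<mu>" "\<mu> < 1" for \<mu>
  proof -
    obtain L where L: "2 \<le> L" and bound: "\<And>l n t. L \<le> real l \<Longrightarrow> real l \<le> \<bar>t\<bar> \<Longrightarrow> cmod (osc_integral \<phi> \<mu> l n t)
       \<le> real l powr (c * (1 + ln (real l) / \<bar>ln \<mu>\<bar>)) * \<bar>t\<bar> powr (- (c * (ln (real l) / \<bar>ln \<mu>\<bar>)))"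
      using decay[OF \<mu>] by blast
    have "(\<lambda>t. sup_osc \<phi> \<mu> l t) \<in> O[at_infinity](\<lambda>t. \<bar>t\<bar> powr (- (c * (ln (real l) / \<bar>ln \<mu>\<bar>))))"
      if "L \<le> real l" for l
      by (rule sup_osc_bigo[OF cont per \<mu> bound[OF that]])
    with L show ?thesis by blast
  qed
  show ?thesis using part1 part2 c by blast
qed

end
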